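(* Consider either the ensemble of $N\times N$ real symmetric Toeplitz matrices or the ensemble of $N\times N$ singly palindromic real symmetric Toeplitz matrices, with independent entries drawn from a distribution with density $\mathfrak{p}$ having mean $0$, variance $1$ and finite higher moments, and let $\widetilde\mu$ be its limiting rescaled spectral measure. Fix $p\in[1/2,1]$ and consider the signed ensemble of Hadamard products $A\circ\mathcal{E}$, where $A$ is a matrix of the ensemble and $\mathcal{E}=(\epsilon_{ij})$ is a real symmetric sign matrix whose entries $\epsilon_{ij}$, $i\le j$, are chosen independently of each other and of $A$ from $\{-1,1\}$ with $\mathrm{Prob}(\epsilon_{ij}=1)=p$. Then for $p=1/2$ the limiting rescaled spectral measure of the signed ensemble is the semi-circle distribution. For all other $p$ (i.e. $p\in(1/2,1]$), the limiting signed rescaled spectral measure has bounded (resp. unbounded) support if $\widetilde\mu$ has bounded (resp. unbounded) support, and the convergence to it is almost sure if additionally the density $\mathfrak{p}$ is even.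
   Context: Real symmetric Toeplitz ensemble: $A=(a_{ij})_{1\le i,j\le N}$ with $a_{ij}=b_{|i-j|}$, where $b_0,\dots,b_{N-1}$ are i.i.d. with density $\mathfrak{p}$. Singly palindromic Toeplitz ensemble: $a_{ij}=b_{|i-j|}$, where in addition the first row is a palindrome, i.e. $b_s=b_{N-1-s}$ for $0\le s\le N-1$, the $b_s$ being otherwise i.i.d. with density $\mathfrak{p}$. The Hadamard product $A\circ B$ of $A=(a_{ij})$ and $B=(b_{ij})$ is the matrix with $(i,j)$ entry $a_{ij}b_{ij}$. The rescaled empirical spectral measure of a real symmetric $N\times N$ matrix $M$ with eigenvalues $\lambda_1(M),\dots,\lambda_N(M)$ is $\widetilde\mu_M=\frac1N\sum_{k=1}^N\delta_{\lambda_k(M)/\sqrt N}$. Limiting rescaled spectral measure of an ensemble: if for each positive integer $k$ the expected $k$-th moment $\mathbb{E}\int x^k\,d\widetilde\mu_M(x)$ converges as $N\to\infty$, and the limits are the moments of a uniquely determined measure, then that measure is called the limiting rescaled spectral measure of the ensemble. It is known to exist for both unsigned ensembles above. For the signed ensemble it is called the limiting signed rescaled spectral measure. The semi-circle distribution has density $\frac1\pi\sqrt{1-(x/2)^2}$ for $|x|\le2$ and $0$ otherwise; its odd moments vanish and its $2k$-th moment is the Catalan number $\frac1{k+1}\binom{2k}{k}$. *)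

theory Defs
  imports "HOL-Probability.Probability" "Jordan_Normal_Form.Char_Poly"
begin

text \<open>
  Matrices are those of \<^theory>\<open>Jordan_Normal_Form.Matrix\<close>, with rows and columns indexed from
  \<open>0\<close> to \<open>N - 1\<close>. All matrices of an ensemble, for all sizes \<open>N\<close> simultaneously, are read off
  from one infinite sequence of entries \<open>b\<close> and one infinite triangular array of signs \<open>e\<close>; this
  is the common probability space that almost sure convergence refers to.
\<close>

definition toeplitz :: "(nat \<Rightarrow> real) \<Rightarrow> nat \<Rightarrow> real mat" where
  "toeplitz b N = Matrix.mat N N (\<lambda>(i, j). b (nat \<bar>int i - int j\<bar>))"

text \<open>
  The identification \<open>b s = b (N - 1 - s)\<close> is imposed by always using the representative with the
  smaller index; so the free entries are those with index at most \<open>(N - 1) div 2\<close>.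
\<close>

definition palindromic_toeplitz :: "(nat \<Rightarrow> real) \<Rightarrow> nat \<Rightarrow> real mat" where
  "palindromic_toeplitz b N = toeplitz (\<lambda>s. b (min s (N - 1 - s))) N"

lemma palindromic_toeplitz_first_row:
  assumes "s < N"
  shows "palindromic_toeplitz b N $$ (0, s) = palindromic_toeplitz b N $$ (0, N - 1 - s)"
  using assms by (auto simp: palindromic_toeplitz_def toeplitz_def min_def intro!: arg_cong[of _ _ b])

text \<open>Only the values \<open>e i j\<close> with \<open>i \<le> j\<close> are used.\<close>

definition sign_matrix :: "(nat \<Rightarrow> nat \<Rightarrow> real) \<Rightarrow> nat \<Rightarrow> real mat" where
  "sign_matrix e N = Matrix.mat N N (\<lambda>(i, j). e (min i j) (max i j))"

definition hadamard :: "'a :: times mat \<Rightarrow> 'a mat \<Rightarrow> 'a mat" where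
  "hadamard A B = Matrix.mat (dim_row A) (dim_col A) (\<lambda>(i, j). A $$ (i, j) * B $$ (i, j))"

text \<open>
  The eigenvalues with multiplicity are the roots of the characteristic polynomial. For a real
  symmetric matrix all of them are real, so the multiset below has \<open>N\<close> elements, each given
  mass \<open>1 / N\<close>. The definition is meaningful only for such matrices, and for \<open>N > 0\<close>.
\<close>

definition rescaled_spectral_measure :: "real mat \<Rightarrow> real measure" where
  "rescaled_spectral_measure A =
     distr (measure_pmf (pmf_of_multiset (proots (char_poly A)))) borel
       (\<lambda>l. l / sqrt (real (dim_row A)))"

definition moment :: "real measure \<Rightarrow> nat \<Rightarrow> real" where
  "moment \<mu> k = (\<integral>x. x ^ k \<partial>\<mu>)"

definition moment_determined :: "real measure \<Rightarrow> bool" where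
  "moment_determined \<mu> \<longleftrightarrow>
     real_distribution \<mu> \<and> (\<forall>k\<ge>1. integrable \<mu> (\<lambda>x. x ^ k)) \<and>
     (\<forall>\<nu>. real_distribution \<nu> \<and>
          (\<forall>k\<ge>1. integrable \<nu> (\<lambda>x. x ^ k) \<and> moment \<nu> k = moment \<mu> k) \<longrightarrow> \<nu> = \<mu>)"

definition limiting_rescaled_spectral_measure ::
  "'w measure \<Rightarrow> (nat \<Rightarrow> 'w \<Rightarrow> real mat) \<Rightarrow> real measure \<Rightarrow> bool" where
  "limiting_rescaled_spectral_measure M A \<mu> \<longleftrightarrow>
     (\<forall>k\<ge>1. (\<lambda>N. \<integral>\<omega>. moment (rescaled_spectral_measure (A N \<omega>)) k \<partial>M) \<longlonglongrightarrow> moment \<mu> k) \<and>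
     moment_determined \<mu>"

text \<open>
  Both the moments and the measures themselves converge (the latter weakly), outside one null set.
\<close>

definition spectral_measures_converge_ae ::
  "'w measure \<Rightarrow> (nat \<Rightarrow> 'w \<Rightarrow> real mat) \<Rightarrow> real measure \<Rightarrow> bool" where
  "spectral_measures_converge_ae M A \<mu> \<longleftrightarrow>
     (AE \<omega> in M.
        (\<forall>k\<ge>1. (\<lambda>N. moment (rescaled_spectral_measure (A N \<omega>)) k) \<longlonglongrightarrow> moment \<mu> k) \<and>
        weak_conv_m (\<lambda>N. rescaled_spectral_measure (A N \<omega>)) \<mu>)"

definition semicircle :: "real measure" where
  "semicircle = density lborel
     (\<lambda>x. ennreal (if \<bar>x\<bar> \<le> 2 then 1 / pi * sqrt (1 - (x / 2)\<^sup>2) else 0))"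

definition measure_support :: "real measure \<Rightarrow> real set" where
  "measure_support \<mu> = {x. \<forall>U. open U \<and> x \<in> U \<longrightarrow> emeasure \<mu> U > 0}"

end

theory Submission
  imports Defs "Jordan_Normal_Form.Schur_Decomposition"
begin

text \<open>
  The expected \<open>m\<close>-th spectral moment is a normalised sum over closed walks of length \<open>m\<close>. The
  link functions of both ensembles say that two steps carry the same entry iff their increments
  agree up to sign and a multiple of \<open>N - 1\<close>, so in the limit only walks survive whose steps are
  matched in pairs with opposite increments. For a fixed pairing these walks are the lattice points
  of a dilated polytope, hence have a limiting density; the signs multiply its contribution by
  \<open>q\<close> to the number of edges traversed an odd number of times, where \<open>q = 2 p - 1\<close>.
  This number is at most \<open>m\<close>, so for even \<open>m\<close> the limit moment lies between \<open>q\<^sup>m\<close> times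
  and once the moment without signs. As boundedness of the support is equivalent to an exponential
  bound on the even moments, it is inherited in both directions if \<open>q > 0\<close>.

  Almost sure convergence follows from the method of moments, as the fourth central moment of each
  spectral moment is \<open>O(N\<^sup>-\<^sup>2)\<close> and hence summable.

  For \<open>q = 0\<close> only walks that traverse every edge an even number of times count. Those with the
  maximal number of vertices are the depth-first traversals of trees. They are counted by ballot
  numbers, which the three-term recursion of the Chebyshev polynomials of the second kind identifies
  with the moments of the semicircle.
\<close>

section \<open>Traces of powers and spectral moments\<close>

text \<open>The two kinds of randomness see different features of a walk: the entry at a step
  depends only on its increment, while the sign depends on which vertices coincide. For a limit to
  exist, both patterns must be constant on almost all walks of a fixed pairing. This works because
  every vertex is an affine form in the starting point and the increments on the \<open>k\<close>
  representatives: two such forms either agree identically, which defines the generic vertices, or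
  agree only on a set of lower dimension. Hence the densities of the pairings do not involve
  \<open>q\<close>, which enters only through the weights. The unsigned ensemble is the same locale
  with all signs 1 and \<open>q = 1\<close>, so both families of moments are weighted sums over the
  same configurations. That the limit moments determine a measure rests on a count: at most
  \<open>36 ^ k * k ^ k\<close> configurations, each of density at most \<open>3 ^ (k + 1)\<close>,
  and \<open>k ^ k\<close> is absorbed by the factorial of \<open>2 * k\<close>. The limit measure
  itself is obtained from a single outcome at which all spectral moments converge.\<close>

definition mat_trace :: "'a :: comm_monoid_add mat \<Rightarrow> 'a" where
  "mat_trace A = (\<Sum>i<dim_row A. A $$ (i, i))"

lemma mat_trace_mult_commute:
  fixes A B :: "'a :: comm_semiring_0 mat"
  assumes "A \<in> carrier_mat n m" "B \<in> carrier_mat m n"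
  shows "mat_trace (A * B) = mat_trace (B * A)"
proof -
  have "mat_trace (A * B) = (\<Sum>i<n. \<Sum>j<m. A $$ (i, j) * B $$ (j, i))"
    using assms unfolding mat_trace_def by (auto simp: scalar_prod_def lessThan_atLeast0 intro!: sum.cong)
  also have "\<dots> = (\<Sum>j<m. \<Sum>i<n. B $$ (j, i) * A $$ (i, j))"
    by (subst sum.swap) (simp add: mult.commute)
  also have "\<dots> = mat_trace (B * A)"
    using assms unfolding mat_trace_def by (auto simp: scalar_prod_def lessThan_atLeast0 intro!: sum.cong)
  finally show ?thesis .
qed

lemma mat_trace_similar:
  fixes A B :: "'a :: comm_ring_1 mat"
  assumes "similar_mat A B"
  shows "mat_trace A = mat_trace B"
proof -
  obtain n P Q where c: "{A, B, P, Q} \<subseteq> carrier_mat n n" and QP: "Q * P = 1\<^sub>m n"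
    and A: "A = P * B * Q"
    using assms unfolding similar_mat_def similar_mat_wit_def Let_def by metis
  have "mat_trace A = mat_trace (P * (B * Q))"
    using c unfolding A by (simp add: assoc_mult_mat[of P n n B n Q n])
  also have "\<dots> = mat_trace (B * Q * P)"
    using c by (intro mat_trace_mult_commute[of _ n n]) auto
  also have "B * Q * P = B" using c QP by (simp add: assoc_mult_mat[of B n n Q n P n] right_mult_one_mat[of B n n])
  finally show ?thesis .
qed

lemma upper_triangular_mult:
  fixes A B :: "'a :: comm_ring_1 mat"
  assumes A: "A \<in> carrier_mat n n" "upper_triangular A" and B: "B \<in> carrier_mat n n" "upper_triangular B"
  shows "upper_triangular (A * B) \<and> (\<forall>i<n. (A * B) $$ (i, i) = A $$ (i, i) * B $$ (i, i))"
proof -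
  have *: "(A * B) $$ (i, j) = (\<Sum>k<n. A $$ (i, k) * B $$ (k, j))" if "i < n" "j < n" for i j
    using that A B by (auto simp: scalar_prod_def lessThan_atLeast0 intro!: sum.cong)
  have A0: "A $$ (i, k) = 0" if "k < i" "i < n" for i k
    using that A by (auto simp: upper_triangular_def)
  have B0: "B $$ (i, k) = 0" if "k < i" "i < n" for i k
    using that B by (auto simp: upper_triangular_def)
  have "(A * B) $$ (i, j) = 0" if "j < i" "i < n" for i j
  proof -
    have "A $$ (i, k) * B $$ (k, j) = 0" if "k < n" for k
      using A0[of k i] B0[of j k] that \<open>j < i\<close> \<open>i < n\<close> by (cases "k < i") auto
    thus ?thesis using that by (subst *) auto
  qed
  moreover have "(A * B) $$ (i, i) = A $$ (i, i) * B $$ (i, i)" if "i < n" for i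
  proof -
    have "A $$ (i, k) * B $$ (k, i) = (if k = i then A $$ (i, i) * B $$ (i, i) else 0)" if "k < n" for k
      using A0[of k i] B0[of i k] that \<open>i < n\<close> by (cases "k < i"; cases "k = i") auto
    hence "(\<Sum>k<n. A $$ (i, k) * B $$ (k, i)) = (\<Sum>k<n. if k = i then A $$ (i, i) * B $$ (i, i) else 0)"
      by (intro sum.cong) auto
    thus ?thesis using that by (subst *) auto
  qed
  ultimately show ?thesis using A B by (auto simp: upper_triangular_def)
qed

lemma upper_triangular_power:
  fixes A :: "'a :: comm_ring_1 mat"
  assumes A: "A \<in> carrier_mat n n" "upper_triangular A"
  shows "upper_triangular (A ^\<^sub>m k) \<and> (\<forall>i<n. (A ^\<^sub>m k) $$ (i, i) = A $$ (i, i) ^ k)"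
proof (induction k)
  case 0
  show ?case using A by (auto simp: upper_triangular_def)
next
  case (Suc k)
  have "A ^\<^sub>m k \<in> carrier_mat n n" using A(1) by (rule pow_carrier_mat)
  thus ?case using upper_triangular_mult[OF _ _ A, of "A ^\<^sub>m k"] Suc by (simp add: mult.commute)
qed

text \<open>Over the complex numbers the characteristic polynomial splits. A root \<open>a\<close>
  has an eigenvector \<open>v\<close>, and the Hermitian form of \<open>A\<close> at
  \<open>v\<close> is real by symmetry and equals \<open>a\<close> times the positive squared norm
  of \<open>v\<close>, so \<open>a\<close> is real and the factorization descends.\<close>

lemma real_symmetric_char_poly_splits:
  fixes A :: "real mat"
  assumes A: "A \<in> carrier_mat n n" and sym: "\<And>i j. i < n \<Longrightarrow> j < n \<Longrightarrow> A $$ (i, j) = A $$ (j, i)"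
  shows "\<exists>es. char_poly A = (\<Prod>e\<leftarrow>es. [:- e, 1:]) \<and> length es = n"
proof -
  define C where "C = map_mat complex_of_real A"
  have C: "C \<in> carrier_mat n n" using A by (simp add: C_def)
  have cp: "char_poly C = map_poly complex_of_real (char_poly A)"
    unfolding C_def by (rule of_real_hom.char_poly_hom[OF A])
  obtain as where as: "char_poly C = (\<Prod>a\<leftarrow>as. [:- a, 1:])" and len: "length as = n"
    using char_poly_factorized[OF C] by blast
  have real: "a = complex_of_real (Re a)" if "a \<in> set as" for a
  proof -
    have "poly (char_poly C) a = 0"
      unfolding as using that by (auto simp: poly_prod_list prod_list_zero_iff)
    hence "eigenvalue C a" using eigenvalue_root_char_poly[OF C] by simp
    then obtain v where v: "v \<in> carrier_vec n" "v \<noteq> 0\<^sub>v n" "C *\<^sub>v v = a \<cdot>\<^sub>v v"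
      using C unfolding eigenvalue_def eigenvector_def by auto
    define Q where "Q = (\<Sum>i<n. (\<Sum>j<n. complex_of_real (A $$ (i, j)) * v $ j) * cnj (v $ i))"
    have "cnj Q = (\<Sum>i<n. \<Sum>j<n. complex_of_real (A $$ (i, j)) * cnj (v $ j) * v $ i)"
      by (simp add: Q_def sum_distrib_right)
    also have "\<dots> = (\<Sum>j<n. \<Sum>i<n. complex_of_real (A $$ (i, j)) * cnj (v $ j) * v $ i)"
      by (rule sum.swap)
    also have "\<dots> = Q" unfolding Q_def sum_distrib_right
      by (intro sum.cong refl) (auto simp: sym)
    finally have Qreal: "cnj Q = Q" .
    have "(\<Sum>j<n. complex_of_real (A $$ (i, j)) * v $ j) = a * v $ i" if "i < n" for i
    proof -
      have "(C *\<^sub>v v) $ i = (\<Sum>j<n. complex_of_real (A $$ (i, j)) * v $ j)"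
        using that A v(1) by (auto simp: C_def scalar_prod_def lessThan_atLeast0 intro!: sum.cong)
      thus ?thesis using v that by simp
    qed
    hence Qa: "Q = a * (\<Sum>i<n. v $ i * cnj (v $ i))"
      unfolding Q_def sum_distrib_left by (intro sum.cong) auto
    have n2: "(\<Sum>i<n. v $ i * cnj (v $ i)) = complex_of_real (\<Sum>i<n. (cmod (v $ i))\<^sup>2)"
      by (simp add: complex_norm_square[symmetric])
    have "(\<Sum>i<n. (cmod (v $ i))\<^sup>2) \<noteq> 0"
    proof
      assume "(\<Sum>i<n. (cmod (v $ i))\<^sup>2) = 0"
      hence "\<forall>i<n. v $ i = 0" by (subst (asm) sum_nonneg_eq_0_iff) auto
      thus False using v by (metis (no_types, lifting) carrier_vecD eq_vecI index_zero_vec(1) index_zero_vec(2))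
    qed
    hence "complex_of_real (\<Sum>i<n. (cmod (v $ i))\<^sup>2) \<noteq> 0" by (simp only: of_real_eq_0_iff not_False_eq_True)
    moreover have "cnj a * complex_of_real (\<Sum>i<n. (cmod (v $ i))\<^sup>2) = a * complex_of_real (\<Sum>i<n. (cmod (v $ i))\<^sup>2)"
      using Qreal unfolding Qa n2 by (simp only: complex_cnj_mult complex_cnj_complex_of_real)
    ultimately have "cnj a = a" by (meson mult_cancel_right)
    thus ?thesis by (metis Reals_cnj_iff of_real_Re)
  qed
  interpret map_poly_inj_idom_hom complex_of_real ..
  have "map_poly complex_of_real (char_poly A) = (\<Prod>a\<leftarrow>map complex_of_real (map Re as). [:- a, 1:])"
    unfolding cp[symmetric] as using real by (intro arg_cong[of _ _ prod_list]) (auto simp: map_idI)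
  also have "\<dots> = map_poly complex_of_real (\<Prod>e\<leftarrow>map Re as. [:- e, 1:])"
    by (simp add: hom_prod_list o_def)
  finally have "char_poly A = (\<Prod>e\<leftarrow>map Re as. [:- e, 1:])"
    by (simp only: eq_iff)
  thus ?thesis using len by (intro exI[of _ "map Re as"]) auto
qed

text \<open>Schur decomposition gives a similar triangular matrix with the roots on its diagonal;
  powers of triangular matrices act on the diagonal entrywise, and the trace is invariant under
  similarity.\<close>

lemma mat_trace_power_eq_sum_roots:
  fixes A :: "real mat"
  assumes A: "A \<in> carrier_mat n n" and es: "char_poly A = (\<Prod>e\<leftarrow>es. [:- e, 1:])"
  shows "mat_trace (A ^\<^sub>m k) = (\<Sum>e\<leftarrow>es. e ^ k)"
proof -
  obtain B P Q where "schur_decomposition A es = (B, P, Q)" by (cases "schur_decomposition A es")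
  from schur_decomposition[OF A es this]
  have sim: "similar_mat_wit A B P Q" and ut: "upper_triangular B" and diag: "diag_mat B = es" by auto
  have B: "B \<in> carrier_mat n n" using similar_mat_witD2[OF A sim] by auto
  have "similar_mat (A ^\<^sub>m k) (B ^\<^sub>m k)"
    using sim similar_mat_wit_pow[OF sim] unfolding similar_mat_def by blast
  hence "mat_trace (A ^\<^sub>m k) = mat_trace (B ^\<^sub>m k)" by (rule mat_trace_similar)
  also have "\<dots> = (\<Sum>i<n. B $$ (i, i) ^ k)"
    using upper_triangular_power[OF B ut] pow_carrier_mat[OF B, of k] by (auto simp: mat_trace_def)
  also have "\<dots> = (\<Sum>e\<leftarrow>diag_mat B. e ^ k)"
    using B by (auto simp: diag_mat_def sum_list_sum_nth lessThan_atLeast0)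
  finally show ?thesis unfolding diag .
qed

lemma sum_list_eq_sum_count:
  fixes f :: "'a \<Rightarrow> real"
  assumes "finite S" "set es \<subseteq> S"
  shows "(\<Sum>e\<leftarrow>es. f e) = (\<Sum>l\<in>S. real (count (mset es) l) * f l)"
  using assms(2)
proof (induction es)
  case (Cons e es)
  have "(\<Sum>l\<in>S. real (count (mset (e # es)) l) * f l)
      = (\<Sum>l\<in>S. real (count (mset es) l) * f l + (if l = e then f e else 0))"
    by (intro sum.cong) (auto simp: algebra_simps)
  also have "\<dots> = (\<Sum>l\<in>S. real (count (mset es) l) * f l) + f e"
    using assms(1) Cons.prems by (simp add: sum.distrib)
  finally show ?case using Cons by simp
qed auto

lemma real_distribution_rescaled_spectral_measure:
  "real_distribution (rescaled_spectral_measure A)"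
  unfolding rescaled_spectral_measure_def
  by (intro prob_space.real_distribution_distr prob_space_measure_pmf) auto

lemma moment_rescaled_spectral_measure:
  fixes A :: "real mat"
  assumes A: "A \<in> carrier_mat n n" and n: "n > 0"
    and sym: "\<And>i j. i < n \<Longrightarrow> j < n \<Longrightarrow> A $$ (i, j) = A $$ (j, i)"
  shows "integrable (rescaled_spectral_measure A) (\<lambda>x. x ^ k)" (is ?int)
    and "moment (rescaled_spectral_measure A) k = mat_trace (A ^\<^sub>m k) / (real n * sqrt (real n) ^ k)" (is ?mom)
proof -
  obtain es where es: "char_poly A = (\<Prod>e\<leftarrow>es. [:- e, 1:])" and len: "length es = n"
    using real_symmetric_char_poly_splits[OF A sym] by blast
  have proots: "proots (char_poly A) = mset es"
    unfolding es
  proof (induction es)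
    case (Cons e es)
    have "proots ([:- e, 1:] * (\<Prod>e\<leftarrow>es. [:- e, 1:])) = {#e#} + mset es"
      using Cons by (subst proots_mult) (auto simp: prod_list_zero_iff)
    thus ?case by simp
  qed auto
  define P where "P = pmf_of_multiset (mset es)"
  have ne: "mset es \<noteq> {#}" using len n by auto
  have setP: "set_pmf P = set es" unfolding P_def using ne by simp
  have fin: "finite (set_pmf P)" by (simp add: setP)
  have rsm: "rescaled_spectral_measure A = distr (measure_pmf P) borel (\<lambda>l. l / sqrt (real n))"
    using A unfolding rescaled_spectral_measure_def proots P_def by simp
  show ?int unfolding rsm
    by (subst integrable_distr_eq) (auto intro!: integrable_measure_pmf_finite fin)
  have "moment (rescaled_spectral_measure A) k = measure_pmf.expectation P (\<lambda>l. (l / sqrt (real n)) ^ k)"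
    unfolding moment_def rsm by (subst integral_distr) auto
  also have "\<dots> = (\<Sum>l\<in>set es. (l / sqrt (real n)) ^ k * pmf P l)"
    by (subst integral_measure_pmf_real[of "set es"]) (auto simp: setP)
  also have "\<dots> = (\<Sum>l\<in>set es. real (count (mset es) l) * (l ^ k)) / (real n * sqrt (real n) ^ k)"
    unfolding sum_divide_distrib P_def using ne len
    by (intro sum.cong) (auto simp: power_divide mult.commute)
  also have "(\<Sum>l\<in>set es. real (count (mset es) l) * (l ^ k)) = (\<Sum>e\<leftarrow>es. e ^ k)"
    by (rule sum_list_eq_sum_count[symmetric]) auto
  also have "\<dots> = mat_trace (A ^\<^sub>m k)" using mat_trace_power_eq_sum_roots[OF A es] by simp
  finally show ?mom .
qed

section \<open>The method of moments\<close>

text \<open>The order is taken even so that the absolute moment in the Taylor remainder is an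
  ordinary moment.\<close>

lemma char_taylor_bound:
  assumes "real_distribution M" and int: "\<And>k. integrable M (\<lambda>x. x ^ k)"
  shows "cmod (char M t - (\<Sum>k\<le>2 * K. ((\<i> * t) ^ k / fact k) * moment M k))
    \<le> 2 * (t ^ (2 * K) * moment M (2 * K) / fact (2 * K))"
proof -
  interpret real_distribution M by fact
  have "\<bar>t\<bar> ^ (2 * K) = t ^ (2 * K)" "\<And>x :: real. \<bar>x\<bar> ^ (2 * K) = x ^ (2 * K)"
    by (simp_all add: power_mult)
  thus ?thesis using char_approx1[of "2 * K" t] int by (simp add: moment_def)
qed

text \<open>Both characteristic functions are approximated by the same Taylor polynomials, with
  remainders that tend to 0 for every \<open>t\<close> by the growth condition. Hence they coincide,
  and Levy's uniqueness theorem applies.\<close>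

lemma moments_determine:
  assumes M1: "real_distribution M1" "\<And>k. integrable M1 (\<lambda>x. x ^ k)"
    and M2: "real_distribution M2" "\<And>k. integrable M2 (\<lambda>x. x ^ k)"
    and eq: "\<And>k. moment M1 k = moment M2 k"
    and growth: "\<And>t. (\<lambda>k. t ^ (2 * k) * moment M1 (2 * k) / fact (2 * k)) \<longlonglongrightarrow> 0"
  shows "M1 = M2"
proof (rule Levy_uniqueness[OF M1(1) M2(1)], rule ext)
  fix t
  have "cmod (char M1 t - char M2 t) \<le> 4 * (t ^ (2 * K) * moment M1 (2 * K) / fact (2 * K))" for K
  proof -
    define S where "S = (\<Sum>k\<le>2 * K. ((\<i> * t) ^ k / fact k) * moment M1 k)"
    have "cmod (char M1 t - S) \<le> 2 * (t ^ (2 * K) * moment M1 (2 * K) / fact (2 * K))"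
      unfolding S_def by (rule char_taylor_bound[OF M1])
    moreover have "cmod (char M2 t - S) \<le> 2 * (t ^ (2 * K) * moment M1 (2 * K) / fact (2 * K))"
      unfolding S_def eq by (rule char_taylor_bound[OF M2])
    ultimately show ?thesis
      using norm_triangle_ineq4[of "char M1 t - S" "char M2 t - S"] by simp
  qed
  moreover have "(\<lambda>K. 4 * (t ^ (2 * K) * moment M1 (2 * K) / fact (2 * K))) \<longlonglongrightarrow> 0"
    using tendsto_mult_left[OF growth[of t], of 4] by simp
  ultimately have "cmod (char M1 t - char M2 t) \<le> 0"
    using LIMSEQ_le_const by blast
  thus "char M1 t = char M2 t" by simp
qed

text \<open>Weak convergence only tests bounded continuous functions, so powers are taken of this
  continuous truncation.\<close>

definition clamp1 :: "real \<Rightarrow> real \<Rightarrow> real" where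
  "clamp1 R x = max (- R) (min R x)"

lemma isCont_clamp1_power: "isCont (\<lambda>x. clamp1 R x ^ k) x"
  unfolding clamp1_def by (intro continuous_intros)

lemma clamp1_measurable [measurable]: "clamp1 R \<in> borel_measurable borel"
  unfolding clamp1_def[abs_def] by measurable

lemma abs_clamp1_le: "R \<ge> 0 \<Longrightarrow> \<bar>clamp1 R x\<bar> \<le> R" "R \<ge> 0 \<Longrightarrow> \<bar>clamp1 R x\<bar> \<le> \<bar>x\<bar>"
  by (auto simp: clamp1_def)

lemma abs_clamp1_power_le: "R \<ge> 0 \<Longrightarrow> \<bar>clamp1 R x ^ k\<bar> \<le> R ^ k"
  unfolding power_abs by (intro power_mono abs_clamp1_le) auto

text \<open>The two powers differ only where \<open>x\<close> exceeds \<open>R\<close> in absolute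
  value, and there one factor of modulus at least \<open>R ^ k\<close> can be traded for another
  power of \<open>x\<close>. The truncation error is thus controlled by a higher moment, uniformly
  in the measure.\<close>

lemma power_clamp1_diff:
  assumes "R \<ge> 1"
  shows "\<bar>x ^ k - clamp1 R x ^ k\<bar> \<le> 2 * x ^ (2 * k) / R ^ k"
proof (cases "\<bar>x\<bar> \<le> R")
  case True
  hence "clamp1 R x = x" by (auto simp: clamp1_def)
  moreover have "0 \<le> x ^ (2 * k)" by (simp add: power_mult)
  ultimately show ?thesis using assms by simp
next
  case False
  have "\<bar>x ^ k - clamp1 R x ^ k\<bar> \<le> \<bar>x\<bar> ^ k + \<bar>clamp1 R x\<bar> ^ k"
    using abs_triangle_ineq4[of "x ^ k" "clamp1 R x ^ k"] by (simp add: power_abs)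
  also have "\<dots> \<le> 2 * \<bar>x\<bar> ^ k"
    using abs_clamp1_le(2)[of R x] assms power_mono[of "\<bar>clamp1 R x\<bar>" "\<bar>x\<bar>" k] by simp
  also have "\<bar>x\<bar> ^ k * R ^ k \<le> \<bar>x\<bar> ^ k * \<bar>x\<bar> ^ k"
    using False assms by (intro mult_left_mono power_mono) auto
  hence "2 * \<bar>x\<bar> ^ k \<le> 2 * (\<bar>x\<bar> ^ k * \<bar>x\<bar> ^ k) / R ^ k"
    using assms by (simp add: field_simps)
  also have "\<bar>x\<bar> ^ k * \<bar>x\<bar> ^ k = x ^ (2 * k)"
    by (simp add: power_mult_distrib[symmetric] power_mult power2_eq_square)
  finally show ?thesis .
qed

lemma clamp1_power_integrable:
  assumes "real_distribution M" "R \<ge> 0"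
  shows "integrable M (\<lambda>x. clamp1 R x ^ k)"
proof -
  interpret real_distribution M by fact
  show ?thesis using abs_clamp1_power_le[OF assms(2)]
    by (intro integrable_const_bound[of _ "R ^ k"]) auto
qed

lemma clamp1_moment_diff:
  assumes M: "real_distribution M" and int: "\<And>k. integrable M (\<lambda>x. x ^ k)" and R: "R \<ge> 1"
  shows "\<bar>moment M k - (\<integral>x. clamp1 R x ^ k \<partial>M)\<bar> \<le> 2 * moment M (2 * k) / R ^ k"
proof -
  have i: "integrable M (\<lambda>x. clamp1 R x ^ k)"
    using R by (intro clamp1_power_integrable[OF M]) auto
  have "\<bar>moment M k - (\<integral>x. clamp1 R x ^ k \<partial>M)\<bar> = \<bar>\<integral>x. x ^ k - clamp1 R x ^ k \<partial>M\<bar>"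
    unfolding moment_def by (subst Bochner_Integration.integral_diff) (use int i in auto)
  also have "\<dots> \<le> (\<integral>x. \<bar>x ^ k - clamp1 R x ^ k\<bar> \<partial>M)" by (rule integral_abs_bound)
  also have "\<dots> \<le> (\<integral>x. 2 * x ^ (2 * k) / R ^ k \<partial>M)"
    using int i power_clamp1_diff[OF R] by (intro integral_mono) auto
  finally show ?thesis by (simp add: moment_def)
qed

text \<open>Fatou's lemma bounds the even moments of the limit by those of the sequence, which gives
  integrability of all powers. Then the truncated moments converge weakly, and the truncation errors
  vanish uniformly as \<open>R\<close> grows.\<close>

lemma weak_conv_moments:
  assumes Ms: "\<And>n. real_distribution (Ms n)" "\<And>n k. integrable (Ms n) (\<lambda>x. x ^ k)"
    and lim: "\<And>k. (\<lambda>n. moment (Ms n) k) \<longlonglongrightarrow> m k"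
    and \<nu>: "real_distribution \<nu>" and wc: "weak_conv_m Ms \<nu>"
  shows "integrable \<nu> (\<lambda>x. x ^ k) \<and> moment \<nu> k = m k"
proof -
  interpret \<nu>: real_distribution \<nu> by fact
  have wcl: "(\<lambda>n. \<integral>x. clamp1 R x ^ k \<partial>Ms n) \<longlonglongrightarrow> (\<integral>x. clamp1 R x ^ k \<partial>\<nu>)" if "R \<ge> 0" for R k
    using that abs_clamp1_power_le[of R _ k]
    by (intro weak_conv_imp_integral_bdd_continuous_conv[OF Ms(1) \<nu> wc, where B = "R ^ k"] isCont_clamp1_power) auto
  have even_bound: "(\<integral>x. clamp1 R x ^ (2 * k) \<partial>\<nu>) \<le> m (2 * k)" if "R \<ge> 0" for R k
  proof (rule LIMSEQ_le[OF wcl[OF that] lim], intro exI allI impI)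
    fix n
    have "clamp1 R x ^ (2 * k) \<le> x ^ (2 * k)" for x
      using power_mono[OF abs_clamp1_le(2)[OF that], of x "2 * k"] by (simp add: power_mult)
    thus "(\<integral>x. clamp1 R x ^ (2 * k) \<partial>Ms n) \<le> moment (Ms n) (2 * k)"
      unfolding moment_def using clamp1_power_integrable[OF Ms(1) that] Ms(2) by (intro integral_mono) auto
  qed
  have even_int: "integrable \<nu> (\<lambda>x. x ^ (2 * k))" for k
  proof (rule integrableI_bounded)
    have "(\<integral>\<^sup>+ x. ennreal (norm (x ^ (2 * k))) \<partial>\<nu>)
        = (\<integral>\<^sup>+ x. liminf (\<lambda>n. ennreal (clamp1 (real n) x ^ (2 * k))) \<partial>\<nu>)"
    proof (rule nn_integral_cong)
      fix x :: real
      have "eventually (\<lambda>n. ennreal (clamp1 (real n) x ^ (2 * k)) = ennreal (norm (x ^ (2 * k)))) sequentially"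
        using eventually_ge_at_top[of "nat \<lceil>\<bar>x\<bar>\<rceil>"]
      proof eventually_elim
        case (elim n)
        hence "clamp1 (real n) x = x" unfolding clamp1_def by linarith
        thus ?case by (simp add: power_mult)
      qed
      hence "(\<lambda>n. ennreal (clamp1 (real n) x ^ (2 * k))) \<longlonglongrightarrow> ennreal (norm (x ^ (2 * k)))"
        by (rule tendsto_eventually)
      thus "ennreal (norm (x ^ (2 * k))) = liminf (\<lambda>n. ennreal (clamp1 (real n) x ^ (2 * k)))"
        by (rule lim_imp_Liminf[OF sequentially_bot, symmetric])
    qed
    also have "\<dots> \<le> liminf (\<lambda>n. \<integral>\<^sup>+ x. ennreal (clamp1 (real n) x ^ (2 * k)) \<partial>\<nu>)"
      by (rule nn_integral_liminf) auto
    also have "\<dots> \<le> ennreal (m (2 * k))"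
    proof -
      have "(\<integral>\<^sup>+ x. ennreal (clamp1 (real n) x ^ (2 * k)) \<partial>\<nu>) \<le> ennreal (m (2 * k))" for n
        using clamp1_power_integrable[OF \<nu>, of "real n" "2 * k"] even_bound[of "real n" k]
        by (subst nn_integral_eq_integral) (auto intro!: ennreal_leI simp: power_mult)
      thus ?thesis
        by (intro order.trans[OF Liminf_le_Limsup] Limsup_bounded) auto
    qed
    finally show "(\<integral>\<^sup>+ x. ennreal (norm (x ^ (2 * k))) \<partial>\<nu>) < \<infinity>"
      using ennreal_less_top le_less_trans by (metis infinity_ennreal_def)
  qed auto
  have int: "integrable \<nu> (\<lambda>x. x ^ k)" for k
  proof (rule Bochner_Integration.integrable_bound[of _ "\<lambda>x. 1 + x ^ (2 * k)"])
    have "norm (x ^ k) \<le> norm (1 + x ^ (2 * k))" for x :: real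
    proof -
      have "0 \<le> (\<bar>x ^ k\<bar> - 1)\<^sup>2" by simp
      moreover have "(\<bar>x ^ k\<bar>)\<^sup>2 = x ^ (2 * k)" by (simp add: power_mult[symmetric] mult.commute)
      moreover have "0 \<le> x ^ (2 * k)" by (simp add: power_mult)
      ultimately show ?thesis by (simp add: power2_diff)
    qed
    thus "AE x in \<nu>. norm (x ^ k) \<le> norm (1 + x ^ (2 * k))" by auto
  qed (use even_int in auto)
  show ?thesis
  proof (cases "k = 0")
    case True
    have "prob_space (Ms n)" for n using Ms(1)[of n] by (simp add: real_distribution_def)
    hence "moment (Ms n) 0 = 1" for n by (simp add: moment_def prob_space.prob_space)
    hence "m 0 = 1" using lim[of 0] by (simp add: LIMSEQ_const_iff)
    thus ?thesis using True \<nu>.prob_space by (simp add: moment_def)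
  next
    case k: False
    define D where "D = 2 * (m (2 * k) + moment \<nu> (2 * k))"
    have bd: "\<bar>moment \<nu> k - m k\<bar> \<le> D / R" if R: "R \<ge> 1" for R
    proof -
      have "\<bar>m k - (\<integral>x. clamp1 R x ^ k \<partial>\<nu>)\<bar> \<le> 2 * m (2 * k) / R ^ k"
      proof (rule LIMSEQ_le)
        show "(\<lambda>n. \<bar>moment (Ms n) k - (\<integral>x. clamp1 R x ^ k \<partial>Ms n)\<bar>) \<longlonglongrightarrow> \<bar>m k - (\<integral>x. clamp1 R x ^ k \<partial>\<nu>)\<bar>"
          using R by (intro tendsto_intros lim wcl) auto
        show "(\<lambda>n. 2 * moment (Ms n) (2 * k) / R ^ k) \<longlonglongrightarrow> 2 * m (2 * k) / R ^ k"
          using R by (intro tendsto_intros lim) auto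
        show "\<exists>N. \<forall>n\<ge>N. \<bar>moment (Ms n) k - (\<integral>x. clamp1 R x ^ k \<partial>Ms n)\<bar> \<le> 2 * moment (Ms n) (2 * k) / R ^ k"
          using clamp1_moment_diff[OF Ms R] by blast
      qed
      moreover have "\<bar>moment \<nu> k - (\<integral>x. clamp1 R x ^ k \<partial>\<nu>)\<bar> \<le> 2 * moment \<nu> (2 * k) / R ^ k"
        by (rule clamp1_moment_diff[OF \<nu> int R])
      ultimately have "\<bar>moment \<nu> k - m k\<bar> \<le> D / R ^ k" unfolding D_def by (simp add: add_divide_distrib distrib_left)
      also have "\<dots> \<le> D / R"
      proof (rule divide_left_mono)
        show "R \<le> R ^ k" using R k by (simp add: self_le_power)
        have "0 \<le> m (2 * k)" using even_bound[of 1 k] by (rule order.trans[rotated]) (auto simp: power_mult)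
        thus "0 \<le> D" unfolding D_def moment_def by (simp add: power_mult)
      qed (use R in auto)
      finally show ?thesis .
    qed
    have "(\<lambda>n. D / real (Suc n)) \<longlonglongrightarrow> 0" by (rule LIMSEQ_Suc[OF lim_const_over_n])
    hence "\<bar>moment \<nu> k - m k\<bar> \<le> 0" by (rule LIMSEQ_le_const) (use bd[of "real (Suc _)"] in auto)
    thus ?thesis using int by simp
  qed
qed

lemma second_moment_tight:
  assumes Ms: "\<And>n. real_distribution (Ms n)" "\<And>n. integrable (Ms n) (\<lambda>x. x ^ 2)"
    and bd: "\<And>n. moment (Ms n) 2 \<le> C"
  shows "tight Ms"
  unfolding tight_def
proof (intro conjI allI impI)
  fix \<epsilon> :: real assume \<epsilon>: "\<epsilon> > 0"
  \<comment> \<open>Chebyshev's inequality bounds the escaping mass by \<open>C / R\<^sup>2\<close>;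
    adding 1 to the modulus of \<open>C\<close> makes this strictly less than the given tolerance
    and keeps \<open>R\<close> positive.\<close>
  define R where "R = sqrt ((\<bar>C\<bar> + 1) / \<epsilon>)"
  have R: "R > 0" "R\<^sup>2 = (\<bar>C\<bar> + 1) / \<epsilon>" using \<epsilon> by (auto simp: R_def)
  have "measure (Ms n) {- R - 1<..R} > 1 - \<epsilon>" for n
  proof -
    interpret real_distribution "Ms n" by (rule Ms)
    have "measure (Ms n) (- {- R - 1<..R}) \<le> prob {x \<in> space (Ms n). R\<^sup>2 \<le> x ^ 2}"
    proof (intro finite_measure_mono subsetI)
      fix x assume "x \<in> - {- R - 1<..R}"
      hence "R \<le> \<bar>x\<bar>" using R(1) by auto
      thus "x \<in> {x \<in> space (Ms n). R\<^sup>2 \<le> x ^ 2}" using power_mono[of R "\<bar>x\<bar>" 2] R(1) by auto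
    qed auto
    also have "\<dots> \<le> expectation (\<lambda>x. x ^ 2) / R\<^sup>2"
      using R(1) Ms(2)[of n] by (intro integral_Markov_inequality_measure[where A = "{}"]) auto
    also have "\<dots> \<le> C / R\<^sup>2" using bd[of n] by (intro divide_right_mono) (auto simp: moment_def)
    also have "\<dots> < \<epsilon>"
    proof -
      have "C * \<epsilon> < (\<bar>C\<bar> + 1) * \<epsilon>" using \<epsilon> by (intro mult_strict_right_mono) auto
      thus ?thesis using \<epsilon> unfolding R(2) by (simp add: field_simps)
    qed
    finally show ?thesis using prob_compl[of "{- R - 1<..R}"] by (simp add: Compl_eq_Diff_UNIV)
  qed
  thus "\<exists>a b. a < b \<and> (\<forall>n. 1 - \<epsilon> < measure (Ms n) {a<..b})"
    using R by (intro exI[of _ "- R - 1"] exI[of _ R]) auto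
qed (rule Ms)

text \<open>The second moments give tightness, so subsequences converge weakly. Every weak limit has
  the moments \<open>m\<close>, and these determine it by the growth condition; hence all
  subsequential limits agree and the whole sequence converges.\<close>

theorem method_of_moments:
  assumes Ms: "\<And>n. real_distribution (Ms n)" "\<And>n k. integrable (Ms n) (\<lambda>x. x ^ k)"
    and lim: "\<And>k. (\<lambda>n. moment (Ms n) k) \<longlonglongrightarrow> m k"
    and growth: "\<And>t. (\<lambda>k. t ^ (2 * k) * m (2 * k) / fact (2 * k)) \<longlonglongrightarrow> 0"
  shows "\<exists>\<nu>. real_distribution \<nu> \<and> (\<forall>k. integrable \<nu> (\<lambda>x. x ^ k) \<and> moment \<nu> k = m k) \<and> weak_conv_m Ms \<nu>"
proof -
  obtain C where C: "\<And>n. norm (moment (Ms n) 2) \<le> C"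
    using convergent_imp_Bseq[OF convergentI[OF lim[of 2]]] unfolding Bseq_def by blast
  have tight: "tight Ms"
    by (rule second_moment_tight[OF Ms, where C = C]) (use C abs_le_D1 in auto)
  have sub: "(\<lambda>n. moment ((Ms \<circ> s) n) k) \<longlonglongrightarrow> m k" if "strict_mono s" for s k
    using LIMSEQ_subseq_LIMSEQ[OF lim[of k] that] by (simp add: o_def)
  obtain r \<nu> where r: "strict_mono r" and \<nu>: "real_distribution \<nu>" and "weak_conv_m (Ms \<circ> id \<circ> r) \<nu>"
    using tight_imp_convergent_subsubsequence[OF tight, of id] by (auto simp: strict_mono_def)
  hence wr: "weak_conv_m (Ms \<circ> r) \<nu>" by simp
  have \<nu>m: "integrable \<nu> (\<lambda>x. x ^ k) \<and> moment \<nu> k = m k" for k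
    by (rule weak_conv_moments[OF _ _ sub[OF r] \<nu> wr]) (auto intro: Ms)
  have "weak_conv_m Ms \<nu>"
  proof (rule tight_subseq_weak_converge[OF Ms(1) \<nu> tight])
    fix s \<nu>' assume s: "strict_mono s" and \<nu>': "real_distribution \<nu>'" and ws: "weak_conv_m (Ms \<circ> s) \<nu>'"
    have \<nu>'m: "integrable \<nu>' (\<lambda>x. x ^ k) \<and> moment \<nu>' k = m k" for k
      by (rule weak_conv_moments[OF _ _ sub[OF s] \<nu>' ws]) (auto intro: Ms)
    have "\<nu>' = \<nu>" by (rule moments_determine) (use \<nu> \<nu>' \<nu>m \<nu>'m growth in auto)
    thus "weak_conv_m (Ms \<circ> s) \<nu>" using ws by simp
  qed
  thus ?thesis using \<nu> \<nu>m by blast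
qed

text \<open>Forwards, the complement of the support is a null set because, by Lindelof, countably
  many null open sets cover it. Backwards, Markov's inequality with exponent \<open>2 * k\<close>
  makes the mass outside a radius larger than \<open>R\<close> decay geometrically in
  \<open>k\<close>, so it is 0.\<close>

lemma bounded_support_iff_moments:
  assumes \<nu>: "real_distribution \<nu>" and int: "\<And>k. integrable \<nu> (\<lambda>x. x ^ k)"
  shows "bounded (measure_support \<nu>) \<longleftrightarrow> (\<exists>R. \<forall>k. moment \<nu> (2 * k) \<le> R ^ (2 * k))"
proof
  interpret real_distribution \<nu> by fact
  assume "bounded (measure_support \<nu>)"
  then obtain R where R: "\<And>x. x \<in> measure_support \<nu> \<Longrightarrow> \<bar>x\<bar> \<le> R"
    unfolding bounded_iff by auto
  define F where "F = {U. open U \<and> emeasure \<nu> U = 0}"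
  obtain F' where F': "F' \<subseteq> F" "countable F'" "\<Union>F' = \<Union>F"
    using Lindelof[of F] unfolding F_def by auto
  have "emeasure \<nu> (\<Union>F') = 0"
  proof -
    have "(\<Union>U\<in>F'. U) \<in> null_sets \<nu>"
      using F' by (intro null_sets_UN') (auto simp: F_def null_sets_def)
    thus ?thesis by auto
  qed
  moreover have "x \<in> \<Union>F" if "\<not> \<bar>x\<bar> \<le> R" for x
    using R[of x] that unfolding measure_support_def F_def by (force simp: not_gr_zero)
  moreover have "\<Union>F' \<in> sets \<nu>" using F' unfolding F_def by (intro sets.countable_Union) auto
  ultimately have AE: "AE x in \<nu>. \<bar>x\<bar> \<le> R"
    unfolding F'(3)[symmetric] by (intro AE_I[of _ _ "\<Union>F'"]) auto
  have "moment \<nu> (2 * k) \<le> \<bar>R\<bar> ^ (2 * k)" for k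
  proof -
    have "moment \<nu> (2 * k) \<le> (\<integral>x. \<bar>R\<bar> ^ (2 * k) \<partial>\<nu>)"
      unfolding moment_def
    proof (intro integral_mono_AE int)
      show "AE x in \<nu>. x ^ (2 * k) \<le> \<bar>R\<bar> ^ (2 * k)"
        using AE
      proof eventually_elim
        case (elim x)
        thus ?case using power_mono[of "\<bar>x\<bar>" "\<bar>R\<bar>" "2 * k"] by (simp add: power_mult)
      qed
    qed auto
    thus ?thesis using prob_space by simp
  qed
  thus "\<exists>R. \<forall>k. moment \<nu> (2 * k) \<le> R ^ (2 * k)" by blast
next
  interpret real_distribution \<nu> by fact
  assume "\<exists>R. \<forall>k. moment \<nu> (2 * k) \<le> R ^ (2 * k)"
  then obtain R where R: "\<And>k. moment \<nu> (2 * k) \<le> R ^ (2 * k)" by blast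
  have "\<bar>x\<bar> \<le> \<bar>R\<bar>" if x: "x \<in> measure_support \<nu>" for x
  proof (rule ccontr)
    assume "\<not> \<bar>x\<bar> \<le> \<bar>R\<bar>"
    \<comment> \<open>A radius strictly between: larger than \<open>R\<close> for geometric decay,
      smaller than the modulus of \<open>x\<close> so that \<open>x\<close> lies in the open set
      \<open>U\<close>.\<close>
    define r where "r = (\<bar>x\<bar> + \<bar>R\<bar>) / 2"
    have r: "\<bar>R\<bar> < r" "r < \<bar>x\<bar>" "r > 0" using \<open>\<not> \<bar>x\<bar> \<le> \<bar>R\<bar>\<close> by (auto simp: r_def)
    define U where "U = {y :: real. r < \<bar>y\<bar>}"
    have U: "open U" unfolding U_def by (intro open_Collect_less continuous_intros)
    have "prob U \<le> ((\<bar>R\<bar> / r)\<^sup>2) ^ k" for k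
    proof -
      have "prob U \<le> prob {x \<in> space \<nu>. r ^ (2 * k) \<le> x ^ (2 * k)}"
      proof (intro finite_measure_mono subsetI)
        fix y assume "y \<in> U"
        thus "y \<in> {x \<in> space \<nu>. r ^ (2 * k) \<le> x ^ (2 * k)}"
          using power_mono[of r "\<bar>y\<bar>" "2 * k"] r(3) by (simp add: U_def power_mult)
      qed auto
      also have "\<dots> \<le> expectation (\<lambda>x. x ^ (2 * k)) / r ^ (2 * k)"
        using r by (intro integral_Markov_inequality_measure[where A = "{}"]) (use int[of "2 * k"] in \<open>auto simp: power_mult\<close>)
      also have "\<dots> \<le> R ^ (2 * k) / r ^ (2 * k)"
        using R[of k] r by (intro divide_right_mono) (auto simp: moment_def)
      finally show ?thesis by (simp add: power_divide power_mult)
    qed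
    moreover have "(\<lambda>k. ((\<bar>R\<bar> / r)\<^sup>2) ^ k) \<longlonglongrightarrow> 0"
      using r by (intro LIMSEQ_realpow_zero) (auto simp: power_less_one_iff)
    ultimately have "prob U \<le> 0" using LIMSEQ_le_const by blast
    hence "emeasure \<nu> U = 0" by (simp add: emeasure_eq_measure measure_le_0_iff)
    moreover have "x \<in> U" using r by (simp add: U_def)
    hence "emeasure \<nu> U > 0" using x U unfolding measure_support_def by blast
    ultimately show False by simp
  qed
  thus "bounded (measure_support \<nu>)" unfolding bounded_iff by auto
qed

section \<open>Lattice points of dilated polytopes\<close>

text \<open>Signed, because most coordinates will be increments, and half-open, so that the box of
  size \<open>q * M\<close> is tiled exactly by cells of side \<open>q\<close> indexed by the box of
  size \<open>M\<close>.\<close>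

definition int_box :: "'j set \<Rightarrow> nat \<Rightarrow> ('j \<Rightarrow> int) set" where
  "int_box J N = J \<rightarrow>\<^sub>E {- int N..<int N}"

text \<open>The constant term scales with \<open>N - 1\<close>, which is both the largest vertex and
  the period in the palindromic link.\<close>

definition form_val :: "'j set \<Rightarrow> nat \<Rightarrow> ('j \<Rightarrow> int) \<times> int \<Rightarrow> ('j \<Rightarrow> int) \<Rightarrow> int" where
  "form_val J N l y = (\<Sum>j\<in>J. fst l j * y j) + snd l * (int N - 1)"

definition lattice_points :: "'j set \<Rightarrow> (('j \<Rightarrow> int) \<times> int) set \<Rightarrow> nat \<Rightarrow> ('j \<Rightarrow> int) set" where
  "lattice_points J L N = {y \<in> int_box J N. \<forall>l\<in>L. 0 \<le> form_val J N l y}"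

lemma finite_int_box: "finite J \<Longrightarrow> finite (int_box J N)"
  unfolding int_box_def by (intro finite_PiE) auto

lemma card_int_box: "finite J \<Longrightarrow> card (int_box J N) = (2 * N) ^ card J"
  unfolding int_box_def by (subst card_PiE) (auto simp: nat_mult_distrib power_mult_distrib)

text \<open>The coordinate \<open>j0\<close> is determined by the others, so restriction to the
  others is injective.\<close>

lemma card_hyperplane_le:
  assumes J: "finite J" "j0 \<in> J" "\<alpha> j0 \<noteq> 0"
  shows "card {y \<in> int_box J N. (\<Sum>j\<in>J. \<alpha> j * y j) = v} \<le> (2 * N) ^ (card J - 1)"
proof -
  let ?S = "{y \<in> int_box J N. (\<Sum>j\<in>J. \<alpha> j * y j) = v}"
  have "card ?S \<le> card (int_box (J - {j0}) N)"
  proof (rule card_inj_on_le)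
    show "inj_on (\<lambda>y. restrict y (J - {j0})) ?S"
    proof (rule inj_onI)
      fix y y' assume y: "y \<in> ?S" and y': "y' \<in> ?S"
        and eq: "restrict y (J - {j0}) = restrict y' (J - {j0})"
      have eq': "y j = y' j" if "j \<in> J - {j0}" for j
        using fun_cong[OF eq, of j] that by simp
      hence "(\<Sum>j\<in>J - {j0}. \<alpha> j * y j) = (\<Sum>j\<in>J - {j0}. \<alpha> j * y' j)" by (intro sum.cong) auto
      moreover have "(\<Sum>j\<in>J. \<alpha> j * y j) = (\<Sum>j\<in>J. \<alpha> j * y' j)" using y y' by simp
      ultimately have "\<alpha> j0 * y j0 = \<alpha> j0 * y' j0" using J by (simp add: sum.remove)
      hence "y j0 = y' j0" using J by simp
      thus "y = y'" using y y' eq' unfolding int_box_def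
        by (intro PiE_ext[of y J "\<lambda>_. {- int N..<int N}" y']) auto
    qed
    show "(\<lambda>y. restrict y (J - {j0})) ` ?S \<subseteq> int_box (J - {j0}) N"
      unfolding int_box_def
      by (intro image_subsetI restrict_PiE_iff[THEN iffD2] ballI) (auto dest: PiE_mem)
  qed (use J in \<open>auto intro: finite_int_box\<close>)
  also have "\<dots> = (2 * N) ^ (card J - 1)" using J by (simp add: card_int_box)
  finally show ?thesis .
qed

lemma card_slab_le:
  assumes J: "finite J" "j0 \<in> J" "\<alpha> j0 \<noteq> 0"
  shows "card {y \<in> int_box J N. (\<Sum>j\<in>J. \<alpha> j * y j) + e \<in> {a..b}} \<le> nat (b - a + 1) * (2 * N) ^ (card J - 1)"
proof -
  have "{y \<in> int_box J N. (\<Sum>j\<in>J. \<alpha> j * y j) + e \<in> {a..b}}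
      = (\<Union>v\<in>{a - e..b - e}. {y \<in> int_box J N. (\<Sum>j\<in>J. \<alpha> j * y j) = v})" by auto
  also have "card \<dots> \<le> (\<Sum>v\<in>{a - e..b - e}. card {y \<in> int_box J N. (\<Sum>j\<in>J. \<alpha> j * y j) = v})"
    by (intro card_UN_le) auto
  also have "\<dots> \<le> (\<Sum>v\<in>{a - e..b - e}. (2 * N) ^ (card J - 1))"
    by (intro sum_mono card_hyperplane_le[where \<alpha> = \<alpha> and ?j0.0 = j0, OF J])
  finally show ?thesis by simp
qed

text \<open>The members at \<open>M\<close> and at \<open>N\<close> are compared through the common
  multiple \<open>M * N\<close>, which yields a Cauchy sequence without any candidate for the limit
  such as a volume.\<close>

lemma convergent_if_dilation_stable:
  fixes a :: "nat \<Rightarrow> real"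
  assumes "\<And>M q. M \<ge> 1 \<Longrightarrow> q \<ge> 1 \<Longrightarrow> \<bar>a (q * M) - a M\<bar> \<le> B / real M"
  shows "convergent a"
proof -
  have "0 \<le> B" using assms[of 1 1] by simp
  have close: "\<bar>a M - a N\<bar> \<le> B / real M + B / real N" if "M \<ge> 1" "N \<ge> 1" for M N
    using assms[of M N] assms[of N M] that by (simp add: mult.commute)
  have "Cauchy a"
  proof (rule metric_CauchyI)
    fix e :: real assume e: "e > 0"
    obtain n0 :: nat where n0: "2 * B / e < real n0" using reals_Archimedean2 by blast
    have small: "B / real M < e / 2" if "M \<ge> Suc n0" for M
    proof -
      have "2 * B / e < real M" using n0 that by linarith
      thus ?thesis using e that by (simp add: field_simps)
    qed
    have "dist (a M) (a N) < e" if "M \<ge> Suc n0" "N \<ge> Suc n0" for M N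
      using close[of M N] small[OF that(1)] small[OF that(2)] that unfolding dist_real_def by linarith
    thus "\<exists>M. \<forall>m\<ge>M. \<forall>n\<ge>M. dist (a m) (a n) < e" by blast
  qed
  thus ?thesis by (rule Cauchy_convergent)
qed

text \<open>
  The boundary of the polytope cut out by the forms meets only \<open>O(M\<^bsup>d-1\<^esup>)\<close> cells of the
  grid of mesh \<open>q\<close> in the box of size \<open>q M\<close>, which makes the densities a Cauchy sequence.
\<close>

lemma lattice_points_dilation:
  assumes J: "finite J" and L: "finite L" and nz: "\<And>l. l \<in> L \<Longrightarrow> \<exists>j\<in>J. fst l j \<noteq> 0"
    and K: "\<And>l. l \<in> L \<Longrightarrow> (\<Sum>j\<in>J. \<bar>fst l j\<bar>) + \<bar>snd l\<bar> \<le> K"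
    and M: "M \<ge> 1" and q: "q \<ge> 1"
  shows "\<bar>real (card (lattice_points J L (q * M))) / real (q * M) ^ card J
           - real (card (lattice_points J L M)) / real M ^ card J\<bar>
         \<le> (real (card L) * real (nat (2 * K + 1)) * 2 ^ card J) / real M"
proof -
  define d where "d = card J"
  define fib where "fib z = (\<Pi>\<^sub>E j\<in>J. {int q * z j..<int q * z j + int q})" for z :: "'a \<Rightarrow> int"
  \<comment> \<open>Only these cells can be cut by the boundary: across a cell a form deviates from
    \<open>q\<close> times its value at \<open>z\<close> by at most \<open>K * q\<close>, so a value
    beyond \<open>K\<close> in modulus fixes the sign on the whole cell.\<close>
  define bad where "bad = {z \<in> int_box J M. \<exists>l\<in>L. form_val J M l z \<in> {- K..K}}"
  define P where "P N = lattice_points J L N" for N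
  have fin: "finite (fib z)" for z unfolding fib_def using J by (intro finite_PiE) auto
  have cfib: "card (fib z) = q ^ d" for z
    unfolding fib_def d_def using J by (subst card_PiE) auto
  have fib_iff: "y \<in> fib z \<longleftrightarrow> y \<in> extensional J \<and> (\<forall>j\<in>J. y j div int q = z j)" for y z
  proof -
    have "(a \<in> {int q * b..<int q * b + int q}) \<longleftrightarrow> a div int q = b" for a b
    proof
      assume "a \<in> {int q * b..<int q * b + int q}"
      thus "a div int q = b" using q by (intro int_div_pos_eq[of _ _ _ "a - int q * b"]) auto
    next
      assume b: "a div int q = b"
      have "0 \<le> a mod int q" "a mod int q < int q" using q by auto
      thus "a \<in> {int q * b..<int q * b + int q}" using mult_div_mod_eq[of "int q" a] b by auto
    qed
    thus ?thesis unfolding fib_def PiE_iff by auto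
  qed
  have box_fib: "y \<in> int_box J (q * M) \<longleftrightarrow> z \<in> int_box J M" if "y \<in> fib z" "z \<in> extensional J" for y z
  proof -
    have "(y j \<in> {- int (q * M)..<int (q * M)}) \<longleftrightarrow> z j \<in> {- int M..<int M}" if j: "j \<in> J" for j
    proof -
      have yj: "int q * z j \<le> y j" "y j < int q * z j + int q"
        using \<open>y \<in> fib z\<close> j unfolding fib_def by (auto simp: PiE_iff)
      have mono: "int q * a \<le> int q * b" if "a \<le> b" for a b using that by (rule mult_left_mono) simp
      show ?thesis
      proof
        assume y: "y j \<in> {- int (q * M)..<int (q * M)}"
        have "\<not> z j + 1 \<le> - int M"
        proof
          assume "z j + 1 \<le> - int M"
          from mono[OF this] show False using y yj unfolding of_nat_mult distrib_left atLeastLessThan_iff by linarith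
        qed
        moreover have "\<not> int M \<le> z j"
        proof
          assume "int M \<le> z j"
          from mono[OF this] have "y j < y j" using y yj unfolding of_nat_mult atLeastLessThan_iff by linarith
          thus False by simp
        qed
        ultimately show "z j \<in> {- int M..<int M}" by auto
      next
        assume "z j \<in> {- int M..<int M}"
        hence "z j + 1 \<le> int M" "- int M \<le> z j" by auto
        from this[THEN mono] show "y j \<in> {- int (q * M)..<int (q * M)}"
          using yj unfolding of_nat_mult distrib_left atLeastLessThan_iff by linarith
      qed
    qed
    moreover have "y \<in> extensional J" using that(1) by (simp add: fib_iff)
    ultimately show ?thesis using that(2) unfolding int_box_def PiE_iff by blast
  qed
  have form: "\<bar>form_val J (q * M) l y - int q * form_val J M l z\<bar> \<le> K * int q"
    if "y \<in> fib z" "l \<in> L" for y z l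
  proof -
    have r: "\<bar>y j - int q * z j\<bar> \<le> int q" if "j \<in> J" for j
      using \<open>y \<in> fib z\<close> that unfolding fib_def by (auto simp: PiE_iff)
    have "form_val J (q * M) l y - int q * form_val J M l z
        = (\<Sum>j\<in>J. fst l j * (y j - int q * z j)) + snd l * (int q - 1)"
      by (simp add: form_val_def algebra_simps sum_subtractf sum_distrib_left)
    also have "\<bar>\<dots>\<bar> \<le> (\<Sum>j\<in>J. \<bar>fst l j\<bar> * int q) + \<bar>snd l\<bar> * int q"
    proof (rule order.trans[OF abs_triangle_ineq], rule add_mono)
      show "\<bar>\<Sum>j\<in>J. fst l j * (y j - int q * z j)\<bar> \<le> (\<Sum>j\<in>J. \<bar>fst l j\<bar> * int q)"
        by (rule order.trans[OF sum_abs], rule sum_mono) (auto simp: abs_mult intro!: mult_left_mono r)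
      show "\<bar>snd l * (int q - 1)\<bar> \<le> \<bar>snd l\<bar> * int q"
        using q by (auto simp: abs_mult intro!: mult_left_mono)
    qed
    also have "\<dots> = ((\<Sum>j\<in>J. \<bar>fst l j\<bar>) + \<bar>snd l\<bar>) * int q"
      unfolding distrib_right sum_distrib_right by simp
    also have "\<dots> \<le> K * int q" using K[OF that(2)] by (intro mult_right_mono) auto
    finally show ?thesis .
  qed
  have decide: "(y \<in> P (q * M)) \<longleftrightarrow> z \<in> P M" if z: "z \<in> int_box J M" "z \<notin> bad" and y: "y \<in> fib z" for y z
  proof -
    have "(0 \<le> form_val J (q * M) l y) \<longleftrightarrow> 0 \<le> form_val J M l z" if l: "l \<in> L" for l
    proof -
      let ?a = "form_val J M l z"
      have nb: "\<not> (- K \<le> ?a \<and> ?a \<le> K)" using z l unfolding bad_def by auto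
      have "0 \<le> (\<Sum>j\<in>J. \<bar>fst l j\<bar>)" by (intro sum_nonneg) auto
      hence "0 \<le> K" using K[OF l] by linarith
      consider "?a \<ge> K + 1" | "?a \<le> - K - 1" using nb by linarith
      thus ?thesis
      proof cases
        case 1
        hence "int q * (K + 1) \<le> int q * ?a" by (intro mult_left_mono) auto
        thus ?thesis using form[OF y l] 1 \<open>0 \<le> K\<close> q by (auto simp: algebra_simps)
      next
        case 2
        hence "int q * ?a \<le> int q * (- K - 1)" by (intro mult_left_mono) auto
        thus ?thesis using form[OF y l] 2 \<open>0 \<le> K\<close> q by (auto simp: algebra_simps)
      qed
    qed
    moreover have "y \<in> int_box J (q * M)"
      using box_fib[OF y] z(1) unfolding int_box_def by (auto simp: PiE_iff)
    ultimately show ?thesis using z(1) unfolding P_def lattice_points_def by auto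
  qed
  have disj: "fib z \<inter> fib z' = {}" if "z \<in> int_box J M" "z' \<in> int_box J M" "z \<noteq> z'" for z z'
  proof (rule ccontr)
    assume "fib z \<inter> fib z' \<noteq> {}"
    then obtain y where "y \<in> fib z" "y \<in> fib z'" by auto
    hence "\<forall>j\<in>J. z j = z' j" by (auto simp: fib_iff)
    hence "z = z'" using that(1,2) unfolding int_box_def by (intro PiE_ext) auto
    thus False using that by simp
  qed
  have finM: "finite (int_box J M)" using J by (rule finite_int_box)
  have finP: "finite (P N)" for N unfolding P_def lattice_points_def using finite_int_box[OF J] by auto
  have "P (q * M) = (\<Union>z\<in>int_box J M. P (q * M) \<inter> fib z)"
  proof (intro equalityI subsetI)
    fix y assume y: "y \<in> P (q * M)"
    define z where "z = (\<lambda>j\<in>J. y j div int q)"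
    have "y \<in> extensional J" using y by (auto simp: P_def lattice_points_def int_box_def PiE_iff)
    hence yz: "y \<in> fib z" by (auto simp: fib_iff z_def)
    moreover have "z \<in> int_box J M"
      using box_fib[OF yz] y by (auto simp: P_def lattice_points_def z_def)
    ultimately show "y \<in> (\<Union>z\<in>int_box J M. P (q * M) \<inter> fib z)" using y by blast
  qed auto
  hence "card (P (q * M)) = card (\<Union>z\<in>int_box J M. P (q * M) \<inter> fib z)" by (rule arg_cong)
  also have "\<dots> = (\<Sum>z\<in>int_box J M. card (P (q * M) \<inter> fib z))"
  proof (rule card_UN_disjoint[OF finM])
    show "\<forall>z\<in>int_box J M. finite (P (q * M) \<inter> fib z)" by (intro ballI finite_Int disjI1 finP)
    show "\<forall>z\<in>int_box J M. \<forall>z'\<in>int_box J M. z \<noteq> z' \<longrightarrow> P (q * M) \<inter> fib z \<inter> (P (q * M) \<inter> fib z') = {}"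
    proof (intro ballI impI)
      fix z z' assume "z \<in> int_box J M" "z' \<in> int_box J M" "z \<noteq> z'"
      thus "P (q * M) \<inter> fib z \<inter> (P (q * M) \<inter> fib z') = {}" using disj[of z z'] by blast
    qed
  qed
  finally have 1: "real (card (P (q * M))) = (\<Sum>z\<in>int_box J M. real (card (P (q * M) \<inter> fib z)))"
    by (simp only: of_nat_sum)
  have 2: "real q ^ d * real (card (P M)) = (\<Sum>z\<in>int_box J M. if z \<in> P M then real q ^ d else 0)"
  proof -
    have "{z \<in> int_box J M. z \<in> P M} = P M" by (auto simp: P_def lattice_points_def)
    thus ?thesis by (simp add: sum.inter_filter[OF finM, symmetric])
  qed
  have 3: "real q ^ d * real (card bad) = (\<Sum>z\<in>int_box J M. if z \<in> bad then real q ^ d else 0)"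
  proof -
    have "{z \<in> int_box J M. z \<in> bad} = bad" by (auto simp: bad_def)
    thus ?thesis by (simp add: sum.inter_filter[OF finM, symmetric])
  qed
  have "\<bar>real (card (P (q * M))) - real q ^ d * real (card (P M))\<bar> \<le> real q ^ d * real (card bad)"
    unfolding 1 2 3 sum_subtractf[symmetric]
  proof (rule order.trans[OF sum_abs], rule sum_mono)
    fix z assume z: "z \<in> int_box J M"
    have le: "real (card (P (q * M) \<inter> fib z)) \<le> real q ^ d"
      using card_mono[OF fin[of z], of "P (q * M) \<inter> fib z"] cfib[of z] by (simp flip: of_nat_power)
    show "\<bar>real (card (P (q * M) \<inter> fib z)) - (if z \<in> P M then real q ^ d else 0)\<bar>
        \<le> (if z \<in> bad then real q ^ d else 0)"
    proof (cases "z \<in> bad")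
      case False
      have "P (q * M) \<inter> fib z = (if z \<in> P M then fib z else {})"
        using decide[OF z False] by auto
      thus ?thesis using False cfib[of z] by simp
    qed (use le in auto)
  qed
  also have "real (card bad) \<le> real (card L) * real (nat (2 * K + 1)) * real (2 * M) ^ (d - 1)"
  proof -
    have "bad = (\<Union>l\<in>L. {z \<in> int_box J M. form_val J M l z \<in> {- K..K}})" by (auto simp: bad_def)
    hence "card bad \<le> (\<Sum>l\<in>L. card {z \<in> int_box J M. form_val J M l z \<in> {- K..K}})"
      using L by (simp add: card_UN_le)
    also have "\<dots> \<le> (\<Sum>l\<in>L. nat (2 * K + 1) * (2 * M) ^ (d - 1))"
    proof (rule sum_mono)
      fix l assume "l \<in> L"
      then obtain j0 where "j0 \<in> J" "fst l j0 \<noteq> 0" using nz by blast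
      from card_slab_le[where \<alpha> = "fst l" and ?j0.0 = j0, OF J this, of M "snd l * (int M - 1)" "- K" K]
      show "card {z \<in> int_box J M. form_val J M l z \<in> {- K..K}} \<le> nat (2 * K + 1) * (2 * M) ^ (d - 1)"
        unfolding form_val_def d_def by simp
    qed
    finally have "card bad \<le> card L * (nat (2 * K + 1) * (2 * M) ^ (d - 1))" by simp
    hence "real (card bad) \<le> real (card L * (nat (2 * K + 1) * (2 * M) ^ (d - 1)))" by (simp only: of_nat_le_iff)
    thus ?thesis by (simp add: mult.assoc)
  qed
  finally have main: "\<bar>real (card (P (q * M))) - real q ^ d * real (card (P M))\<bar>
      \<le> real q ^ d * (real (card L) * real (nat (2 * K + 1)) * real (2 * M) ^ (d - 1))"
    by (simp add: mult_left_mono)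
  have pos: "real q > 0" "real M > 0" using q M by auto
  define X T where "X = real (card (P (q * M))) - real q ^ d * real (card (P M))"
    and "T = real (card L) * real (nat (2 * K + 1)) * real (2 * M) ^ (d - 1)"
  have qd: "real q ^ d > 0" "real M ^ d > 0" using pos by simp_all
  have "real (card (P (q * M))) / real (q * M) ^ d - real (card (P M)) / real M ^ d = X / (real q ^ d * real M ^ d)"
    using pos unfolding X_def by (simp add: power_mult_distrib diff_divide_distrib)
  hence "\<bar>real (card (P (q * M))) / real (q * M) ^ d - real (card (P M)) / real M ^ d\<bar> = \<bar>X\<bar> / (real q ^ d * real M ^ d)"
    by (simp only: abs_divide abs_mult power_abs abs_of_nat)
  also have "\<dots> \<le> (real q ^ d * T) / (real q ^ d * real M ^ d)"
    by (rule divide_right_mono) (use main qd in \<open>simp_all only: X_def T_def zero_le_mult_iff order_less_imp_le simp_thms\<close>)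
  also have "\<dots> = T / real M ^ d" by (rule mult_divide_mult_cancel_left) (use qd in simp)
  also have "\<dots> = real (card L) * real (nat (2 * K + 1)) * real (2 * M) ^ (d - 1) / real M ^ d"
    by (simp only: T_def)
  also have "\<dots> \<le> real (card L) * real (nat (2 * K + 1)) * 2 ^ d / real M"
  \<comment> \<open>With no forms the bound is 0. Otherwise \<open>nz\<close> forces
    \<open>J\<close> to be nonempty, so that \<open>d - 1\<close> is a genuine predecessor.\<close>
  proof (cases "L = {}")
    case False
    hence "J \<noteq> {}" using nz by blast
    then obtain d' where d': "d = Suc d'" using J gr0_implies_Suc[of d] by (auto simp: d_def card_gt_0_iff)
    have "real (2 * M) ^ (d - 1) = 2 ^ d' * real M ^ d'" by (simp add: d' power_mult_distrib)
    moreover have "real M ^ d = real M * real M ^ d'" by (simp add: d')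
    ultimately have "real (2 * M) ^ (d - 1) / real M ^ d = 2 ^ d' / real M" using pos by simp
    also have "\<dots> \<le> 2 ^ d / real M"
      by (rule divide_right_mono) (use pos in \<open>simp_all add: d'\<close>)
    finally have "real (card L) * real (nat (2 * K + 1)) * (real (2 * M) ^ (d - 1) / real M ^ d)
       \<le> real (card L) * real (nat (2 * K + 1)) * (2 ^ d / real M)" by (rule mult_left_mono) simp
    thus ?thesis by (simp only: times_divide_eq_right)
  qed simp
  finally show ?thesis unfolding P_def d_def .
qed

theorem lattice_points_density_convergent:
  assumes J: "finite J" and L: "finite L" and nz: "\<And>l. l \<in> L \<Longrightarrow> \<exists>j\<in>J. fst l j \<noteq> 0"
  shows "convergent (\<lambda>N. real (card (lattice_points J L N)) / real N ^ card J)"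
proof -
  define K where "K = (\<Sum>l\<in>L. (\<Sum>j\<in>J. \<bar>fst l j\<bar>) + \<bar>snd l\<bar>)"
  have K: "(\<Sum>j\<in>J. \<bar>fst l j\<bar>) + \<bar>snd l\<bar> \<le> K" if "l \<in> L" for l
    unfolding K_def
    by (rule member_le_sum[of l L "\<lambda>l. (\<Sum>j\<in>J. \<bar>fst l j\<bar>) + \<bar>snd l\<bar>"])
      (use L that in \<open>simp_all add: sum_nonneg\<close>)
  show ?thesis
  proof (rule convergent_if_dilation_stable)
    fix M q :: nat assume "M \<ge> 1" "q \<ge> 1"
    thus "\<bar>real (card (lattice_points J L (q * M))) / real (q * M) ^ card J
           - real (card (lattice_points J L M)) / real M ^ card J\<bar>
         \<le> (real (card L) * real (nat (2 * K + 1)) * 2 ^ card J) / real M"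
      by (intro lattice_points_dilation J L nz K)
  qed
qed

text \<open>The factorial of \<open>2 * k\<close> is at least \<open>k ^ k\<close> times the
  factorial of \<open>k\<close>. After cancelling \<open>k ^ k\<close> a term of an exponential
  series remains.\<close>

lemma growth_if_bounded:
  fixes m :: "nat \<Rightarrow> real"
  assumes nonneg: "\<And>k. 0 \<le> m (2 * k)" and le: "\<And>k. k \<ge> 1 \<Longrightarrow> m (2 * k) \<le> B * C ^ k * real k ^ k"
  shows "(\<lambda>k. t ^ (2 * k) * m (2 * k) / fact (2 * k)) \<longlonglongrightarrow> 0"
proof (rule tendsto_sandwich)
  have fact: "fact (2 * k) \<ge> (real k ^ k * fact k)" for k
  proof -
    have "fact (k + j) \<ge> real k ^ j * fact k" for j
    proof (induction j)
      case (Suc j)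
      have "real k ^ Suc j * fact k = real k * (real k ^ j * fact k)" by simp
      also have "\<dots> \<le> real (Suc (k + j)) * fact (k + j)"
        using Suc.IH by (intro mult_mono) auto
      finally show ?case by simp
    qed simp
    from this[of k] show ?thesis by (simp add: mult_2)
  qed
  show "\<forall>\<^sub>F k in sequentially. t ^ (2 * k) * m (2 * k) / fact (2 * k) \<le> B * ((t\<^sup>2 * C) ^ k / fact k)"
    using eventually_ge_at_top[of 1]
  proof eventually_elim
    case (elim k)
    have k: "real k ^ k > 0" using elim by simp
    have B: "0 \<le> B * C ^ k * real k ^ k" using nonneg[of k] le[OF elim] by linarith
    have "t ^ (2 * k) * m (2 * k) / fact (2 * k) \<le> t ^ (2 * k) * (B * C ^ k * real k ^ k) / fact (2 * k)"
      using le[OF elim] by (intro divide_right_mono mult_left_mono) (auto simp: power_mult)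
    also have "\<dots> \<le> t ^ (2 * k) * (B * C ^ k * real k ^ k) / (real k ^ k * fact k)"
    proof (rule divide_left_mono)
      show "0 \<le> t ^ (2 * k) * (B * C ^ k * real k ^ k)" by (intro mult_nonneg_nonneg B) (simp add: power_mult)
    qed (use fact[of k] k in auto)
    also have "t ^ (2 * k) = (t\<^sup>2) ^ k" by (rule power_mult)
    also have "(t\<^sup>2) ^ k * (B * C ^ k * real k ^ k) / (real k ^ k * fact k) = B * ((t\<^sup>2 * C) ^ k / fact k)"
      using k by (simp add: power_mult_distrib)
    finally show ?case by (simp only: power_mult)
  qed
  show "\<forall>\<^sub>F k in sequentially. 0 \<le> t ^ (2 * k) * m (2 * k) / fact (2 * k)"
    using nonneg by (intro always_eventually allI divide_nonneg_pos mult_nonneg_nonneg) (auto simp: power_mult)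
  have "(\<lambda>k. (t\<^sup>2 * C) ^ k / fact k) \<longlonglongrightarrow> 0"
    using summable_LIMSEQ_zero[OF summable_exp[of "t\<^sup>2 * C"]] by (simp add: field_simps)
  thus "(\<lambda>k. B * ((t\<^sup>2 * C) ^ k / fact k)) \<longlonglongrightarrow> 0" by (rule tendsto_mult_right_zero)
qed auto

section \<open>Moments of the semicircle\<close>

text \<open>Rescaled to the interval from -2 to 2: at 2 cos t the value is sin ((h + 1) t) / sin t.
  With this normalisation the recursion has coefficients 1 and matches that of
  \<open>ballot\<close>.\<close>

fun chebyshev_U :: "nat \<Rightarrow> real \<Rightarrow> real" where
  "chebyshev_U 0 x = 1"
| "chebyshev_U (Suc 0) x = x"
| "chebyshev_U (Suc (Suc h)) x = x * chebyshev_U (Suc h) x - chebyshev_U h x"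

text \<open>Counts the paths with steps +1 and -1 of length \<open>n\<close> that lead from height
  \<open>h\<close> to 0 without becoming negative. At height 0 and even length these are the Catalan
  numbers.\<close>

fun ballot :: "nat \<Rightarrow> nat \<Rightarrow> nat" where
  "ballot 0 h = (if h = 0 then 1 else 0)"
| "ballot (Suc n) h = ballot n (Suc h) + (if h = 0 then 0 else ballot n (h - 1))"

lemma ballot_eq_0: "n < h \<Longrightarrow> ballot n h = 0"
  by (induction n arbitrary: h) auto

lemma ballot_odd: "odd (n + h) \<Longrightarrow> ballot n h = 0"
  by (induction n arbitrary: h) (auto simp: odd_pos)

lemma sin_mult_chebyshev_U: "sin \<theta> * chebyshev_U h (2 * cos \<theta>) = sin (real (h + 1) * \<theta>)"
proof (induction h rule: induct_nat_012)
  case (ge2 h)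
  let ?a = "real (h + 2) * \<theta>"
  have "sin \<theta> * chebyshev_U (Suc (Suc h)) (2 * cos \<theta>)
      = 2 * cos \<theta> * (sin \<theta> * chebyshev_U (Suc h) (2 * cos \<theta>)) - sin \<theta> * chebyshev_U h (2 * cos \<theta>)"
    by (simp add: algebra_simps)
  also have "\<dots> = 2 * cos \<theta> * sin ?a - sin (?a - \<theta>)"
    using ge2 by (simp add: algebra_simps)
  also have "\<dots> = sin (?a + \<theta>)" by (simp add: sin_add sin_diff)
  also have "?a + \<theta> = real (Suc (Suc h) + 1) * \<theta>" by (simp add: algebra_simps)
  finally show ?case .
qed (auto simp: sin_double)

lemma continuous_on_chebyshev_U [continuous_intros]: "continuous_on S (chebyshev_U h)"
  by (induction h "0 :: real" rule: chebyshev_U.induct) (auto intro!: continuous_intros simp: fun_eq_iff)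

definition semicircle_density :: "real \<Rightarrow> real" where
  "semicircle_density x = (if \<bar>x\<bar> \<le> 2 then 1 / pi * sqrt (1 - (x / 2)\<^sup>2) else 0)"

lemma semicircle_density_measurable [measurable]: "semicircle_density \<in> borel_measurable borel"
  unfolding semicircle_density_def[abs_def] by measurable

lemma semicircle_density_nonneg: "0 \<le> semicircle_density x"
proof -
  have "x\<^sup>2 \<le> 4" if "\<bar>x\<bar> \<le> 2" using power_mono[OF that, of 2] by simp
  thus ?thesis unfolding semicircle_density_def by (simp add: power_divide)
qed

lemma semicircle_eq: "semicircle = density lborel (\<lambda>x. ennreal (semicircle_density x))"
  unfolding semicircle_def semicircle_density_def ..

lemma integrable_semicircle_density:
  assumes "continuous_on UNIV f"
  shows "integrable lborel (\<lambda>x. semicircle_density x * f x)"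
proof -
  have "set_integrable lborel {-2..2} (\<lambda>x. 1 / pi * sqrt (1 - (x / 2)\<^sup>2) * f x)"
    by (intro borel_integrable_atLeastAtMost' continuous_intros continuous_on_subset[OF assms]) auto
  thus ?thesis unfolding set_integrable_def
    by (rule Bochner_Integration.integrable_cong[THEN iffD1, rotated -1])
       (auto simp: semicircle_density_def indicator_def abs_le_iff)
qed

definition sin_antideriv :: "nat \<Rightarrow> real \<Rightarrow> real" where
  "sin_antideriv h \<theta> = (if h = 0 then \<theta> else sin (real h * \<theta>) / real h)"

lemma sin_antideriv_deriv: "(sin_antideriv h has_real_derivative cos (real h * \<theta>)) (at \<theta>)"
proof (cases "h = 0")
  case True
  thus ?thesis by (simp add: sin_antideriv_def[abs_def])
next
  case False
  thus ?thesis unfolding sin_antideriv_def[abs_def]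
    by (auto intro!: derivative_eq_intros)
qed

lemma integral_semicircle_chebyshev_U:
  "(\<integral>x. semicircle_density x * chebyshev_U h x \<partial>lborel) = (if h = 0 then 1 else 0)"
proof -
  define g where "g x = 1 / pi * sqrt (1 - (x / 2)\<^sup>2) * chebyshev_U h x" for x
  \<comment> \<open>With x = 2 cos t the integrand becomes a multiple of sin t sin ((h + 1) t),
    which is half the difference of the cosines of h t and (h + 2) t; \<open>G\<close> integrates
    these cosines.\<close>
  define G where "G x = - 1 / pi * (sin_antideriv h (arccos (x / 2)) - sin_antideriv (h + 2) (arccos (x / 2)))" for x
  have cont: "continuous_on {-2..2} g" unfolding g_def
    by (intro continuous_intros) auto
  have sc: "continuous_on UNIV (sin_antideriv j)" for j
    using sin_antideriv_deriv by (intro continuous_at_imp_continuous_on ballI) (metis DERIV_isCont)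
  \<comment> \<open>The arccosine is not differentiable at the ends of its domain, so the derivative
    is computed in the interior only and \<open>G\<close> is merely continuous at the ends.\<close>
  have "(g has_integral (G 2 - G (-2))) {-2..2}"
  proof (rule fundamental_theorem_of_calculus_interior)
    show "continuous_on {-2..2} G" unfolding G_def
      by (intro continuous_intros continuous_on_compose2[OF sc]) auto
    fix x :: real assume x: "x \<in> {-2<..<2}"
    define \<theta> where "\<theta> = arccos (x / 2)"
    have c: "cos \<theta> = x / 2" using x unfolding \<theta>_def by (intro cos_arccos) auto
    have s: "sin \<theta> = sqrt (1 - (x / 2)\<^sup>2)" using x unfolding \<theta>_def by (intro sin_arccos) auto
    have "(x / 2)\<^sup>2 < 1" using x by (simp add: abs_square_less_1 abs_less_iff)
    hence spos: "sin \<theta> > 0" unfolding s by simp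
    have d1: "((\<lambda>x. arccos (x / 2)) has_real_derivative (inverse (- sin \<theta>) * (1 / 2))) (at x)"
      unfolding s using x
      by (auto intro!: derivative_eq_intros simp: field_simps)
    have d2: "((\<lambda>x. sin_antideriv j (arccos (x / 2))) has_real_derivative (cos (real j * \<theta>) * (inverse (- sin \<theta>) * (1 / 2)))) (at x)" for j
      unfolding \<theta>_def by (rule DERIV_chain2[OF sin_antideriv_deriv d1[unfolded \<theta>_def]])
    have "(G has_real_derivative (- 1 / pi * (cos (real h * \<theta>) * (inverse (- sin \<theta>) * (1 / 2))
        - cos (real (h + 2) * \<theta>) * (inverse (- sin \<theta>) * (1 / 2))))) (at x)"
      unfolding G_def[abs_def] by (intro DERIV_cmult DERIV_diff d2)
    moreover have "- 1 / pi * (cos (real h * \<theta>) * (inverse (- sin \<theta>) * (1 / 2))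
        - cos (real (h + 2) * \<theta>) * (inverse (- sin \<theta>) * (1 / 2))) = g x"
    proof -
      let ?a = "real (h + 1) * \<theta>"
      have a: "real h * \<theta> = ?a - \<theta>" "real (h + 2) * \<theta> = ?a + \<theta>" by (simp_all add: algebra_simps)
      have "cos (real h * \<theta>) - cos (real (h + 2) * \<theta>) = 2 * sin \<theta> * sin ?a"
        unfolding a by (simp add: cos_add cos_diff)
      also have "sin ?a = sin \<theta> * chebyshev_U h x"
        using sin_mult_chebyshev_U[of \<theta> h] c by simp
      finally have *: "cos (real h * \<theta>) - cos (real (h + 2) * \<theta>) = 2 * sin \<theta> * (sin \<theta> * chebyshev_U h x)" .
      have "- 1 / pi * (cos (real h * \<theta>) * (inverse (- sin \<theta>) * (1 / 2))
        - cos (real (h + 2) * \<theta>) * (inverse (- sin \<theta>) * (1 / 2)))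
        = (cos (real h * \<theta>) - cos (real (h + 2) * \<theta>)) / (2 * pi * sin \<theta>)"
        using spos by (simp add: field_simps)
      also have "\<dots> = 1 / pi * sin \<theta> * chebyshev_U h x" unfolding * using spos by simp
      finally show ?thesis unfolding g_def s .
    qed
    ultimately show "(G has_vector_derivative g x) (at x)"
      by (simp add: has_real_derivative_iff_has_vector_derivative)
  qed simp
  moreover have "G 2 - G (-2) = (if h = 0 then 1 else 0)"
  proof -
    have "sin ((2 + real h) * pi) = 0" using sin_npi[of "h + 2"] by (simp add: add.commute)
    thus ?thesis by (simp add: G_def sin_antideriv_def)
  qed
  ultimately have "integral {-2..2} g = (if h = 0 then 1 else 0)" by (simp add: integral_unique)
  moreover have "(LINT x:{-2..2}|lborel. g x) = integral {-2..2} g"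
    by (intro set_borel_integral_eq_integral(2) borel_integrable_atLeastAtMost' cont)
  moreover have "(LINT x:{-2..2}|lborel. g x) = (\<integral>x. semicircle_density x * chebyshev_U h x \<partial>lborel)"
    unfolding set_lebesgue_integral_def g_def
    by (intro Bochner_Integration.integral_cong) (auto simp: semicircle_density_def indicator_def abs_le_iff)
  ultimately show ?thesis by simp
qed

lemma integral_semicircle_power_chebyshev_U:
  "(\<integral>x. semicircle_density x * (x ^ n * chebyshev_U h x) \<partial>lborel) = real (ballot n h)"
proof (induction n arbitrary: h)
  case 0
  show ?case using integral_semicircle_chebyshev_U[of h] by simp
next
  case (Suc n)
  have i: "integrable lborel (\<lambda>x. semicircle_density x * (x ^ n * chebyshev_U h x))" for h
    by (intro integrable_semicircle_density continuous_intros)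
  have rec: "x * chebyshev_U h x = chebyshev_U (Suc h) x + (if h = 0 then 0 else chebyshev_U (h - 1) x)" for x
    by (cases h) auto
  have "(\<integral>x. semicircle_density x * (x ^ Suc n * chebyshev_U h x) \<partial>lborel)
      = (\<integral>x. semicircle_density x * (x ^ n * (x * chebyshev_U h x)) \<partial>lborel)"
    by (simp add: mult.left_commute mult.assoc)
  also have "\<dots> = (\<integral>x. semicircle_density x * (x ^ n * chebyshev_U (Suc h) x)
      + (if h = 0 then 0 else semicircle_density x * (x ^ n * chebyshev_U (h - 1) x)) \<partial>lborel)"
    unfolding rec by (intro Bochner_Integration.integral_cong) (auto simp: distrib_left)
  also have "\<dots> = real (ballot n (Suc h)) + (if h = 0 then 0 else real (ballot n (h - 1)))"
    using i Suc.IH by (cases "h = 0") (simp_all del: chebyshev_U.simps)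
  finally show ?case by simp
qed

lemma semicircle_distribution: "real_distribution semicircle"
proof -
  have "(\<integral>\<^sup>+x. ennreal (semicircle_density x) \<partial>lborel) = ennreal (\<integral>x. semicircle_density x \<partial>lborel)"
    using integrable_semicircle_density[of "\<lambda>_. 1"] semicircle_density_nonneg by (intro nn_integral_eq_integral) auto
  also have "(\<integral>x. semicircle_density x \<partial>lborel) = 1"
    using integral_semicircle_chebyshev_U[of 0] by simp
  finally have "prob_space semicircle"
    unfolding semicircle_eq by (intro prob_spaceI) (simp add: emeasure_density)
  thus ?thesis by (simp add: real_distribution_def real_distribution_axioms_def semicircle_eq)
qed

lemma semicircle_integrable: "integrable semicircle (\<lambda>x. x ^ n)"
proof -
  have "integrable lborel (\<lambda>x. semicircle_density x * x ^ n)"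
    by (rule integrable_semicircle_density) (intro continuous_intros)
  thus ?thesis unfolding semicircle_eq
    using semicircle_density_nonneg by (subst integrable_density) auto
qed

lemma moment_semicircle: "moment semicircle n = real (ballot n 0)"
  unfolding semicircle_eq moment_def
  using integral_semicircle_power_chebyshev_U[of n 0] semicircle_density_nonneg
  by (subst integral_density) auto

section \<open>Depth-first walks\<close>

text \<open>An undirected edge as a sorted pair, which is exactly the index of the sign used at that
  position.\<close>

definition edge :: "nat \<Rightarrow> nat \<Rightarrow> nat \<times> nat" where
  "edge v x = (min v x, max v x)"

lemma edge_commute: "edge v x = edge x v"
  by (simp add: edge_def min.commute max.commute)

lemma edge_eq_iff: "edge a b = edge c d \<longleftrightarrow> (a = c \<and> b = d) \<or> (a = d \<and> b = c)"
  by (auto simp: edge_def min_def max_def split: if_splits)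

fun edge_list :: "nat \<Rightarrow> nat list \<Rightarrow> (nat \<times> nat) list" where
  "edge_list v [] = []"
| "edge_list v (x # xs) = edge v x # edge_list x xs"

lemma length_edge_list [simp]: "length (edge_list v xs) = length xs"
  by (induction xs arbitrary: v) auto

lemma edge_list_nth: "j < length xs \<Longrightarrow> edge_list v xs ! j = edge ((v # xs) ! j) (xs ! j)"
  by (induction xs arbitrary: v j) (auto simp: nth_Cons split: nat.splits)

lemma edge_list_mem: "edge a b \<in> set (edge_list v xs) \<Longrightarrow> a \<in> set (v # xs) \<and> b \<in> set (v # xs)"
  by (induction xs arbitrary: v) (auto simp: edge_eq_iff)

text \<open>
  A depth-first traversal of a tree: the list \<open>st\<close> is the path from the current vertex back to the
  root, \<open>U\<close> the set of visited vertices, and the walk ends at the root.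
\<close>

fun tree_walk :: "nat list \<Rightarrow> nat set \<Rightarrow> nat list \<Rightarrow> bool" where
  "tree_walk st U [] = (length st = 1)"
| "tree_walk st U (x # xs) = ((x \<notin> U \<and> tree_walk (x # st) (insert x U) xs) \<or>
     (tl st \<noteq> [] \<and> x = hd (tl st) \<and> x \<in> U \<and> tree_walk (tl st) U xs))"

text \<open>Each edge on the stack still has to be traversed once, on the way back to the root.
  Counting stack edges along with the remaining steps gives an invariant of the traversal.\<close>

lemma tree_walk_even:
  "tree_walk (v # st) U xs \<Longrightarrow> even (count_list (edge_list v xs) e + count_list (edge_list v st) e)"
proof (induction xs arbitrary: v st U)
  case (Cons x xs)
  from Cons.prems consider "tree_walk (x # v # st) (insert x U) xs"
    | u st' where "st = u # st'" "x = u" "tree_walk (u # st') U xs"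
    by (cases st) auto
  thus ?case
  proof cases
    case 1
    from Cons.IH[OF this] show ?thesis by (auto simp: edge_commute split: if_splits)
  next
    case 2
    from Cons.IH[OF this(3)] show ?thesis using 2 by auto
  qed
qed auto

lemma edge_on_stack:
  assumes "distinct (v # st)" "edge v x \<in> set (edge_list v st)"
  shows "st \<noteq> [] \<and> x = hd st"
  using assms by (cases st) (auto simp: edge_eq_iff dest: edge_list_mem)

text \<open>The hypotheses are kept invariant along the walk: every edge occurs twice or not at all
  among stack and remaining steps, and each step finds a new vertex or repeats an earlier edge. A
  step to an old vertex must then repeat a stack edge, and the only one at the current vertex leads
  to the parent.\<close>

lemma tree_walkI:
  assumes "distinct (v # st)" "set (v # st) \<subseteq> U"
    and "\<And>e. count_list (edge_list v xs) e + count_list (edge_list v st) e \<in> {0, 2}"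
    and "\<And>j. j < length xs \<Longrightarrow> xs ! j \<notin> U \<union> set (take j xs) \<or>
           edge_list v xs ! j \<in> set (edge_list v st) \<union> set (take j (edge_list v xs))"
  shows "tree_walk (v # st) U xs"
  using assms
proof (induction xs arbitrary: v st U)
  case Nil
  show ?case
  proof (cases st)
    case (Cons u st')
    have "edge v u \<notin> set (edge_list u st')" using Nil.prems(1) Cons by (auto dest: edge_list_mem)
    hence "count_list (edge_list v st) (edge v u) = 1" using Cons by simp
    thus ?thesis using Nil.prems(3)[of "edge v u"] by simp
  qed simp
next
  case (Cons x xs)
  show ?case
  proof (cases "x \<in> U")
    case False
    have "tree_walk (x # v # st) (insert x U) xs"
    proof (rule Cons.IH)
      show "distinct (x # v # st)" "set (x # v # st) \<subseteq> insert x U" using Cons.prems(1,2) False by auto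
      show "count_list (edge_list x xs) e + count_list (edge_list x (v # st)) e \<in> {0, 2}" for e
        using Cons.prems(3)[of e] by (simp add: edge_commute[of x v] split: if_splits)
      fix j assume "j < length xs"
      thus "xs ! j \<notin> insert x U \<union> set (take j xs) \<or>
         edge_list x xs ! j \<in> set (edge_list x (v # st)) \<union> set (take j (edge_list x xs))"
        using Cons.prems(4)[of "Suc j"] by (auto simp: edge_commute[of x v])
    qed
    thus ?thesis using False by simp
  next
    case True
    hence "edge v x \<in> set (edge_list v st)" using Cons.prems(4)[of 0] by auto
    from edge_on_stack[OF Cons.prems(1) this] obtain st' where st: "st = x # st'" by (cases st) auto
    \<comment> \<open>The popped edge has now been used both times, once on the stack and once by
      this step, so it cannot occur again.\<close>
    have cnt: "count_list (edge_list x xs) e + count_list (edge_list x st') e \<in> {0, 2}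
        \<and> (e = edge v x \<longrightarrow> count_list (edge_list x xs) e + count_list (edge_list x st') e = 0)" for e
      using Cons.prems(3)[of e] st by (auto split: if_splits)
    have "tree_walk (x # st') U xs"
    proof (rule Cons.IH)
      show "distinct (x # st')" "set (x # st') \<subseteq> U" using Cons.prems(1,2) st by auto
      show "count_list (edge_list x xs) e + count_list (edge_list x st') e \<in> {0, 2}" for e
        using cnt by blast
      fix j assume j: "j < length xs"
      have "edge v x \<notin> set (edge_list x xs)"
        using cnt[of "edge v x"] by (auto simp: count_list_0_iff)
      hence "edge_list x xs ! j \<noteq> edge v x" using j by (metis length_edge_list nth_mem)
      thus "xs ! j \<notin> U \<union> set (take j xs) \<or>
         edge_list x xs ! j \<in> set (edge_list x st') \<union> set (take j (edge_list x xs))"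
        using Cons.prems(4)[of "Suc j"] j st by auto
    qed
    thus ?thesis using st True by simp
  qed
qed

definition tree_walks :: "nat \<Rightarrow> nat \<Rightarrow> nat list \<Rightarrow> nat set \<Rightarrow> nat list set" where
  "tree_walks N n st U = {xs. length xs = n \<and> set xs \<subseteq> {..<N} \<and> tree_walk st U xs}"

lemma finite_tree_walks: "finite (tree_walks N n st U)"
  unfolding tree_walks_def
  by (rule finite_subset[OF _ finite_lists_length_eq[of "{..<N}" n]]) auto

lemma tree_walks_Suc:
  "tree_walks N (Suc n) st U = (\<Union>x\<in>{..<N} - U. (#) x ` tree_walks N n (x # st) (insert x U)) \<union>
     (if tl st \<noteq> [] \<and> hd (tl st) \<in> U \<inter> {..<N} then (#) (hd (tl st)) ` tree_walks N n (tl st) U else {})"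
proof (intro equalityI subsetI)
  fix ys assume "ys \<in> tree_walks N (Suc n) st U"
  then obtain x xs where "ys = x # xs" "length xs = n" "x < N" "set xs \<subseteq> {..<N}" "tree_walk st U (x # xs)"
    unfolding tree_walks_def by (auto simp: length_Suc_conv)
  thus "ys \<in> (\<Union>x\<in>{..<N} - U. (#) x ` tree_walks N n (x # st) (insert x U)) \<union>
     (if tl st \<noteq> [] \<and> hd (tl st) \<in> U \<inter> {..<N} then (#) (hd (tl st)) ` tree_walks N n (tl st) U else {})"
    unfolding tree_walks_def by auto
qed (auto simp: tree_walks_def split: if_splits)

text \<open>The height profile is a ballot path from the height of the stack to 0, and each of its
  up-steps chooses a vertex not yet visited. If the height exceeds \<open>n\<close>, the truncated
  exponent does no harm, as the ballot number vanishes.\<close>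

lemma card_tree_walks:
  assumes "st \<noteq> []" "set st \<subseteq> U" "U \<subseteq> {..<N}"
  shows "card (tree_walks N n st U) = ballot n (length st - 1) * (\<Prod>t<(n - (length st - 1)) div 2. N - card U - t)"
  using assms
proof (induction n arbitrary: st U)
  case 0
  have "tree_walks N 0 st U = (if length st = 1 then {[]} else {})" unfolding tree_walks_def by auto
  thus ?case using 0 by (cases st) auto
next
  case (Suc n)
  define h where "h = length st - 1"
  have len: "length st = Suc h" using Suc.prems by (simp add: h_def)
  have finU: "finite U" using Suc.prems finite_subset by blast
  define A where "A = (\<Union>x\<in>{..<N} - U. (#) x ` tree_walks N n (x # st) (insert x U))"
  define B where "B = (if tl st \<noteq> [] \<and> hd (tl st) \<in> U \<inter> {..<N} then (#) (hd (tl st)) ` tree_walks N n (tl st) U else {})"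
  have "card A = (\<Sum>x\<in>{..<N} - U. card ((#) x ` tree_walks N n (x # st) (insert x U)))"
    unfolding A_def by (intro card_UN_disjoint) (auto intro: finite_tree_walks)
  also have "\<dots> = (\<Sum>x\<in>{..<N} - U. ballot n (Suc h) * (\<Prod>t<(n - Suc h) div 2. N - card U - Suc t))"
  proof (rule sum.cong)
    fix x assume x: "x \<in> {..<N} - U"
    have "card ((#) x ` tree_walks N n (x # st) (insert x U)) = card (tree_walks N n (x # st) (insert x U))"
      by (rule card_image) auto
    also have "\<dots> = ballot n (Suc h) * (\<Prod>t<(n - Suc h) div 2. N - card (insert x U) - t)"
      using Suc.IH[of "x # st" "insert x U"] Suc.prems x len by auto
    finally show "card ((#) x ` tree_walks N n (x # st) (insert x U)) = ballot n (Suc h) * (\<Prod>t<(n - Suc h) div 2. N - card U - Suc t)"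
      using x finU by simp
  qed simp
  also have "\<dots> = (N - card U) * (ballot n (Suc h) * (\<Prod>t<(n - Suc h) div 2. N - card U - Suc t))"
    using Suc.prems finU by (simp add: card_Diff_subset)
  also have "\<dots> = ballot n (Suc h) * (\<Prod>t<(Suc n - h) div 2. N - card U - t)"
  proof (cases "n < Suc h")
    case False
    hence "(Suc n - h) div 2 = Suc ((n - Suc h) div 2)" by linarith
    thus ?thesis by (simp add: prod.lessThan_Suc_shift del: prod.lessThan_Suc)
  qed (simp add: ballot_eq_0)
  finally have cA: "card A = ballot n (Suc h) * (\<Prod>t<(Suc n - h) div 2. N - card U - t)" .
  have cB: "card B = (if h = 0 then 0 else ballot n (h - 1)) * (\<Prod>t<(Suc n - h) div 2. N - card U - t)"
  proof (cases "h = 0")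
    case True
    hence "tl st = []" using len by (cases st) auto
    thus ?thesis using True by (simp add: B_def)
  next
    case False
    obtain v u st' where st: "st = v # u # st'" using len False by (cases st; cases "tl st") auto
    have "card B = card (tree_walks N n (tl st) U)"
      using st Suc.prems unfolding B_def by (auto intro!: card_image)
    also have "\<dots> = ballot n (h - 1) * (\<Prod>t<(n - (h - 1)) div 2. N - card U - t)"
      using Suc.IH[of "tl st" U] Suc.prems st len by auto
    also have "n - (h - 1) = Suc n - h" using False by simp
    finally show ?thesis using False by simp
  qed
  have "card (tree_walks N (Suc n) st U) = card A + card B"
    unfolding tree_walks_Suc A_def[symmetric] B_def[symmetric]
  proof (rule card_Un_disjoint)
    show "finite A" unfolding A_def by (auto intro: finite_tree_walks)
    show "finite B" unfolding B_def by (auto intro: finite_tree_walks)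
    show "A \<inter> B = {}" unfolding A_def B_def by (auto split: if_splits)
  qed
  thus ?case unfolding cA cB h_def[symmetric] by (simp add: distrib_right)
qed

section \<open>Closed walks and their labels\<close>

definition closed_walks :: "nat \<Rightarrow> nat \<Rightarrow> (nat \<Rightarrow> nat) set" where
  "closed_walks m N = {..<m} \<rightarrow>\<^sub>E {..<N}"

lemma finite_closed_walks [simp]: "finite (closed_walks m N)"
  unfolding closed_walks_def by (intro finite_PiE) auto

lemma closed_walk_less: "i \<in> closed_walks m N \<Longrightarrow> s < m \<Longrightarrow> i s < N"
  unfolding closed_walks_def by auto

text \<open>
  A family of \<open>w\<close> closed walks of length \<open>m\<close> is read off from an object \<open>x\<close> by \<open>vt\<close>;
  its edges are indexed by \<open>edges w m\<close>.
\<close>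

definition edges :: "nat \<Rightarrow> nat \<Rightarrow> (nat \<times> nat) set" where
  "edges w m = {..<w} \<times> {..<m}"

definition src :: "('x \<Rightarrow> nat \<Rightarrow> nat \<Rightarrow> nat) \<Rightarrow> 'x \<Rightarrow> nat \<times> nat \<Rightarrow> nat" where
  "src vt x v = vt x (fst v) (snd v)"

definition tgt :: "nat \<Rightarrow> ('x \<Rightarrow> nat \<Rightarrow> nat \<Rightarrow> nat) \<Rightarrow> 'x \<Rightarrow> nat \<times> nat \<Rightarrow> nat" where
  "tgt m vt x v = vt x (fst v) (Suc (snd v) mod m)"

definition incr :: "nat \<Rightarrow> ('x \<Rightarrow> nat \<Rightarrow> nat \<Rightarrow> nat) \<Rightarrow> 'x \<Rightarrow> nat \<times> nat \<Rightarrow> int" where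
  "incr m vt x v = int (tgt m vt x v) - int (src vt x v)"

lemma finite_edges [simp]: "finite (edges w m)" by (simp add: edges_def)
lemma card_edges: "card (edges w m) = w * m" by (simp add: edges_def)

lemma sum_cyclic_shift:
  fixes f :: "nat \<Rightarrow> 'a :: comm_monoid_add"
  assumes "m > 0"
  shows "(\<Sum>s<m. f (Suc s mod m)) = (\<Sum>s<m. f s)"
proof -
  obtain m' where m: "m = Suc m'" using assms gr0_implies_Suc by blast
  have "(\<Sum>s<m. f (Suc s mod m)) = (\<Sum>s<m'. f (Suc s)) + f 0"
    unfolding m by (simp add: sum.lessThan_Suc)
  also have "\<dots> = (\<Sum>s<m. f s)" unfolding m by (simp only: sum.lessThan_Suc_shift add.commute)
  finally show ?thesis .
qed

lemma sum_incr_eq_0: "m > 0 \<Longrightarrow> (\<Sum>s<m. incr m vt x (u, s)) = 0"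
  unfolding incr_def tgt_def src_def
  using sum_cyclic_shift[of m "\<lambda>s. int (vt x u s)"] by (simp add: sum_subtractf)

lemma closed_walk_eqI:
  assumes i: "vt x u \<in> closed_walks m N" "vt x' u \<in> closed_walks m N" and "m > 0"
    and "vt x u 0 = vt x' u 0" and incr: "\<And>s. s < m \<Longrightarrow> incr m vt x (u, s) = incr m vt x' (u, s)"
  shows "vt x u = vt x' u"
proof -
  have "vt x u s = vt x' u s" if "s < m" for s
    using that
  proof (induction s)
    case (Suc s)
    thus ?case using incr[of s] by (simp add: incr_def tgt_def src_def)
  qed (use assms in auto)
  thus ?thesis using i unfolding closed_walks_def by (intro PiE_ext) auto
qed

section \<open>Counting walks by free coordinates\<close>

lemma card_le_of_inj_int_box:
  fixes F :: "'x \<Rightarrow> 'k \<Rightarrow> int"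
  assumes K: "finite K" and N: "N \<ge> 1"
    and inj: "\<And>x x'. x \<in> S \<Longrightarrow> x' \<in> S \<Longrightarrow> (\<And>k. k \<in> K \<Longrightarrow> F x k = F x' k) \<Longrightarrow> x = x'"
    and bd: "\<And>x k. x \<in> S \<Longrightarrow> k \<in> K \<Longrightarrow> \<bar>F x k\<bar> \<le> int N"
  shows "finite S \<and> card S \<le> (3 * N) ^ card K"
proof -
  let ?B = "K \<rightarrow>\<^sub>E {- int N..int N}"
  have fin: "finite ?B" using K by (intro finite_PiE) auto
  have injF: "inj_on (\<lambda>x. restrict (F x) K) S"
  proof (rule inj_onI)
    fix x x' assume "x \<in> S" "x' \<in> S" "restrict (F x) K = restrict (F x') K"
    thus "x = x'" by (intro inj) (auto dest: fun_cong simp: restrict_def split: if_splits)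
  qed
  have sub: "(\<lambda>x. restrict (F x) K) ` S \<subseteq> ?B"
    by (intro image_subsetI restrict_PiE_iff[THEN iffD2] ballI) (auto dest: bd simp: abs_le_iff)
  have "card S \<le> card ?B" by (rule card_inj_on_le[OF injF sub fin])
  also have "\<dots> = (2 * N + 1) ^ card K" using K by (subst card_PiE) (auto simp: nat_add_distrib nat_mult_distrib)
  also have "\<dots> \<le> (3 * N) ^ card K" using N by (intro power_mono) auto
  finally show ?thesis using inj_on_finite[OF injF sub fin] by simp
qed

text \<open>
  The increments along the edges determine a walk up to its starting point; here all increments are
  functions of those on the representatives \<open>f ` V\<close>, and the ones on \<open>Z\<close> are redundant.
\<close>

lemma card_determined_walks:
  fixes vt :: "'x \<Rightarrow> nat \<Rightarrow> nat \<Rightarrow> nat"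
  assumes m: "m > 0" and N: "N \<ge> 1" and f: "f ` edges w m \<subseteq> edges w m"
    and X: "\<And>x u. x \<in> S \<Longrightarrow> u < w \<Longrightarrow> vt x u \<in> closed_walks m N"
    and inj: "\<And>x x'. x \<in> S \<Longrightarrow> x' \<in> S \<Longrightarrow> (\<And>u. u < w \<Longrightarrow> vt x u = vt x' u) \<Longrightarrow> x = x'"
    and det: "\<And>x v. x \<in> S \<Longrightarrow> v \<in> edges w m \<Longrightarrow> incr m vt x v = h v * incr m vt x (f v) + c v"
    and Z: "\<And>x x' r. x \<in> S \<Longrightarrow> x' \<in> S \<Longrightarrow> (\<And>r. r \<in> f ` edges w m - Z \<Longrightarrow> incr m vt x r = incr m vt x' r)
              \<Longrightarrow> r \<in> Z \<Longrightarrow> incr m vt x r = incr m vt x' r"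
  shows "finite S \<and> card S \<le> (3 * N) ^ (w + card (f ` edges w m - Z))"
proof -
  \<comment> \<open>The free coordinates: a starting point for each walk and the increments on the
    representatives outside \<open>Z\<close>.\<close>
  define K where "K = Inl ` {..<w} \<union> Inr ` (f ` edges w m - Z)"
  define F where "F x k = (case k of Inl u \<Rightarrow> int (vt x u 0) | Inr r \<Rightarrow> incr m vt x r)" for x k
  have cardK: "card K = w + card (f ` edges w m - Z)"
    unfolding K_def by (subst card_Un_disjoint) (auto simp: card_image)
  have "finite S \<and> card S \<le> (3 * N) ^ card K"
  proof (rule card_le_of_inj_int_box[OF _ N])
    show "finite K" unfolding K_def by auto
    fix x k assume x: "x \<in> S" and k: "k \<in> K"
    show "\<bar>F x k\<bar> \<le> int N"
    proof (cases k)
      case (Inl u)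
      hence "u < w" using k by (auto simp: K_def)
      thus ?thesis using closed_walk_less[OF X[OF x], of u 0] m Inl by (simp add: F_def)
    next
      case (Inr r)
      hence "r \<in> edges w m" using k f by (auto simp: K_def)
      hence "src vt x r < N" "tgt m vt x r < N"
        using closed_walk_less[OF X[OF x]] m by (auto simp: edges_def src_def tgt_def)
      thus ?thesis using Inr by (simp add: F_def incr_def)
    qed
  next
    fix x x' assume x: "x \<in> S" "x' \<in> S" and eq: "\<And>k. k \<in> K \<Longrightarrow> F x k = F x' k"
    have "incr m vt x r = incr m vt x' r" if "r \<in> f ` edges w m - Z" for r
      using eq[of "Inr r"] that by (simp add: F_def K_def)
    moreover from this have "incr m vt x r = incr m vt x' r" if "r \<in> Z" for r
      using Z[OF x _ that] by blast
    ultimately have "incr m vt x v = incr m vt x' v" if "v \<in> edges w m" for v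
      using det[OF x(1) that] det[OF x(2) that] that by (metis DiffI imageI)
    moreover have "vt x u 0 = vt x' u 0" if "u < w" for u
      using eq[of "Inl u"] that by (simp add: F_def K_def)
    ultimately show "x = x'"
      by (intro inj x closed_walk_eqI[OF X[OF x(1)] X[OF x(2)] m]) (auto simp: edges_def)
  qed
  thus ?thesis unfolding cardK .
qed

lemma card_covered_le:
  assumes "finite I" "S \<subseteq> (\<Union>i\<in>I. T i)" "\<And>i. i \<in> I \<Longrightarrow> finite (T i) \<and> card (T i) \<le> B"
  shows "finite S \<and> card S \<le> card I * B"
proof -
  have fin: "finite (\<Union>i\<in>I. T i)" using assms by auto
  have "card S \<le> card (\<Union>i\<in>I. T i)" using assms fin by (intro card_mono)
  also have "\<dots> \<le> (\<Sum>i\<in>I. card (T i))" using assms by (intro card_UN_le) auto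
  also have "\<dots> \<le> (\<Sum>i\<in>I. B)" using assms by (intro sum_mono) auto
  finally show ?thesis using finite_subset[OF assms(2) fin] by auto
qed

lemma odd_sum_signs:
  assumes "finite A" "\<And>a. a \<in> A \<Longrightarrow> h a \<in> {-1, 1 :: int}" "odd (card A)"
  shows "sum h A \<noteq> 0"
proof -
  have "even (sum h A) \<longleftrightarrow> even (card A)"
    using assms(1,2)
  proof (induction A)
    case (insert x F)
    have "odd (h x)" using insert.prems[of x] by auto
    thus ?case using insert by simp
  qed simp
  thus ?thesis using assms(3) by auto
qed

text \<open>If all other classes contribute nothing, the closing condition says that a sum of an odd
  number of signs times the increment on \<open>P\<close> is 0, and such a sum is nonzero.\<close>

lemma odd_class_increment_0:
  fixes \<delta> :: "nat \<times> nat \<Rightarrow> int"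
  assumes \<delta>: "\<And>s. s < m \<Longrightarrow> \<delta> (u, s) = h (u, s) * \<delta> (f (u, s))"
    and h: "\<And>s. s < m \<Longrightarrow> h (u, s) \<in> {-1, 1}" and closed: "(\<Sum>s<m. \<delta> (u, s)) = 0"
    and other: "\<And>s. s < m \<Longrightarrow> f (u, s) \<noteq> P \<Longrightarrow> \<delta> (f (u, s)) = 0"
    and odd: "odd (card {s. s < m \<and> f (u, s) = P})"
  shows "\<delta> P = 0"
proof -
  let ?A = "{s. s < m \<and> f (u, s) = P}"
  have "0 = (\<Sum>s<m. \<delta> (u, s))" using closed by simp
  also have "\<dots> = (\<Sum>s<m. if f (u, s) = P then h (u, s) * \<delta> P else 0)"
    by (intro sum.cong) (auto simp: \<delta> other)
  also have "\<dots> = (\<Sum>s\<in>?A. h (u, s) * \<delta> P)"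
    by (subst sum.inter_filter[symmetric]) (auto intro: sum.cong)
  also have "\<dots> = (\<Sum>s\<in>?A. h (u, s)) * \<delta> P" by (simp add: sum_distrib_right)
  finally show ?thesis using odd_sum_signs[of ?A "\<lambda>s. h (u, s)"] h odd by auto
qed

text \<open>The choice depends only on the partition of \<open>V\<close> into level sets, so
  labellings with equal partitions get the same function. Restricting it to \<open>V\<close> places
  it in a finite function space, over which walks can be classified.\<close>

definition canon :: "'v set \<Rightarrow> ('v \<Rightarrow> 'l) \<Rightarrow> 'v \<Rightarrow> 'v" where
  "canon V lab = (\<lambda>v\<in>V. SOME v'. v' \<in> V \<and> lab v' = lab v)"

lemma canon_in: "v \<in> V \<Longrightarrow> canon V lab v \<in> V \<and> lab (canon V lab v) = lab v"
proof -
  assume v: "v \<in> V"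
  hence "v \<in> V \<and> lab v = lab v" by simp
  from someI[of "\<lambda>v'. v' \<in> V \<and> lab v' = lab v", OF this]
  show ?thesis unfolding canon_def restrict_apply'[OF v] .
qed

lemma canon_eq_iff: "v \<in> V \<Longrightarrow> v' \<in> V \<Longrightarrow> canon V lab v = canon V lab v' \<longleftrightarrow> lab v = lab v'"
proof
  assume v: "v \<in> V" "v' \<in> V"
  show "lab v = lab v'" if "canon V lab v = canon V lab v'"
    using canon_in[OF v(1), of lab] canon_in[OF v(2), of lab] that by metis
  show "canon V lab v = canon V lab v'" if "lab v = lab v'"
    unfolding canon_def restrict_apply'[OF v(1)] restrict_apply'[OF v(2)] that ..
qed

lemma canon_idem: "v \<in> V \<Longrightarrow> canon V lab (canon V lab v) = canon V lab v"
  using canon_in[of v V lab] by (subst canon_eq_iff) auto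

lemma canon_PiE: "canon V lab \<in> V \<rightarrow>\<^sub>E V"
  using canon_in[of _ V lab] by (auto simp: canon_def)

lemma canon_cong:
  assumes "\<And>v v'. v \<in> V \<Longrightarrow> v' \<in> V \<Longrightarrow> lab v = lab v' \<longleftrightarrow> lab' v = lab' v'"
  shows "canon V lab = canon V lab'"
proof
  fix v
  have "(\<lambda>v'. v' \<in> V \<and> lab v' = lab v) = (\<lambda>v'. v' \<in> V \<and> lab' v' = lab' v)" if "v \<in> V"
    using assms[OF _ that] by auto
  thus "canon V lab v = canon V lab' v" by (simp add: canon_def)
qed

lemma canon_canon: "canon V (canon V lab) = canon V lab"
  by (rule canon_cong) (simp add: canon_eq_iff)

lemma card_canon_image: "card (canon V lab ` V) = card (lab ` V)"
proof -
  have eq: "lab (canon V lab v) = lab v" if "v \<in> V" for v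
    using canon_in[OF that, of lab] by (rule conjunct2)
  have "lab ` V = lab ` canon V lab ` V" unfolding image_image
    by (rule image_cong[OF refl]) (rule eq[symmetric])
  moreover have "inj_on lab (canon V lab ` V)"
  proof (rule inj_onI, elim imageE)
    fix r r' v v' assume "lab r = lab r'" and r: "r = canon V lab v" "r' = canon V lab v'" and v: "v \<in> V" "v' \<in> V"
    hence "lab v = lab v'" using eq[OF v(1)] eq[OF v(2)] by simp
    thus "r = r'" unfolding r by (simp only: canon_eq_iff[OF v, of lab])
  qed
  ultimately show ?thesis using card_image by metis
qed

text \<open>
  In a configuration \<open>(f, h, c)\<close> the increment along the edge \<open>v\<close> is \<open>h v\<close> times the one along the
  representative \<open>f v\<close> plus \<open>c v * (N - 1)\<close>.
\<close>

definition configs :: "'v set \<Rightarrow> (('v \<Rightarrow> 'v) \<times> ('v \<Rightarrow> int) \<times> ('v \<Rightarrow> int)) set" where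
  "configs V = (V \<rightarrow>\<^sub>E V) \<times> (V \<rightarrow>\<^sub>E {-1, 1}) \<times> (V \<rightarrow>\<^sub>E {-1, 0, 1})"

lemma finite_configs: "finite V \<Longrightarrow> finite (configs V)"
  unfolding configs_def by (intro finite_cartesian_product finite_PiE) auto

text \<open>
  The link function says which entry of the sequence is placed at a position. The Toeplitz ensemble
  has \<open>Cs = {0}\<close>, the palindromic one \<open>Cs = {-1, 0, 1}\<close>.
\<close>

locale link =
  fixes lnk :: "nat \<Rightarrow> nat \<Rightarrow> nat \<Rightarrow> nat" and Cs :: "int set"
  assumes Cs: "Cs \<subseteq> {-1, 0, 1}"
    and lnk_eq_iff: "\<And>N i j i' j'. i < N \<Longrightarrow> j < N \<Longrightarrow> i' < N \<Longrightarrow> j' < N \<Longrightarrow> lnk N i j = lnk N i' j' \<longleftrightarrow>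
      (\<exists>h\<in>{-1, 1}. \<exists>c\<in>Cs. int j - int i = h * (int j' - int i') + c * (int N - 1))"
begin

definition lab :: "nat \<Rightarrow> nat \<Rightarrow> ('x \<Rightarrow> nat \<Rightarrow> nat \<Rightarrow> nat) \<Rightarrow> 'x \<Rightarrow> nat \<times> nat \<Rightarrow> nat" where
  "lab N m vt x v = lnk N (src vt x v) (tgt m vt x v)"

definition obeying :: "nat \<Rightarrow> nat \<Rightarrow> nat \<Rightarrow> ('x \<Rightarrow> nat \<Rightarrow> nat \<Rightarrow> nat) \<Rightarrow>
    (nat \<times> nat \<Rightarrow> nat \<times> nat) \<times> (nat \<times> nat \<Rightarrow> int) \<times> (nat \<times> nat \<Rightarrow> int) \<Rightarrow> 'x \<Rightarrow> bool" where
  "obeying w N m vt cfg x \<longleftrightarrow> canon (edges w m) (lab N m vt x) = fst cfg \<and>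
     (\<forall>v\<in>edges w m. incr m vt x v = fst (snd cfg) v * incr m vt x (fst cfg v) + snd (snd cfg) v * (int N - 1)) \<and>
     (\<forall>v\<in>edges w m. snd (snd cfg) v \<in> Cs) \<and>
     (\<forall>v\<in>edges w m. fst cfg v = v \<longrightarrow> fst (snd cfg) v = 1 \<and> snd (snd cfg) v = 0)"

lemma zero_in_Cs: "0 \<in> Cs"
proof -
  \<comment> \<open>For \<open>N = 5\<close> the equation 1 = h + 4 c with signs \<open>h\<close>
    and \<open>c\<close> in -1, 0, 1 has only the solution h = 1, c = 0.\<close>
  have "lnk 5 0 1 = lnk 5 0 1" by simp
  hence "\<exists>h\<in>{-1, 1}. \<exists>c\<in>Cs. int 1 - int 0 = h * (int 1 - int 0) + c * (int 5 - 1)"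
    by (subst (asm) lnk_eq_iff) auto
  thus ?thesis using Cs by auto
qed

lemma edge_vertices_less:
  assumes "m > 0" "\<And>u. u < w \<Longrightarrow> vt x u \<in> closed_walks m N" "v \<in> edges w m"
  shows "src vt x v < N" "tgt m vt x v < N"
  using assms closed_walk_less[of "vt x (fst v)" m N] by (auto simp: edges_def src_def tgt_def)

lemma lab_eq_iff:
  assumes m: "m > 0" and x: "\<And>u. u < w \<Longrightarrow> vt x u \<in> closed_walks m N"
    and v: "v \<in> edges w m" "v' \<in> edges w m"
  shows "lab N m vt x v = lab N m vt x v' \<longleftrightarrow>
    (\<exists>h\<in>{-1, 1}. \<exists>c\<in>Cs. incr m vt x v = h * incr m vt x v' + c * (int N - 1))"
proof -
  note b = edge_vertices_less[of m w vt x N, OF m x]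
  show ?thesis unfolding lab_def incr_def by (rule lnk_eq_iff) (use b v in auto)
qed

lemma obeying_exists:
  assumes m: "m > 0" and x: "\<And>u. u < w \<Longrightarrow> vt x u \<in> closed_walks m N"
  shows "\<exists>cfg\<in>configs (edges w m). obeying w N m vt cfg x"
proof -
  define V where "V = edges w m"
  define f where "f = canon V (lab N m vt x)"
  have "\<exists>hc. fst hc \<in> {-1, 1} \<and> snd hc \<in> Cs \<and> incr m vt x v = fst hc * incr m vt x (f v) + snd hc * (int N - 1) \<and>
      (f v = v \<longrightarrow> fst hc = 1 \<and> snd hc = 0)" if v: "v \<in> V" for v
  proof (cases "f v = v")
    case True
    thus ?thesis using zero_in_Cs by (intro exI[of _ "(1, 0)"]) auto
  next
    case False
    have "f v \<in> V" "lab N m vt x v = lab N m vt x (f v)"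
      using canon_in[OF v, of "lab N m vt x"] unfolding f_def by auto
    hence "\<exists>h\<in>{-1, 1}. \<exists>c\<in>Cs. incr m vt x v = h * incr m vt x (f v) + c * (int N - 1)"
      using lab_eq_iff[of m w vt x N v "f v"] m x v unfolding V_def by auto
    thus ?thesis using False by (metis fst_conv snd_conv)
  qed
  then obtain hc where hc: "\<And>v. v \<in> V \<Longrightarrow> fst (hc v) \<in> {-1, 1} \<and> snd (hc v) \<in> Cs \<and>
      incr m vt x v = fst (hc v) * incr m vt x (f v) + snd (hc v) * (int N - 1) \<and>
      (f v = v \<longrightarrow> fst (hc v) = 1 \<and> snd (hc v) = 0)" by metis
  define h c where "h = (\<lambda>v\<in>V. fst (hc v))" and "c = (\<lambda>v\<in>V. snd (hc v))"
  have "h \<in> V \<rightarrow>\<^sub>E {-1, 1}" unfolding h_def restrict_PiE_iff using hc by blast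
  moreover have "c \<in> V \<rightarrow>\<^sub>E {-1, 0, 1}" unfolding c_def restrict_PiE_iff using hc Cs by blast
  moreover have "f \<in> V \<rightarrow>\<^sub>E V" unfolding f_def by (rule canon_PiE)
  ultimately have "(f, h, c) \<in> configs V" unfolding configs_def by blast
  moreover have "obeying w N m vt (f, h, c) x"
    unfolding obeying_def V_def[symmetric] fst_conv snd_conv
  proof (intro conjI ballI)
    show "canon V (lab N m vt x) = f" by (simp only: f_def)
    fix v assume v: "v \<in> V"
    have hv: "h v = fst (hc v)" "c v = snd (hc v)" using v by (simp_all only: h_def c_def restrict_apply')
    show "incr m vt x v = h v * incr m vt x (f v) + c v * (int N - 1)" "c v \<in> Cs" "f v = v \<longrightarrow> h v = 1 \<and> c v = 0"
      unfolding hv using hc[OF v] by blast+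
  qed
  ultimately show ?thesis unfolding V_def by blast
qed

text \<open>There are finitely many configurations, and within each the walks have \<open>w\<close>
  starting points and at most \<open>r\<close> increments as free coordinates. The redundant set
  \<open>Z\<close> may differ between configurations, which lets each one exploit its own closing
  conditions.\<close>

lemma card_obeying_le:
  fixes vt :: "'x \<Rightarrow> nat \<Rightarrow> nat \<Rightarrow> nat"
  assumes m: "m > 0" and N: "N \<ge> 1"
    and X: "\<And>x u. x \<in> X \<Longrightarrow> u < w \<Longrightarrow> vt x u \<in> closed_walks m N"
    and inj: "\<And>x x'. x \<in> X \<Longrightarrow> x' \<in> X \<Longrightarrow> (\<And>u. u < w \<Longrightarrow> vt x u = vt x' u) \<Longrightarrow> x = x'"
    and S: "S \<subseteq> X"
    and Z: "\<And>f h c. (f, h, c) \<in> configs (edges w m) \<Longrightarrow> (\<exists>x\<in>S. obeying w N m vt (f, h, c) x) \<Longrightarrow>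
       \<exists>Z. card (f ` edges w m - Z) \<le> r \<and>
         (\<forall>x\<in>S. \<forall>x'\<in>S. obeying w N m vt (f, h, c) x \<longrightarrow> obeying w N m vt (f, h, c) x' \<longrightarrow>
           (\<forall>r\<in>f ` edges w m - Z. incr m vt x r = incr m vt x' r) \<longrightarrow> (\<forall>r\<in>Z. incr m vt x r = incr m vt x' r))"
  shows "finite S \<and> card S \<le> card (configs (edges w m)) * (3 * N) ^ (w + r)"
proof (rule card_covered_le[where T = "\<lambda>cfg. {x \<in> S. obeying w N m vt cfg x}"])
  show "finite (configs (edges w m))" by (rule finite_configs) simp
  show "S \<subseteq> (\<Union>cfg\<in>configs (edges w m). {x \<in> S. obeying w N m vt cfg x})"
  proof
    fix x assume x: "x \<in> S"
    hence "\<And>u. u < w \<Longrightarrow> vt x u \<in> closed_walks m N" using S X by blast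
    from obeying_exists[where vt = vt and x = x and w = w and N = N, OF m this] obtain cfg where "cfg \<in> configs (edges w m)" "obeying w N m vt cfg x"
      by blast
    thus "x \<in> (\<Union>cfg\<in>configs (edges w m). {x \<in> S. obeying w N m vt cfg x})" using x by blast
  qed
  fix cfg assume cfg: "cfg \<in> configs (edges w m)"
  obtain f h c where fhc: "cfg = (f, h, c)" by (cases cfg)
  let ?T = "{x \<in> S. obeying w N m vt cfg x}"
  show "finite ?T \<and> card ?T \<le> (3 * N) ^ (w + r)"
  proof (cases "?T = {}")
    case False
    then obtain Z where Z1: "card (f ` edges w m - Z) \<le> r" and
      Z2: "\<And>x x' r. x \<in> S \<Longrightarrow> x' \<in> S \<Longrightarrow> obeying w N m vt (f, h, c) x \<Longrightarrow> obeying w N m vt (f, h, c) x' \<Longrightarrow>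
           (\<And>r. r \<in> f ` edges w m - Z \<Longrightarrow> incr m vt x r = incr m vt x' r) \<Longrightarrow> r \<in> Z \<Longrightarrow> incr m vt x r = incr m vt x' r"
      using Z[of f h c] cfg unfolding fhc by blast
    have "finite ?T \<and> card ?T \<le> (3 * N) ^ (w + card (f ` edges w m - Z))"
    proof (rule card_determined_walks[OF m N, where h = h and c = "\<lambda>v. c v * (int N - 1)"])
      show "f ` edges w m \<subseteq> edges w m" using cfg unfolding fhc configs_def by auto
      fix x x' assume x: "x \<in> ?T" "x' \<in> ?T"
      show "x = x'" if "\<And>u. u < w \<Longrightarrow> vt x u = vt x' u" using inj[of x x'] x S that by blast
      show "incr m vt x r = incr m vt x' r"
        if "\<And>r. r \<in> f ` edges w m - Z \<Longrightarrow> incr m vt x r = incr m vt x' r" "r \<in> Z" for r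
        using Z2[OF _ _ _ _ that(1) that(2)] x unfolding fhc by blast
    next
      fix x u assume "x \<in> ?T" "u < w" thus "vt x u \<in> closed_walks m N" using X S by blast
    next
      fix x v assume "x \<in> ?T" "v \<in> edges w m"
      thus "incr m vt x v = h v * incr m vt x (f v) + c v * (int N - 1)"
        unfolding fhc obeying_def by simp
    qed
    moreover have "(3 * N) ^ (w + card (f ` edges w m - Z)) \<le> (3 * N) ^ (w + r)"
      using Z1 N by (intro power_increasing) auto
    ultimately show ?thesis by linarith
  next
    case True
    show ?thesis unfolding True by simp
  qed
qed

lemma card_few_labels:
  assumes m: "m > 0" and N: "N \<ge> 1"
    and X: "\<And>x u. x \<in> X \<Longrightarrow> u < w \<Longrightarrow> vt x u \<in> closed_walks m N"
    and inj: "\<And>x x'. x \<in> X \<Longrightarrow> x' \<in> X \<Longrightarrow> (\<And>u. u < w \<Longrightarrow> vt x u = vt x' u) \<Longrightarrow> x = x'"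
  shows "finite {x \<in> X. card (lab N m vt x ` edges w m) \<le> r} \<and>
    card {x \<in> X. card (lab N m vt x ` edges w m) \<le> r} \<le> card (configs (edges w m)) * (3 * N) ^ (w + r)"
proof (rule card_obeying_le[where vt = vt and X = X and w = w, OF m N X inj])
  fix f h c assume "\<exists>x\<in>{x \<in> X. card (lab N m vt x ` edges w m) \<le> r}. obeying w N m vt (f, h, c) x"
  then obtain x where "card (lab N m vt x ` edges w m) \<le> r" "canon (edges w m) (lab N m vt x) = f"
    unfolding obeying_def by auto
  hence "card (f ` edges w m - {}) \<le> r" using card_canon_image[of "edges w m" "lab N m vt x"] by simp
  thus "\<exists>Z. card (f ` edges w m - Z) \<le> r \<and> (\<forall>x\<in>{x \<in> X. card (lab N m vt x ` edges w m) \<le> r}.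
      \<forall>x'\<in>{x \<in> X. card (lab N m vt x ` edges w m) \<le> r}.
      obeying w N m vt (f, h, c) x \<longrightarrow> obeying w N m vt (f, h, c) x' \<longrightarrow>
      (\<forall>r\<in>f ` edges w m - Z. incr m vt x r = incr m vt x' r) \<longrightarrow> (\<forall>r\<in>Z. incr m vt x r = incr m vt x' r))"
    by blast
qed auto

end

section \<open>Linked quadruples of walks\<close>

definition occurrences :: "nat \<Rightarrow> (nat \<times> nat \<Rightarrow> 'v) \<Rightarrow> nat \<Rightarrow> 'v \<Rightarrow> nat" where
  "occurrences m f u P = card {s. s < m \<and> f (u, s) = P}"

lemma card_fiber_eq_occurrences:
  "card {v \<in> edges w m. f v = P} = (\<Sum>u<w. occurrences m f u P)"
proof -
  have "{v \<in> edges w m. f v = P} = (SIGMA u:{..<w}. {s. s < m \<and> f (u, s) = P})"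
    by (auto simp: edges_def)
  thus ?thesis by (simp add: occurrences_def)
qed

lemma occurrences_pos: "s < m \<Longrightarrow> f (u, s) = P \<Longrightarrow> occurrences m f u P \<ge> 1"
  unfolding occurrences_def by (rule Suc_leI[THEN order.trans[rotated], of 0, simplified]) (auto simp: card_gt_0_iff)

lemma pair_occurrences:
  assumes two: "card {v \<in> edges w m. f v = P} = 2" and ab: "a < w" "b < w" "a \<noteq> b"
    and occ: "occurrences m f a P \<ge> 1" "occurrences m f b P \<ge> 1"
  shows "occurrences m f a P = 1" "occurrences m f b P = 1" "\<And>u. u < w \<Longrightarrow> u \<noteq> a \<Longrightarrow> u \<noteq> b \<Longrightarrow> occurrences m f u P = 0"
proof -
  have "(\<Sum>u<w. occurrences m f u P) = occurrences m f a P + (occurrences m f b P + (\<Sum>u\<in>{..<w} - {a} - {b}. occurrences m f u P))"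
    using ab by (subst sum.remove[of _ a], simp, simp, subst sum.remove[of _ b]) auto
  hence *: "occurrences m f a P + (occurrences m f b P + (\<Sum>u\<in>{..<w} - {a} - {b}. occurrences m f u P)) = 2"
    using two card_fiber_eq_occurrences[of w m f P] by simp
  show "occurrences m f a P = 1" "occurrences m f b P = 1" using * occ by linarith+
  have "(\<Sum>u\<in>{..<w} - {a} - {b}. occurrences m f u P) = 0" using * occ by linarith
  thus "occurrences m f u P = 0" if "u < w" "u \<noteq> a" "u \<noteq> b" for u
    using that by (subst (asm) sum_eq_0_iff) auto
qed

text \<open>
  The closing condition of a walk that meets a class an odd number of times is a nontrivial relation
  between the increments, and each class of size larger than two lowers the number of classes.
  Together both effects always save two dimensions; this is why the fourth central moment is
  \<open>O(N\<^sup>-\<^sup>2)\<close>.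
\<close>

lemma linked_quadruple_rank:
  fixes f :: "nat \<times> nat \<Rightarrow> 'v"
  assumes m: "m > 0" and fib: "\<And>v. v \<in> edges 4 m \<Longrightarrow> 2 \<le> card {v' \<in> edges 4 m. f v' = f v}"
    and linked: "\<And>u. u < 4 \<Longrightarrow> \<exists>s<m. \<exists>v'\<in>edges 4 m. fst v' \<noteq> u \<and> f v' = f (u, s)"
  shows "card (f ` edges 4 m) \<le> 2 * m - 2 \<or>
    (\<exists>P\<in>f ` edges 4 m. \<exists>u<4. odd (occurrences m f u P) \<and> card (f ` edges 4 m) = 2 * m - 1) \<or>
    (\<exists>P\<in>f ` edges 4 m. \<exists>Q\<in>f ` edges 4 m. P \<noteq> Q \<and> card (f ` edges 4 m) = 2 * m \<and>
      (\<exists>u<4. \<exists>u'<4. odd (occurrences m f u P) \<and> occurrences m f u Q = 0 \<and> odd (occurrences m f u' Q)))"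
proof -
  let ?V = "edges 4 m" let ?R = "f ` edges 4 m"
  define F where "F P = card {v \<in> ?V. f v = P}" for P
  define occ where "occ = occurrences m f"
  have F2: "2 \<le> F P" if "P \<in> ?R" for P using that fib unfolding F_def by auto
  have sumF: "(\<Sum>P\<in>?R. F P) = 4 * m"
    using sum.image_gen[of ?V "\<lambda>_. 1::nat" f] unfolding F_def by (simp add: card_edges)
  have Focc: "F P = (\<Sum>u<4. occ u P)" for P unfolding F_def occ_def by (rule card_fiber_eq_occurrences)
  have le: "2 * card ?R \<le> 4 * m"
    using sum_mono[of ?R "\<lambda>_. 2" F] F2 sumF by simp
  have link: "\<exists>P\<in>?R. \<exists>a<4. a \<noteq> u \<and> occ u P \<ge> 1 \<and> occ a P \<ge> 1" if u: "u < 4" for u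
  proof -
    obtain s v' where s: "s < m" and v': "v' \<in> ?V" "fst v' \<noteq> u" "f v' = f (u, s)" using linked[OF u] by blast
    have "occ u (f v') \<ge> 1" unfolding occ_def by (rule occurrences_pos[OF s]) (simp add: v'(3))
    moreover have "occ (fst v') (f v') \<ge> 1" unfolding occ_def
      by (rule occurrences_pos[of "snd v'"]) (use v' in \<open>auto simp: edges_def\<close>)
    moreover have "fst v' < 4" using v' by (auto simp: edges_def)
    ultimately show ?thesis using v' by blast
  qed
  obtain P a where P: "P \<in> ?R" and a: "a < 4" "a \<noteq> 0" and occP: "occ 0 P \<ge> 1" "occ a P \<ge> 1"
    using link[of 0] by auto
  \<comment> \<open>A walk outside the first linked pair. Its own link supplies a second class
    \<open>Q\<close>, which may still coincide with \<open>P\<close>.\<close>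
  obtain u2 where u2: "u2 < 4" "u2 \<noteq> 0" "u2 \<noteq> a"
  proof (cases "a = 1")
    case True thus ?thesis using that[of 2] by simp
  next
    case False thus ?thesis using that[of 1] by simp
  qed
  obtain Q b where Q: "Q \<in> ?R" and b: "b < 4" "b \<noteq> u2" and occQ: "occ u2 Q \<ge> 1" "occ b Q \<ge> 1"
    using link[OF u2(1)] by auto
  consider "card ?R \<le> 2 * m - 2" | "card ?R = 2 * m - 1" | "card ?R = 2 * m" using le by linarith
  thus ?thesis
  proof cases
    case 2
    \<comment> \<open>With \<open>2 * m - 1\<close> classes only 2 elements exceed two per class.
      Were all occurrences even, every walk meeting a class would do so at least twice, and the
      links would force an excess of 4: six elements in one class, or four in each of two.\<close>
    have "\<exists>P\<in>?R. \<exists>u<4. odd (occ u P)"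
    proof (rule ccontr)
      assume "\<not> ?thesis"
      hence ev: "even (occ u P)" if "P \<in> ?R" "u < 4" for u P using that by blast
      have ge2: "occ u P \<ge> 2" if "P \<in> ?R" "u < 4" "occ u P \<ge> 1" for u P
        using ev[OF that(1,2)] that(3) by (auto elim!: evenE)
      have F_ge: "F P \<ge> (\<Sum>u\<in>U. occ u P)" if "U \<subseteq> {..<4}" for U P
        unfolding Focc using that by (intro sum_mono2) auto
      show False
      proof (cases "P = Q")
        case True
        have "6 \<le> (\<Sum>u\<in>{0, a, u2}. occ u P)"
          using ge2[OF P, of 0] ge2[OF P a(1)] ge2[OF P u2(1)] occP occQ True a u2 by simp
        hence "6 \<le> F P" using F_ge[of "{0, a, u2}" P] a u2 by auto
        moreover have "(\<Sum>P\<in>?R. F P) = F P + (\<Sum>P\<in>?R - {P}. F P)" using P by (intro sum.remove) auto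
        moreover have "(\<Sum>P\<in>?R - {P}. F P) \<ge> 2 * (card ?R - 1)"
          using sum_mono[of "?R - {P}" "\<lambda>_. 2" F] F2 P by (simp add: card_Diff_singleton)
        ultimately show False using sumF 2 m by linarith
      next
        case False
        have "4 \<le> (\<Sum>u\<in>{0, a}. occ u P)" using ge2[OF P, of 0] ge2[OF P a(1)] occP a by simp
        hence FP: "4 \<le> F P" using F_ge[of "{0, a}" P] a by auto
        have "4 \<le> (\<Sum>u\<in>{u2, b}. occ u Q)" using ge2[OF Q u2(1)] ge2[OF Q b(1)] occQ b by simp
        hence FQ: "4 \<le> F Q" using F_ge[of "{u2, b}" Q] b u2 by auto
        have s: "(\<Sum>P\<in>?R. F P) = F P + (F Q + (\<Sum>P\<in>?R - {P} - {Q}. F P))"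
          using P Q False by (subst sum.remove[of _ P], simp, simp, subst sum.remove[of _ Q]) auto
        have "card (?R - {P} - {Q}) = card ?R - 2"
          using P Q False by (simp add: card_Diff_singleton)
        hence "(\<Sum>P\<in>?R - {P} - {Q}. F P) \<ge> 2 * (card ?R - 2)"
          using sum_mono[of "?R - {P} - {Q}" "\<lambda>_. 2" F] F2 by simp
        thus False using s FP FQ sumF 2 m by linarith
      qed
    qed
    thus ?thesis using 2 unfolding occ_def by blast
  next
    case 3
    \<comment> \<open>Now all classes have size two, so a class shared by two walks meets each of
      them exactly once and no other walk.\<close>
    have Feq: "F r = 2" if r: "r \<in> ?R" for r
    proof -
      have "(\<Sum>P\<in>?R. F P) = F r + (\<Sum>P\<in>?R - {r}. F P)" using r by (intro sum.remove) auto
      moreover have "(\<Sum>P\<in>?R - {r}. 2) \<le> (\<Sum>P\<in>?R - {r}. F P)" by (rule sum_mono) (use F2 in blast)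
      moreover have "(\<Sum>P\<in>?R - {r}. 2) = 2 * (2 * m - 1)" using 3 r by (simp add: card_Diff_singleton)
      ultimately have "F r + 2 * (2 * m - 1) \<le> 4 * m" using sumF by linarith
      thus ?thesis using F2[OF r] m by linarith
    qed
    note po = pair_occurrences[where f = f and m = m and w = 4]
    have c2: "card {v \<in> edges 4 m. f v = r} = 2" if "r \<in> ?R" for r using Feq[OF that] unfolding F_def .
    have z4: "(0::nat) < 4" by simp
    note P0 = po[OF c2[OF P] z4 a(1) a(2)[symmetric] occP[unfolded occ_def], folded occ_def]
    note Q0 = po[OF c2[OF Q] u2(1) b(1) b(2)[symmetric] occQ[unfolded occ_def], folded occ_def]
    have "P \<noteq> Q" using P0(3)[OF u2] Q0(1) by force
    \<comment> \<open>\<open>Q\<close> meets only \<open>u2\<close> and \<open>b\<close>, so one of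
      the two walks \<open>0\<close> and \<open>a\<close> sharing \<open>P\<close> avoids
      \<open>Q\<close>: it is \<open>a\<close> if \<open>b = 0\<close>, and \<open>0\<close>
      otherwise.\<close>
    moreover have "\<exists>u<4. odd (occ u P) \<and> occ u Q = 0"
    proof (cases "b = 0")
      case True
      have "occ a Q = 0" using Q0(3)[OF a(1)] a u2 True by auto
      thus ?thesis using P0(2) a by (intro exI[of _ a]) auto
    next
      case False
      have "occ 0 Q = 0" using Q0(3)[of 0] u2 False by auto
      thus ?thesis using P0(1) by (intro exI[of _ 0]) auto
    qed
    moreover have "odd (occ u2 Q)" using Q0(1) by simp
    ultimately show ?thesis using 3 P Q u2(1) unfolding occ_def by blast
  qed blast
qed

context link
begin

text \<open>Four starting points and \<open>2 * m - 2\<close> free increments remain. The fourth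
  power of the normalisation of the spectral moment is \<open>N ^ (2 * m + 4)\<close>, so a factor
  \<open>N ^ 2\<close> is gained.\<close>

theorem card_linked_quadruples:
  assumes m: "m > 0" and N: "N \<ge> 1"
  defines "V \<equiv> edges 4 m"
  defines "S \<equiv> {g \<in> {..<4} \<rightarrow>\<^sub>E closed_walks m N.
     (\<forall>v\<in>V. 2 \<le> card {v' \<in> V. lab N m (\<lambda>g. g) g v' = lab N m (\<lambda>g. g) g v}) \<and>
     (\<forall>u<4. \<exists>s<m. \<exists>v'\<in>V. fst v' \<noteq> u \<and> lab N m (\<lambda>g. g) g v' = lab N m (\<lambda>g. g) g (u, s))}"
  shows "card S \<le> card (configs V) * (3 * N) ^ (2 * m + 2)"
proof -
  let ?id = "\<lambda>g :: nat \<Rightarrow> nat \<Rightarrow> nat. g"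
  have "finite S \<and> card S \<le> card (configs (edges 4 m)) * (3 * N) ^ (4 + (2 * m - 2))"
  proof (rule card_obeying_le[where vt = ?id and X = "{..<4} \<rightarrow>\<^sub>E closed_walks m N" and w = 4, OF m N])
    show "g u \<in> closed_walks m N" if "g \<in> {..<4} \<rightarrow>\<^sub>E closed_walks m N" "u < 4" for g u
      using that by (auto dest: PiE_mem)
    show "g = g'" if "g \<in> {..<4} \<rightarrow>\<^sub>E closed_walks m N" "g' \<in> {..<4} \<rightarrow>\<^sub>E closed_walks m N"
      "\<And>u. u < 4 \<Longrightarrow> g u = g' u" for g g' :: "nat \<Rightarrow> nat \<Rightarrow> nat"
      using that by (intro PiE_ext[of g "{..<4}" "\<lambda>_. closed_walks m N" g']) auto
    show "S \<subseteq> {..<4} \<rightarrow>\<^sub>E closed_walks m N" unfolding S_def by blast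
    fix f h c assume cfg: "(f, h, c) \<in> configs (edges 4 m)" and ex: "\<exists>x\<in>S. obeying 4 N m ?id (f, h, c) x"
    then obtain g where g: "g \<in> S" "obeying 4 N m ?id (f, h, c) g" by blast
    have f: "canon V (lab N m ?id g) = f" using g(2) unfolding obeying_def V_def by simp
    have fV: "f v \<in> V" if "v \<in> V" for v using canon_in[OF that, of "lab N m ?id g"] unfolding f by blast
    have idem: "f (f v) = f v" if "v \<in> V" for v using canon_idem[OF that, of "lab N m ?id g"] unfolding f .
    have flab: "f v = f v' \<longleftrightarrow> lab N m ?id g v = lab N m ?id g v'" if "v \<in> V" "v' \<in> V" for v v'
      using canon_eq_iff[OF that, of "lab N m ?id g"] unfolding f .
    have uV: "(u, s) \<in> V" if "u < 4" "s < m" for u s using that unfolding V_def edges_def by simp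
    have rank: "card (f ` V) \<le> 2 * m - 2 \<or>
    (\<exists>P\<in>f ` V. \<exists>u<4. odd (occurrences m f u P) \<and> card (f ` V) = 2 * m - 1) \<or>
    (\<exists>P\<in>f ` V. \<exists>Q\<in>f ` V. P \<noteq> Q \<and> card (f ` V) = 2 * m \<and>
      (\<exists>u<4. \<exists>u'<4. odd (occurrences m f u P) \<and> occurrences m f u Q = 0 \<and> odd (occurrences m f u' Q)))"
      unfolding V_def
    proof (rule linked_quadruple_rank[OF m])
      fix v assume "v \<in> edges 4 m"
      hence v: "v \<in> V" by (simp add: V_def)
      have "{v' \<in> V. f v' = f v} = {v' \<in> V. lab N m ?id g v' = lab N m ?id g v}" using flab[OF _ v] by blast
      thus "2 \<le> card {v' \<in> edges 4 m. f v' = f v}" using g(1) v unfolding S_def V_def[symmetric] by simp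
    next
      fix u :: nat assume u: "u < 4"
      then obtain s v' where "s < m" "v' \<in> V" "fst v' \<noteq> u" "lab N m ?id g v' = lab N m ?id g (u, s)"
        using g(1) unfolding S_def by blast
      thus "\<exists>s<m. \<exists>v'\<in>edges 4 m. fst v' \<noteq> u \<and> f v' = f (u, s)"
        using flab uV[OF u] unfolding V_def[symmetric] by blast
    qed
    have hs: "h v \<in> {-1, 1}" if "v \<in> V" for v
      using cfg that unfolding configs_def V_def by (auto dest: PiE_mem)
    \<comment> \<open>For two walks of one configuration the constants cancel in the difference of
      the increments, which therefore obeys homogeneous relations and the closing condition.\<close>
    have kill: "incr m ?id x P = incr m ?id x' P"
      if x: "obeying 4 N m ?id (f, h, c) x" "obeying 4 N m ?id (f, h, c) x'"
        and u: "u < 4" and odd: "odd (occurrences m f u P)"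
        and other: "\<And>r. r \<in> f ` V \<Longrightarrow> r \<noteq> P \<Longrightarrow> (\<exists>s<m. f (u, s) = r) \<Longrightarrow> incr m ?id x r = incr m ?id x' r"
      for x x' u P
    proof -
      define \<delta> where "\<delta> v = incr m ?id x v - incr m ?id x' v" for v
      have "\<delta> P = 0"
      proof (rule odd_class_increment_0[where u = u and h = h and f = f and m = m])
        fix s assume s: "s < m"
        show "\<delta> (u, s) = h (u, s) * \<delta> (f (u, s))"
          using x uV[OF u s] unfolding obeying_def \<delta>_def V_def[symmetric] by (simp add: right_diff_distrib)
        show "h (u, s) \<in> {-1, 1}" using hs uV[OF u s] by blast
        show "\<delta> (f (u, s)) = 0" if "f (u, s) \<noteq> P"
          unfolding \<delta>_def using other[of "f (u, s)"] that s uV[OF u s] by auto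
      next
        show "(\<Sum>s<m. \<delta> (u, s)) = 0" unfolding \<delta>_def using sum_incr_eq_0[OF m, of ?id] by (simp add: sum_subtractf)
        show "odd (card {s. s < m \<and> f (u, s) = P})" using odd unfolding occurrences_def .
      qed
      thus ?thesis by (simp add: \<delta>_def)
    qed
    have occ0: "f (u, s) \<noteq> Q" if "occurrences m f u Q = 0" "s < m" for u s Q
      using that occurrences_pos[of s m f u Q] by auto
    have finR: "finite (f ` V)" by (simp add: V_def)
    from rank consider "card (f ` V) \<le> 2 * m - 2"
      | P u where "P \<in> f ` V" "u < 4" "odd (occurrences m f u P)" "card (f ` V) = 2 * m - 1"
      | P Q u u' where "P \<in> f ` V" "Q \<in> f ` V" "P \<noteq> Q" "card (f ` V) = 2 * m" "u < 4" "u' < 4"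
          "odd (occurrences m f u P)" "occurrences m f u Q = 0" "odd (occurrences m f u' Q)"
      by blast
    hence "\<exists>Z. card (f ` V - Z) \<le> 2 * m - 2 \<and>
         (\<forall>x\<in>S. \<forall>x'\<in>S. obeying 4 N m ?id (f, h, c) x \<longrightarrow> obeying 4 N m ?id (f, h, c) x' \<longrightarrow>
           (\<forall>r\<in>f ` V - Z. incr m ?id x r = incr m ?id x' r) \<longrightarrow> (\<forall>r\<in>Z. incr m ?id x r = incr m ?id x' r))"
    proof cases
      case 1
      thus ?thesis by (intro exI[of _ "{}"]) auto
    next
      case 2
      have "card (f ` V - {P}) \<le> 2 * m - 2" using 2 finR by (simp add: card_Diff_singleton)
      moreover have "incr m ?id x P = incr m ?id x' P"
        if "obeying 4 N m ?id (f, h, c) x" "obeying 4 N m ?id (f, h, c) x'"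
          "\<forall>r\<in>f ` V - {P}. incr m ?id x r = incr m ?id x' r" for x x'
        using kill[OF that(1,2) 2(2,3)] that(3) by blast
      ultimately show ?thesis by (intro exI[of _ "{P}"]) blast
    next
      case 3
      have "card (f ` V - {P, Q}) = card (f ` V) - card {P, Q}" using 3 finR by (intro card_Diff_subset) auto
      hence "card (f ` V - {P, Q}) \<le> 2 * m - 2" using 3 by simp
      moreover have "incr m ?id x r = incr m ?id x' r"
        if x: "obeying 4 N m ?id (f, h, c) x" "obeying 4 N m ?id (f, h, c) x'"
          and eq: "\<forall>r\<in>f ` V - {P, Q}. incr m ?id x r = incr m ?id x' r" and r: "r \<in> {P, Q}" for x x' r
      proof -
        \<comment> \<open>The order matters: the walk \<open>u\<close> avoids \<open>Q\<close> and
          determines the increment on \<open>P\<close>; only afterwards can the closing condition of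
          \<open>u'\<close> determine the one on \<open>Q\<close>.\<close>
        have P: "incr m ?id x P = incr m ?id x' P"
        proof (rule kill[OF x 3(5,7)])
          fix r assume "r \<in> f ` V" "r \<noteq> P" "\<exists>s<m. f (u, s) = r"
          moreover from this have "r \<noteq> Q" using occ0[OF 3(8)] by blast
          ultimately show "incr m ?id x r = incr m ?id x' r" using eq by blast
        qed
        have "incr m ?id x Q = incr m ?id x' Q"
        proof (rule kill[OF x 3(6,9)])
          fix r assume "r \<in> f ` V" "r \<noteq> Q"
          thus "incr m ?id x r = incr m ?id x' r" using eq P by (cases "r = P") blast+
        qed
        thus ?thesis using P r by blast
      qed
      ultimately show ?thesis by (intro exI[of _ "{P, Q}"]) blast
    qed
    thus "\<exists>Z. card (f ` edges 4 m - Z) \<le> 2 * m - 2 \<and>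
         (\<forall>x\<in>S. \<forall>x'\<in>S. obeying 4 N m ?id (f, h, c) x \<longrightarrow> obeying 4 N m ?id (f, h, c) x' \<longrightarrow>
           (\<forall>r\<in>f ` edges 4 m - Z. incr m ?id x r = incr m ?id x' r) \<longrightarrow> (\<forall>r\<in>Z. incr m ?id x r = incr m ?id x' r))"
      unfolding V_def .
  qed
  moreover have "4 + (2 * m - 2) = 2 * m + 2" using m by simp
  ultimately show ?thesis unfolding V_def by simp
qed

end

declare One_nat_def [simp del]

section \<open>Pairings\<close>

text \<open>Views one walk as a family with a single member, so that the counts for families apply
  with \<open>w = 1\<close>.\<close>

definition solo :: "(nat \<Rightarrow> nat) \<Rightarrow> nat \<Rightarrow> nat \<Rightarrow> nat" where
  "solo i u = i"

lemma edges_1: "edges 1 m = {0} \<times> {..<m}"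
  by (auto simp: edges_def)

lemma sum_edges_1: "(\<Sum>v\<in>edges 1 m. g v) = (\<Sum>r<m. g (0, r))"
proof -
  have "edges 1 m = Pair 0 ` {..<m}" by (auto simp: edges_def)
  thus ?thesis by (simp add: sum.reindex inj_on_def)
qed

lemma src_solo [simp]: "src solo i v = i (snd v)" by (simp add: src_def solo_def)
lemma tgt_solo [simp]: "tgt m solo i v = i (Suc (snd v) mod m)" by (simp add: tgt_def solo_def)

definition orient :: "(nat \<times> nat \<Rightarrow> nat \<times> nat) \<Rightarrow> nat \<times> nat \<Rightarrow> int" where
  "orient f v = (if f v = v then 1 else - 1)"

text \<open>With \<open>vertex_const\<close> this describes the vertex at position \<open>p\<close>
  as an affine form: starting point, plus the increments on the representatives with these
  coefficients, plus a multiple of \<open>N - 1\<close>.\<close>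

definition vertex_coeff :: "(nat \<times> nat \<Rightarrow> nat \<times> nat) \<Rightarrow> nat \<Rightarrow> nat \<times> nat \<Rightarrow> int" where
  "vertex_coeff f p \<rho> = (\<Sum>r<p. if f (0, r) = \<rho> then orient f (0, r) else 0)"

definition vertex_const :: "(nat \<times> nat \<Rightarrow> int) \<Rightarrow> nat \<Rightarrow> int" where
  "vertex_const c p = (\<Sum>r<p. c (0, r))"

text \<open>A partition into pairs is encoded by its canonical representative map; being a fixed
  point of \<open>canon\<close> makes the encoding unique.\<close>

definition pairings :: "nat \<Rightarrow> (nat \<times> nat \<Rightarrow> nat \<times> nat) set" where
  "pairings k = {f \<in> edges 1 (2 * k) \<rightarrow>\<^sub>E edges 1 (2 * k). canon (edges 1 (2 * k)) f = f \<and>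
     (\<forall>v\<in>edges 1 (2 * k). card {v' \<in> edges 1 (2 * k). f v' = f v} = 2)}"

definition matched_walks :: "nat \<Rightarrow> nat \<Rightarrow> (nat \<times> nat \<Rightarrow> nat \<times> nat) \<Rightarrow> (nat \<times> nat \<Rightarrow> int) \<Rightarrow> (nat \<Rightarrow> nat) set" where
  "matched_walks k N f c = {i \<in> closed_walks (2 * k) N. \<forall>v\<in>edges 1 (2 * k).
     incr (2 * k) solo i v = orient f v * incr (2 * k) solo i (f v) + c v * (int N - 1)}"

lemma pairings_idem: "f \<in> pairings k \<Longrightarrow> v \<in> edges 1 (2 * k) \<Longrightarrow> f (f v) = f v"
  using canon_idem[of v "edges 1 (2 * k)" f] unfolding pairings_def by simp

lemma pairings_in: "f \<in> pairings k \<Longrightarrow> v \<in> edges 1 (2 * k) \<Longrightarrow> f v \<in> edges 1 (2 * k)"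
  unfolding pairings_def by (auto dest: PiE_mem)

lemma card_image_fibers_2:
  assumes V: "finite V" and "\<And>v. v \<in> V \<Longrightarrow> card {v' \<in> V. f v' = f v} = 2"
  shows "card V = 2 * card (f ` V)"
proof -
  have "card V = (\<Sum>r\<in>f ` V. card {v \<in> V. f v = r})"
    using sum.image_gen[OF V, of "\<lambda>_. 1::nat" f] by simp
  also have "\<dots> = (\<Sum>r\<in>f ` V. 2)" using assms(2) by (intro sum.cong) auto
  finally show ?thesis by simp
qed

lemma pairings_card_image: "f \<in> pairings k \<Longrightarrow> card (f ` edges 1 (2 * k)) = k"
  using card_image_fibers_2[of "edges 1 (2 * k)" f] by (auto simp: pairings_def card_edges)

lemma pairings_fiber:
  assumes f: "f \<in> pairings k" and v: "v \<in> edges 1 (2 * k)" "f v \<noteq> v"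
  shows "{v' \<in> edges 1 (2 * k). f v' = f v} = {v, f v}"
proof (rule card_seteq[symmetric])
  show "finite {v' \<in> edges 1 (2 * k). f v' = f v}" by simp
  show "{v, f v} \<subseteq> {v' \<in> edges 1 (2 * k). f v' = f v}"
    using v pairings_in[OF f v(1)] pairings_idem[OF f v(1)] by auto
  show "card {v' \<in> edges 1 (2 * k). f v' = f v} \<le> card {v, f v}"
    using f v unfolding pairings_def by auto
qed

lemma pairings_nonrep:
  assumes f: "f \<in> pairings k" and r: "r \<in> f ` edges 1 (2 * k)"
  shows "\<exists>v\<in>edges 1 (2 * k). f v = r \<and> v \<noteq> r"
proof (rule ccontr)
  assume *: "\<not> (\<exists>v\<in>edges 1 (2 * k). f v = r \<and> v \<noteq> r)"
  obtain v where v: "v \<in> edges 1 (2 * k)" "f v = r" using r by auto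
  have "{v' \<in> edges 1 (2 * k). f v' = f v} \<subseteq> {r}" using * v by auto
  hence "card {v' \<in> edges 1 (2 * k). f v' = f v} \<le> card {r}" by (intro card_mono) auto
  thus False using f v unfolding pairings_def by auto
qed

lemma sum_orient_eq:
  fixes g :: "nat \<times> nat \<Rightarrow> int"
  assumes "finite R" "\<And>r. r < p \<Longrightarrow> f (0, r) \<in> R"
  shows "(\<Sum>r<p. orient f (0, r) * g (f (0, r))) = (\<Sum>\<rho>\<in>R. vertex_coeff f p \<rho> * g \<rho>)"
proof -
  have "(\<Sum>\<rho>\<in>R. vertex_coeff f p \<rho> * g \<rho>)
      = (\<Sum>\<rho>\<in>R. \<Sum>r<p. (if f (0, r) = \<rho> then orient f (0, r) else 0) * g \<rho>)"
    by (simp add: vertex_coeff_def sum_distrib_right)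
  also have "\<dots> = (\<Sum>r<p. \<Sum>\<rho>\<in>R. (if f (0, r) = \<rho> then orient f (0, r) else 0) * g \<rho>)"
    by (rule sum.swap)
  also have "\<dots> = (\<Sum>r<p. orient f (0, r) * g (f (0, r)))"
  proof (rule sum.cong[OF refl])
    fix r assume "r \<in> {..<p}"
    hence fR: "f (0, r) \<in> R" using assms(2) by auto
    have "(\<Sum>\<rho>\<in>R. (if f (0, r) = \<rho> then orient f (0, r) else 0) * g \<rho>)
        = (\<Sum>\<rho>\<in>R. if f (0, r) = \<rho> then orient f (0, r) * g \<rho> else 0)"
      by (intro sum.cong) auto
    also have "\<dots> = orient f (0, r) * g (f (0, r))" using assms(1) fR by simp
    finally show "(\<Sum>\<rho>\<in>R. (if f (0, r) = \<rho> then orient f (0, r) else 0) * g \<rho>) = orient f (0, r) * g (f (0, r))" .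
  qed
  finally show ?thesis by simp
qed

text \<open>The two members of a pair have opposite orientation and cancel. The closing condition
  thus imposes nothing on the increments, and all \<open>k + 1\<close> dimensions survive.\<close>

lemma vertex_coeff_closing:
  assumes f: "f \<in> pairings k" and \<rho>: "\<rho> \<in> f ` edges 1 (2 * k)"
  shows "vertex_coeff f (2 * k) \<rho> = 0"
proof -
  obtain v where v: "v \<in> edges 1 (2 * k)" "f v = \<rho>" "v \<noteq> \<rho>" using pairings_nonrep[OF f \<rho>] by blast
  have fib: "{v' \<in> edges 1 (2 * k). f v' = \<rho>} = {v, \<rho>}" using pairings_fiber[OF f v(1)] v by auto
  have idem: "f \<rho> = \<rho>" using pairings_idem[OF f v(1)] v by simp
  have "vertex_coeff f (2 * k) \<rho> = (\<Sum>w\<in>edges 1 (2 * k). if f w = \<rho> then orient f w else 0)"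
    unfolding vertex_coeff_def by (rule sum_edges_1[symmetric])
  also have "\<dots> = (\<Sum>w\<in>{v, \<rho>}. orient f w)"
    by (subst sum.inter_filter[symmetric]) (simp_all add: fib)
  also have "\<dots> = 0" using v idem by (simp add: orient_def)
  finally show ?thesis .
qed

lemma walk_telescope:
  "p < m \<Longrightarrow> int (i p) = int (i 0) + (\<Sum>r<p. incr m solo i (0, r))"
proof (induction p)
  case (Suc p)
  have "incr m solo i (0, p) = int (i (Suc p)) - int (i p)" using Suc.prems by (simp add: incr_def)
  thus ?case using Suc by simp
qed simp

lemma matched_walk_vertex:
  assumes f: "f \<in> pairings k" and i: "i \<in> matched_walks k N f c" and p: "p < 2 * k"
  shows "int (i p) = int (i 0) + (\<Sum>\<rho>\<in>f ` edges 1 (2 * k). vertex_coeff f p \<rho> * incr (2 * k) solo i \<rho>)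
           + vertex_const c p * (int N - 1)"
proof -
  have "(\<Sum>r<p. incr (2 * k) solo i (0, r))
      = (\<Sum>r<p. orient f (0, r) * incr (2 * k) solo i (f (0, r)) + c (0, r) * (int N - 1))"
    using i p by (intro sum.cong) (auto simp: matched_walks_def edges_1)
  also have "\<dots> = (\<Sum>r<p. orient f (0, r) * incr (2 * k) solo i (f (0, r))) + vertex_const c p * (int N - 1)"
    by (simp add: sum.distrib vertex_const_def sum_distrib_right)
  also have "(\<Sum>r<p. orient f (0, r) * incr (2 * k) solo i (f (0, r)))
      = (\<Sum>\<rho>\<in>f ` edges 1 (2 * k). vertex_coeff f p \<rho> * incr (2 * k) solo i \<rho>)"
    using p by (intro sum_orient_eq) (auto simp: edges_1)
  finally show ?thesis using walk_telescope[OF p, of i] by simp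
qed

text \<open>
  The coordinate \<open>None\<close> is the starting point of the walk, \<open>Some \<rho>\<close> the increment along the
  representative \<open>\<rho>\<close>.
\<close>

definition form_index :: "nat \<Rightarrow> (nat \<times> nat \<Rightarrow> nat \<times> nat) \<Rightarrow> (nat \<times> nat) option set" where
  "form_index k f = insert None (Some ` f ` edges 1 (2 * k))"

text \<open>The condition that the vertex at \<open>p\<close> is at least 0;
  \<open>upper_form\<close> expresses that it is at most \<open>N - 1\<close>. Both have a constant
  proportional to \<open>N - 1\<close>, as the forms of the polytope require.\<close>

definition lower_form :: "(nat \<times> nat \<Rightarrow> nat \<times> nat) \<Rightarrow> (nat \<times> nat \<Rightarrow> int) \<Rightarrow> nat \<Rightarrow> ((nat \<times> nat) option \<Rightarrow> int) \<times> int" where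
  "lower_form f c p = ((\<lambda>j. case j of None \<Rightarrow> 1 | Some \<rho> \<Rightarrow> vertex_coeff f p \<rho>), vertex_const c p)"

definition upper_form :: "(nat \<times> nat \<Rightarrow> nat \<times> nat) \<Rightarrow> (nat \<times> nat \<Rightarrow> int) \<Rightarrow> nat \<Rightarrow> ((nat \<times> nat) option \<Rightarrow> int) \<times> int" where
  "upper_form f c p = ((\<lambda>j. case j of None \<Rightarrow> - 1 | Some \<rho> \<Rightarrow> - vertex_coeff f p \<rho>), 1 - vertex_const c p)"

lemma sum_form_index:
  fixes g :: "(nat \<times> nat) option \<Rightarrow> int"
  shows "(\<Sum>j\<in>form_index k f. g j) = g None + (\<Sum>\<rho>\<in>f ` edges 1 (2 * k). g (Some \<rho>))"
proof -
  have "(\<Sum>j\<in>form_index k f. g j) = g None + (\<Sum>j\<in>Some ` f ` edges 1 (2 * k). g j)"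
    unfolding form_index_def by (subst sum.insert) auto
  also have "(\<Sum>j\<in>Some ` f ` edges 1 (2 * k). g j) = (\<Sum>\<rho>\<in>f ` edges 1 (2 * k). g (Some \<rho>))"
    by (subst sum.reindex) auto
  finally show ?thesis .
qed

definition vertex_val :: "nat \<Rightarrow> nat \<Rightarrow> (nat \<times> nat \<Rightarrow> nat \<times> nat) \<Rightarrow> (nat \<times> nat \<Rightarrow> int) \<Rightarrow> ((nat \<times> nat) option \<Rightarrow> int) \<Rightarrow> nat \<Rightarrow> int" where
  "vertex_val k N f c y p = y None + (\<Sum>\<rho>\<in>f ` edges 1 (2 * k). vertex_coeff f p \<rho> * y (Some \<rho>)) + vertex_const c p * (int N - 1)"

lemma form_val_lower: "form_val (form_index k f) N (lower_form f c p) y = vertex_val k N f c y p"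
  unfolding form_val_def sum_form_index vertex_val_def by (simp add: lower_form_def)

lemma form_val_upper: "form_val (form_index k f) N (upper_form f c p) y = int N - 1 - vertex_val k N f c y p"
  unfolding form_val_def sum_form_index vertex_val_def
  by (simp add: upper_form_def sum_negf algebra_simps)

definition walk_forms :: "nat \<Rightarrow> (nat \<times> nat \<Rightarrow> nat \<times> nat) \<Rightarrow> (nat \<times> nat \<Rightarrow> int) \<Rightarrow> (((nat \<times> nat) option \<Rightarrow> int) \<times> int) set" where
  "walk_forms k f c = lower_form f c ` {..<2 * k} \<union> upper_form f c ` {..<2 * k}"

lemma lattice_points_walk_forms:
  "y \<in> lattice_points (form_index k f) (walk_forms k f c) N \<longleftrightarrow>
   y \<in> int_box (form_index k f) N \<and> (\<forall>p<2 * k. 0 \<le> vertex_val k N f c y p \<and> vertex_val k N f c y p < int N)"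
  unfolding lattice_points_def walk_forms_def mem_Collect_eq ball_Un Set.ball_simps(9)
  by (auto simp: form_val_lower form_val_upper)

lemma vertex_val_0 [simp]: "vertex_val k N f c y 0 = y None"
  by (simp add: vertex_val_def vertex_coeff_def vertex_const_def)

lemma vertex_val_Suc:
  assumes "f (0, p) \<in> f ` edges 1 (2 * k)"
  shows "vertex_val k N f c y (Suc p) = vertex_val k N f c y p + orient f (0, p) * y (Some (f (0, p))) + c (0, p) * (int N - 1)"
proof -
  let ?R = "f ` edges 1 (2 * k)"
  have "(\<Sum>\<rho>\<in>?R. vertex_coeff f (Suc p) \<rho> * y (Some \<rho>))
      = (\<Sum>\<rho>\<in>?R. vertex_coeff f p \<rho> * y (Some \<rho>) + (if f (0, p) = \<rho> then orient f (0, p) * y (Some \<rho>) else 0))"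
    by (intro sum.cong) (auto simp: vertex_coeff_def distrib_right)
  also have "\<dots> = (\<Sum>\<rho>\<in>?R. vertex_coeff f p \<rho> * y (Some \<rho>)) + orient f (0, p) * y (Some (f (0, p)))"
    using assms by (simp add: sum.distrib)
  finally show ?thesis by (simp add: vertex_val_def vertex_const_def distrib_right)
qed

text \<open>Starting point and representative increments are coordinates for these walks, and the
  box together with the vertex constraints is exactly their range. The condition that the constants
  sum to 0 makes the reconstructed walk close up.\<close>

lemma matched_walks_bij:
  assumes f: "f \<in> pairings k" and k: "k > 0" and N: "N \<ge> 1"
    and c0: "\<And>v. v \<in> edges 1 (2 * k) \<Longrightarrow> f v = v \<Longrightarrow> c v = 0" and closing: "vertex_const c (2 * k) = 0"
  shows "card (matched_walks k N f c) = card (lattice_points (form_index k f) (walk_forms k f c) N)"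
proof (rule bij_betw_same_card)
  let ?V = "edges 1 (2 * k)" let ?J = "form_index k f"
  define \<Phi> where "\<Phi> i = (\<lambda>j\<in>?J. case j of None \<Rightarrow> int (i 0) | Some \<rho> \<Rightarrow> incr (2 * k) solo i \<rho>)" for i
  define \<Psi> where "\<Psi> y = (\<lambda>p\<in>{..<2 * k}. nat (vertex_val k N f c y p))" for y
  have val: "vertex_val k N f c (\<Phi> i) p = int (i p)" if "i \<in> matched_walks k N f c" "p < 2 * k" for i p
  proof -
    have "\<Phi> i None = int (i 0)" by (simp add: \<Phi>_def form_index_def)
    moreover have "\<Phi> i (Some \<rho>) = incr (2 * k) solo i \<rho>" if "\<rho> \<in> f ` ?V" for \<rho>
      using that by (simp add: \<Phi>_def form_index_def)
    ultimately show ?thesis using matched_walk_vertex[OF f that] unfolding vertex_val_def by simp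
  qed
  have walkN: "i p < N" if "i \<in> matched_walks k N f c" "p < 2 * k" for i p
    using that(1) closed_walk_less[OF _ that(2), of i N] unfolding matched_walks_def by simp
  show "bij_betw \<Phi> (matched_walks k N f c) (lattice_points ?J (walk_forms k f c) N)"
  proof (rule bij_betwI[where g = \<Psi>])
    show "\<Phi> \<in> matched_walks k N f c \<rightarrow> lattice_points ?J (walk_forms k f c) N"
    proof
      fix i assume i: "i \<in> matched_walks k N f c"
      have "\<Phi> i \<in> int_box ?J N" unfolding int_box_def \<Phi>_def restrict_PiE_iff
      proof
        fix j assume j: "j \<in> ?J"
        show "(case j of None \<Rightarrow> int (i 0) | Some \<rho> \<Rightarrow> incr (2 * k) solo i \<rho>) \<in> {- int N..<int N}"
        proof (cases j)
          case None
          thus ?thesis using walkN[OF i, of 0] k by simp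
        next
          case (Some \<rho>)
          hence "\<rho> \<in> ?V" using j pairings_in[OF f] by (auto simp: form_index_def)
          hence "snd \<rho> < 2 * k" by (auto simp: edges_1)
          moreover have "Suc (snd \<rho>) mod (2 * k) < 2 * k" using k by simp
          ultimately have "i (snd \<rho>) < N" "i (Suc (snd \<rho>) mod (2 * k)) < N" using walkN[OF i] by blast+
          thus ?thesis using Some by (simp add: incr_def)
        qed
      qed
      thus "\<Phi> i \<in> lattice_points ?J (walk_forms k f c) N"
        unfolding lattice_points_walk_forms using val[OF i] walkN[OF i] by simp
    qed
    show "\<Psi> (\<Phi> i) = i" if i: "i \<in> matched_walks k N f c" for i
    proof -
      have "i \<in> extensional {..<2 * k}" using i unfolding matched_walks_def closed_walks_def by (simp add: PiE_iff)
      thus ?thesis unfolding \<Psi>_def by (auto simp: fun_eq_iff val[OF i] extensional_def)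
    qed
    have inv: "incr (2 * k) solo (\<Psi> y) (0, p) = orient f (0, p) * y (Some (f (0, p))) + c (0, p) * (int N - 1)"
      if y: "y \<in> lattice_points ?J (walk_forms k f c) N" and p: "p < 2 * k" for y p
    proof -
      have nn: "int (\<Psi> y q) = vertex_val k N f c y q" if "q < 2 * k" for q
        using y that unfolding lattice_points_walk_forms \<Psi>_def by simp
      have last: "vertex_val k N f c y (2 * k) = vertex_val k N f c y 0"
        unfolding vertex_val_def using closing vertex_coeff_closing[OF f]
        by (simp add: vertex_coeff_def[of f 0] vertex_const_def[of c 0])
      have "vertex_val k N f c y (Suc p mod (2 * k)) = vertex_val k N f c y (Suc p)"
      proof (cases "Suc p = 2 * k")
        case True
        thus ?thesis using last by simp
      qed (use p in simp)
      moreover have "Suc p mod (2 * k) < 2 * k" using k by simp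
      ultimately have "incr (2 * k) solo (\<Psi> y) (0, p) = vertex_val k N f c y (Suc p) - vertex_val k N f c y p"
        using nn p by (simp add: incr_def)
      thus ?thesis using vertex_val_Suc[of f p k N c y] p by (simp add: edges_1)
    qed
    have rep: "incr (2 * k) solo (\<Psi> y) \<rho> = y (Some \<rho>)"
      if y: "y \<in> lattice_points ?J (walk_forms k f c) N" and \<rho>: "\<rho> \<in> f ` ?V" for y \<rho>
    proof -
      obtain v where v: "v \<in> ?V" "\<rho> = f v" using \<rho> by auto
      have \<rho>V: "\<rho> \<in> ?V" "f \<rho> = \<rho>" using pairings_in[OF f v(1)] pairings_idem[OF f v(1)] v(2) by auto
      then obtain p where p: "\<rho> = (0, p)" "p < 2 * k" by (auto simp: edges_1)
      show ?thesis using inv[OF y p(2)] c0[OF \<rho>V] \<rho>V(2) by (simp add: p orient_def)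
    qed
    show "\<Psi> \<in> lattice_points ?J (walk_forms k f c) N \<rightarrow> matched_walks k N f c"
    proof
      fix y assume y: "y \<in> lattice_points ?J (walk_forms k f c) N"
      have "nat (vertex_val k N f c y p) \<in> {..<N}" if "p < 2 * k" for p
      proof -
        have "0 \<le> vertex_val k N f c y p \<and> vertex_val k N f c y p < int N"
          using y that unfolding lattice_points_walk_forms by blast
        thus ?thesis by (simp add: nat_less_iff)
      qed
      hence cw: "\<Psi> y \<in> closed_walks (2 * k) N" unfolding \<Psi>_def closed_walks_def restrict_PiE_iff by blast
      have step: "incr (2 * k) solo (\<Psi> y) v = orient f v * incr (2 * k) solo (\<Psi> y) (f v) + c v * (int N - 1)"
        if v: "v \<in> ?V" for v
      proof -
        obtain p where p: "v = (0, p)" "p < 2 * k" using v by (auto simp: edges_1)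
        have fr: "incr (2 * k) solo (\<Psi> y) (f v) = y (Some (f v))" by (rule rep[OF y]) (use v in blast)
        show ?thesis unfolding fr unfolding p(1) by (rule inv[OF y p(2)])
      qed
      show "\<Psi> y \<in> matched_walks k N f c" unfolding matched_walks_def
        by (intro CollectI conjI ballI cw step)
    qed
    show "\<Phi> (\<Psi> y) = y" if y: "y \<in> lattice_points ?J (walk_forms k f c) N" for y
    proof
      fix j
      show "\<Phi> (\<Psi> y) j = y j"
      proof (cases "j \<in> ?J")
        case False
        have "y \<in> int_box ?J N" using y unfolding lattice_points_walk_forms by (rule conjunct1)
        hence "y j = undefined" using False unfolding int_box_def by (rule PiE_arb)
        thus ?thesis using False unfolding \<Phi>_def by (simp only: restrict_apply if_False)
      next
        case True
        have "0 < 2 * k" using k by simp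
        hence "0 \<le> vertex_val k N f c y 0" using y unfolding lattice_points_walk_forms by blast
        hence y0: "int (\<Psi> y 0) = y None" using k by (simp add: \<Psi>_def)
        show ?thesis
        proof (cases j)
          case None
          show ?thesis using True unfolding \<Phi>_def None by (simp only: restrict_apply if_True option.case y0)
        next
          case (Some \<rho>)
          hence "\<rho> \<in> f ` ?V" using True by (auto simp: form_index_def)
          from rep[OF y this] show ?thesis using True unfolding \<Phi>_def Some
            by (simp only: restrict_apply if_True option.case)
        qed
      qed
    qed
  qed
qed

text \<open>If the constants sum to 0, the walks are lattice points of a dilated polytope in
  dimension \<open>k + 1\<close>. Otherwise the increments cancel in the closing condition and leave
  a nonzero multiple of \<open>N - 1\<close>, so no such walk exists for large
  \<open>N\<close>.\<close>

theorem matched_walks_density: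
  assumes f: "f \<in> pairings k" and k: "k > 0"
    and c0: "\<And>v. v \<in> edges 1 (2 * k) \<Longrightarrow> f v = v \<Longrightarrow> c v = 0"
  shows "convergent (\<lambda>N. real (card (matched_walks k N f c)) / real N ^ (k + 1))"
proof (cases "vertex_const c (2 * k) = 0")
  case True
  have J: "finite (form_index k f)" "card (form_index k f) = k + 1"
  proof -
    show "finite (form_index k f)" by (simp add: form_index_def)
    have "card (form_index k f) = Suc (card (Some ` f ` edges 1 (2 * k)))"
      unfolding form_index_def by (subst card_insert_disjoint) auto
    also have "card (Some ` f ` edges 1 (2 * k)) = k"
      by (subst card_image) (auto simp: pairings_card_image[OF f])
    finally show "card (form_index k f) = k + 1" by simp
  qed
  have "convergent (\<lambda>N. real (card (lattice_points (form_index k f) (walk_forms k f c) N)) / real N ^ card (form_index k f))"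
  proof (rule lattice_points_density_convergent[OF J(1)])
    show "finite (walk_forms k f c)" by (simp add: walk_forms_def)
    fix l assume "l \<in> walk_forms k f c"
    \<comment> \<open>The starting point enters every vertex with coefficient 1, so no form is
      degenerate.\<close>
    hence "fst l None \<noteq> 0" by (auto simp: walk_forms_def lower_form_def upper_form_def)
    thus "\<exists>j\<in>form_index k f. fst l j \<noteq> 0" by (intro bexI[of _ None]) (auto simp: form_index_def)
  qed
  then obtain l where "(\<lambda>N. real (card (lattice_points (form_index k f) (walk_forms k f c) N)) / real N ^ (k + 1)) \<longlonglongrightarrow> l"
    unfolding J(2) convergent_def by blast
  moreover have "eventually (\<lambda>N. real (card (lattice_points (form_index k f) (walk_forms k f c) N)) / real N ^ (k + 1)
      = real (card (matched_walks k N f c)) / real N ^ (k + 1)) sequentially"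
    using eventually_ge_at_top[of 1]
  proof eventually_elim
    case (elim N)
    have "card (matched_walks k N f c) = card (lattice_points (form_index k f) (walk_forms k f c) N)"
      by (rule matched_walks_bij[OF f k elim c0 True])
    thus ?case by (simp only:)
  qed
  ultimately have "(\<lambda>N. real (card (matched_walks k N f c)) / real N ^ (k + 1)) \<longlonglongrightarrow> l"
    by (rule Lim_transform_eventually)
  thus ?thesis by (rule convergentI)
next
  case False
  have empty: "matched_walks k N f c = {}" if "N \<ge> 2" for N
  proof (rule ccontr)
    assume "matched_walks k N f c \<noteq> {}"
    then obtain i where i: "i \<in> matched_walks k N f c" by auto
    have "0 = (\<Sum>r<2 * k. incr (2 * k) solo i (0, r))" using sum_incr_eq_0[of "2 * k" solo i 0] k by simp
    also have "\<dots> = (\<Sum>r<2 * k. orient f (0, r) * incr (2 * k) solo i (f (0, r)) + c (0, r) * (int N - 1))"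
      using i by (intro sum.cong) (auto simp: matched_walks_def edges_1)
    also have "\<dots> = (\<Sum>r<2 * k. orient f (0, r) * incr (2 * k) solo i (f (0, r))) + vertex_const c (2 * k) * (int N - 1)"
      by (simp add: sum.distrib vertex_const_def sum_distrib_right)
    also have "(\<Sum>r<2 * k. orient f (0, r) * incr (2 * k) solo i (f (0, r)))
      = (\<Sum>\<rho>\<in>f ` edges 1 (2 * k). vertex_coeff f (2 * k) \<rho> * incr (2 * k) solo i \<rho>)"
      by (intro sum_orient_eq) (auto simp: edges_1)
    also have "\<dots> = 0" by (rule sum.neutral) (simp add: vertex_coeff_closing[OF f])
    finally show False using False that by simp
  qed
  have "eventually (\<lambda>N. 0 = real (card (matched_walks k N f c)) / real N ^ (k + 1)) sequentially"
    using eventually_ge_at_top[of 2]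
  proof eventually_elim
    case (elim N)
    show ?case unfolding empty[OF elim] by simp
  qed
  hence "(\<lambda>N. real (card (matched_walks k N f c)) / real N ^ (k + 1)) \<longlonglongrightarrow> 0"
    by (rule Lim_transform_eventually[OF tendsto_const])
  thus ?thesis by (rule convergentI)
qed

text \<open>
  The index of the first vertex that generically, that is up to \<open>O(N\<^bsup>k\<^esup>)\<close> walks, coincides with the
  \<open>p\<close>-th one.
\<close>

definition generic_vertex :: "nat \<Rightarrow> (nat \<times> nat \<Rightarrow> nat \<times> nat) \<Rightarrow> (nat \<times> nat \<Rightarrow> int) \<Rightarrow> nat \<Rightarrow> nat" where
  "generic_vertex k f c = canon {..<2 * k} (\<lambda>p. (restrict (vertex_coeff f p) (f ` edges 1 (2 * k)), vertex_const c p))"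

definition degenerate_walks :: "nat \<Rightarrow> nat \<Rightarrow> (nat \<times> nat \<Rightarrow> nat \<times> nat) \<Rightarrow> (nat \<times> nat \<Rightarrow> int) \<Rightarrow> (nat \<Rightarrow> nat) set" where
  "degenerate_walks k N f c = {i \<in> matched_walks k N f c. \<exists>p<2 * k. \<exists>q<2 * k.
     (i p = i q) \<noteq> (generic_vertex k f c p = generic_vertex k f c q)}"

text \<open>The difference of two vertices is an affine form. If its linear part vanishes, the
  constants alone decide coincidence as soon as \<open>N - 1\<close> is nonzero. If not, the
  vertices are generically distinct, and coincidence determines one increment from the
  others.\<close>

lemma card_degenerate_walks:
  assumes f: "f \<in> pairings k" and k: "k > 0" and N: "N \<ge> 2"
  shows "card (degenerate_walks k N f c) \<le> (2 * k * (2 * k)) * (3 * N) ^ k"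
proof -
  let ?V = "edges 1 (2 * k)" let ?R = "f ` edges 1 (2 * k)"
  define T where "T pq = {i \<in> matched_walks k N f c. (i (fst pq) = i (snd pq)) \<noteq>
     (generic_vertex k f c (fst pq) = generic_vertex k f c (snd pq))}" for pq
  have geq: "generic_vertex k f c p = generic_vertex k f c q \<longleftrightarrow>
      (\<forall>\<rho>\<in>?R. vertex_coeff f p \<rho> = vertex_coeff f q \<rho>) \<and> vertex_const c p = vertex_const c q"
    if "p < 2 * k" "q < 2 * k" for p q
  proof -
    have "generic_vertex k f c p = generic_vertex k f c q \<longleftrightarrow>
        restrict (vertex_coeff f p) ?R = restrict (vertex_coeff f q) ?R \<and> vertex_const c p = vertex_const c q"
      unfolding generic_vertex_def using that by (subst canon_eq_iff) auto
    also have "restrict (vertex_coeff f p) ?R = restrict (vertex_coeff f q) ?R \<longleftrightarrow> (\<forall>\<rho>\<in>?R. vertex_coeff f p \<rho> = vertex_coeff f q \<rho>)"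
    proof
      assume eq: "restrict (vertex_coeff f p) ?R = restrict (vertex_coeff f q) ?R"
      show "\<forall>\<rho>\<in>?R. vertex_coeff f p \<rho> = vertex_coeff f q \<rho>"
        using fun_cong[OF eq] by (metis restrict_apply')
    qed (rule restrict_ext, blast)
    finally show ?thesis .
  qed
  have "finite (degenerate_walks k N f c) \<and> card (degenerate_walks k N f c) \<le> card ({..<2 * k} \<times> {..<2 * k}) * (3 * N) ^ k"
  proof (rule card_covered_le[where T = T])
    show "degenerate_walks k N f c \<subseteq> (\<Union>pq\<in>{..<2 * k} \<times> {..<2 * k}. T pq)"
    proof
      fix i assume "i \<in> degenerate_walks k N f c"
      then obtain p q where "p < 2 * k" "q < 2 * k" "i \<in> T (p, q)"
        unfolding degenerate_walks_def T_def by auto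
      thus "i \<in> (\<Union>pq\<in>{..<2 * k} \<times> {..<2 * k}. T pq)" by blast
    qed
  next
    fix pq assume "pq \<in> {..<2 * k} \<times> {..<2 * k}"
    then obtain p q where pq: "pq = (p, q)" "p < 2 * k" "q < 2 * k" by auto
    have diff: "int (i p) - int (i q) = (\<Sum>\<rho>\<in>?R. (vertex_coeff f p \<rho> - vertex_coeff f q \<rho>) * incr (2 * k) solo i \<rho>)
        + (vertex_const c p - vertex_const c q) * (int N - 1)" if "i \<in> matched_walks k N f c" for i
      using matched_walk_vertex[OF f that pq(2)] matched_walk_vertex[OF f that pq(3)]
      by (simp add: left_diff_distrib sum_subtractf)
    show "finite (T pq) \<and> card (T pq) \<le> (3 * N) ^ k"
    proof (cases "\<exists>\<rho>\<in>?R. vertex_coeff f p \<rho> \<noteq> vertex_coeff f q \<rho>")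
      case False
      have "i \<notin> T pq" for i
      proof
        assume i: "i \<in> T pq"
        hence iT: "i \<in> matched_walks k N f c" by (simp add: T_def)
        have "(\<Sum>\<rho>\<in>?R. (vertex_coeff f p \<rho> - vertex_coeff f q \<rho>) * incr (2 * k) solo i \<rho>) = 0"
          by (rule sum.neutral) (use False in auto)
        hence "int (i p) - int (i q) = (vertex_const c p - vertex_const c q) * (int N - 1)"
          using diff[OF iT] by simp
        hence "i p = i q \<longleftrightarrow> vertex_const c p = vertex_const c q" using N by auto
        thus False using i geq[OF pq(2,3)] False pq(1) unfolding T_def by auto
      qed
      hence "T pq = {}" by blast
      thus ?thesis by simp
    next
      case True
      then obtain \<rho>0 where \<rho>0: "\<rho>0 \<in> ?R" "vertex_coeff f p \<rho>0 \<noteq> vertex_coeff f q \<rho>0" by blast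
      have "finite (T pq) \<and> card (T pq) \<le> (3 * N) ^ (1 + card (?R - {\<rho>0}))"
      proof (rule card_determined_walks[where vt = solo and w = 1 and m = "2 * k" and h = "orient f" and c = "\<lambda>v. c v * (int N - 1)"])
        show "0 < 2 * k" "1 \<le> N" "f ` ?V \<subseteq> ?V" using k N pairings_in[OF f] by auto
        fix i u assume "i \<in> T pq" thus "solo i u \<in> closed_walks (2 * k) N"
          unfolding T_def matched_walks_def solo_def by auto
      next
        fix i i' assume "\<And>u. u < 1 \<Longrightarrow> solo i u = solo i' u"
        from this[of 0] show "i = i'" by (simp add: solo_def)
      next
        fix i v assume "i \<in> T pq" "v \<in> ?V"
        thus "incr (2 * k) solo i v = orient f v * incr (2 * k) solo i (f v) + c v * (int N - 1)"
          unfolding T_def matched_walks_def by blast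
      next
        fix i i' r assume i: "i \<in> T pq" "i' \<in> T pq" and r: "r \<in> {\<rho>0}"
          and eq: "\<And>r. r \<in> ?R - {\<rho>0} \<Longrightarrow> incr (2 * k) solo i r = incr (2 * k) solo i' r"
        have neq: "generic_vertex k f c p \<noteq> generic_vertex k f c q" using geq[OF pq(2,3)] \<rho>0 by blast
        hence "i p = i q" "i' p = i' q" using i pq(1) unfolding T_def by auto
        hence "(\<Sum>\<rho>\<in>?R. (vertex_coeff f p \<rho> - vertex_coeff f q \<rho>) * incr (2 * k) solo i \<rho>)
            = (\<Sum>\<rho>\<in>?R. (vertex_coeff f p \<rho> - vertex_coeff f q \<rho>) * incr (2 * k) solo i' \<rho>)"
          using diff[of i] diff[of i'] i unfolding T_def by simp
        moreover have "(\<Sum>\<rho>\<in>?R - {\<rho>0}. (vertex_coeff f p \<rho> - vertex_coeff f q \<rho>) * incr (2 * k) solo i \<rho>)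
            = (\<Sum>\<rho>\<in>?R - {\<rho>0}. (vertex_coeff f p \<rho> - vertex_coeff f q \<rho>) * incr (2 * k) solo i' \<rho>)"
          using eq by (intro sum.cong) auto
        ultimately have "(vertex_coeff f p \<rho>0 - vertex_coeff f q \<rho>0) * incr (2 * k) solo i \<rho>0
            = (vertex_coeff f p \<rho>0 - vertex_coeff f q \<rho>0) * incr (2 * k) solo i' \<rho>0"
          using \<rho>0(1) by (simp add: sum.remove)
        thus "incr (2 * k) solo i r = incr (2 * k) solo i' r" using r \<rho>0(2) by simp
      qed
      moreover have "1 + card (?R - {\<rho>0}) = k" using \<rho>0(1) pairings_card_image[OF f] k by (simp add: card_Diff_singleton)
      ultimately show ?thesis by simp
    qed
  qed auto
  thus ?thesis by simp
qed

section \<open>Weights of pairings\<close>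

text \<open>With \<open>F\<close> a sequence of moments this is the expectation of a product of
  independent variables, one for each value of \<open>g\<close>, each raised to its
  multiplicity.\<close>

definition class_prod :: "(nat \<Rightarrow> real) \<Rightarrow> ('v \<Rightarrow> 'l) \<Rightarrow> 'v set \<Rightarrow> real" where
  "class_prod F g W = (\<Prod>l\<in>g ` W. F (card {v \<in> W. g v = l}))"

lemma class_prod_canon: "class_prod F (canon W g) W = class_prod F g W"
proof -
  have eq: "g (canon W g v) = g v" if "v \<in> W" for v using canon_in[OF that, of g] by (rule conjunct2)
  have img: "g ` W = g ` canon W g ` W" unfolding image_image
    by (rule image_cong[OF refl]) (rule eq[symmetric])
  have inj: "inj_on g (canon W g ` W)"
  proof (rule inj_onI, elim imageE)
    fix r r' v v' assume "g r = g r'" and r: "r = canon W g v" "r' = canon W g v'" and v: "v \<in> W" "v' \<in> W"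
    hence "g v = g v'" using eq[OF v(1)] eq[OF v(2)] by simp
    thus "r = r'" unfolding r by (simp only: canon_eq_iff[OF v, of g])
  qed
  have "class_prod F g W = (\<Prod>r\<in>canon W g ` W. F (card {v \<in> W. g v = g r}))"
    unfolding class_prod_def img by (subst prod.reindex[OF inj]) (simp only: o_def)
  also have "\<dots> = (\<Prod>r\<in>canon W g ` W. F (card {v \<in> W. canon W g v = r}))"
  proof (rule prod.cong[OF refl], elim imageE)
    fix r v0 assume r: "r = canon W g v0" "v0 \<in> W"
    have "{v \<in> W. g v = g r} = {v \<in> W. canon W g v = r}"
      unfolding r(1) eq[OF r(2)] using canon_eq_iff[OF _ r(2), of _ g] by blast
    thus "F (card {v \<in> W. g v = g r}) = F (card {v \<in> W. canon W g v = r})" by (simp only:)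
  qed
  finally show ?thesis unfolding class_prod_def ..
qed

lemma class_prod_cong:
  assumes "\<And>v v'. v \<in> W \<Longrightarrow> v' \<in> W \<Longrightarrow> g v = g v' \<longleftrightarrow> g' v = g' v'"
  shows "class_prod F g W = class_prod F g' W"
proof -
  have "canon W g = canon W g'" by (rule canon_cong) (rule assms)
  thus ?thesis using class_prod_canon[of F W g] class_prod_canon[of F W g'] by simp
qed

lemma class_prod_Un:
  assumes fin: "finite W1" "finite W2" and disj: "W1 \<inter> W2 = {}" "g ` W1 \<inter> g ` W2 = {}"
  shows "class_prod F g (W1 \<union> W2) = class_prod F g W1 * class_prod F g W2"
proof -
  have "class_prod F g (W1 \<union> W2) = (\<Prod>l\<in>g ` W1. F (card {v \<in> W1 \<union> W2. g v = l})) * (\<Prod>l\<in>g ` W2. F (card {v \<in> W1 \<union> W2. g v = l}))"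
    unfolding class_prod_def image_Un using fin disj(2) by (intro prod.union_disjoint) auto
  also have "(\<Prod>l\<in>g ` W1. F (card {v \<in> W1 \<union> W2. g v = l})) = class_prod F g W1"
    unfolding class_prod_def
  proof (rule prod.cong[OF refl])
    fix l assume "l \<in> g ` W1"
    hence "l \<notin> g ` W2" using disj(2) by blast
    hence "{v \<in> W1 \<union> W2. g v = l} = {v \<in> W1. g v = l}" by blast
    thus "F (card {v \<in> W1 \<union> W2. g v = l}) = F (card {v \<in> W1. g v = l})" by (simp only:)
  qed
  also have "(\<Prod>l\<in>g ` W2. F (card {v \<in> W1 \<union> W2. g v = l})) = class_prod F g W2"
    unfolding class_prod_def
  proof (rule prod.cong[OF refl])
    fix l assume "l \<in> g ` W2"
    hence "l \<notin> g ` W1" using disj(2) by blast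
    hence "{v \<in> W1 \<union> W2. g v = l} = {v \<in> W2. g v = l}" by blast
    thus "F (card {v \<in> W1 \<union> W2. g v = l}) = F (card {v \<in> W2. g v = l})" by (simp only:)
  qed
  finally show ?thesis .
qed

definition sign_moment :: "real \<Rightarrow> nat \<Rightarrow> real" where
  "sign_moment q n = (if odd n then q else 1)"

lemma class_prod_sign_bounds:
  assumes q: "0 \<le> q" "q \<le> 1" and W: "finite W"
  shows "q ^ card W \<le> class_prod (sign_moment q) g W" "class_prod (sign_moment q) g W \<le> 1"
proof -
  have "q ^ card W \<le> q ^ card (g ` W)" using q card_image_le[OF W, of g] by (intro power_decreasing) auto
  also have "\<dots> = (\<Prod>l\<in>g ` W. q)" by simp
  also have "\<dots> \<le> class_prod (sign_moment q) g W"
    unfolding class_prod_def sign_moment_def using q by (intro prod_mono) auto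
  finally show "q ^ card W \<le> class_prod (sign_moment q) g W" .
  show "class_prod (sign_moment q) g W \<le> 1"
    unfolding class_prod_def sign_moment_def using q by (intro prod_le_1) auto
qed

definition walk_edge :: "nat \<Rightarrow> ('x \<Rightarrow> nat \<Rightarrow> nat \<Rightarrow> nat) \<Rightarrow> 'x \<Rightarrow> nat \<times> nat \<Rightarrow> nat \<times> nat" where
  "walk_edge m vt x v = edge (src vt x v) (tgt m vt x v)"

definition generic_edge :: "nat \<Rightarrow> (nat \<times> nat \<Rightarrow> nat \<times> nat) \<Rightarrow> (nat \<times> nat \<Rightarrow> int) \<Rightarrow> nat \<times> nat \<Rightarrow> nat \<times> nat" where
  "generic_edge k f c v = edge (generic_vertex k f c (snd v)) (generic_vertex k f c (Suc (snd v) mod (2 * k)))"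

definition pairing_weight :: "real \<Rightarrow> nat \<Rightarrow> (nat \<times> nat \<Rightarrow> nat \<times> nat) \<Rightarrow> (nat \<times> nat \<Rightarrow> int) \<Rightarrow> real" where
  "pairing_weight q k f c = class_prod (sign_moment q) (generic_edge k f c) (edges 1 (2 * k))"

text \<open>Off the degenerate walks the vertices coincide exactly as the generic ones do, so the
  edges are partitioned alike, and the product over classes depends only on the partition.\<close>

lemma pairing_weight_eq:
  assumes k: "k > 0" and i: "i \<in> matched_walks k N f c" "i \<notin> degenerate_walks k N f c"
  shows "class_prod (sign_moment q) (walk_edge (2 * k) solo i) (edges 1 (2 * k)) = pairing_weight q k f c"
  unfolding pairing_weight_def
proof (rule class_prod_cong)
  have eq: "i p = i p' \<longleftrightarrow> generic_vertex k f c p = generic_vertex k f c p'" if "p < 2 * k" "p' < 2 * k" for p p'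
    using i that unfolding degenerate_walks_def by blast
  fix v v' assume "v \<in> edges 1 (2 * k)" "v' \<in> edges 1 (2 * k)"
  hence "snd v < 2 * k" "snd v' < 2 * k" by (auto simp: edges_1)
  moreover have "Suc (snd v) mod (2 * k) < 2 * k" "Suc (snd v') mod (2 * k) < 2 * k" using k by simp_all
  ultimately show "walk_edge (2 * k) solo i v = walk_edge (2 * k) solo i v' \<longleftrightarrow> generic_edge k f c v = generic_edge k f c v'"
    unfolding walk_edge_def generic_edge_def edge_eq_iff src_solo tgt_solo by (simp only: eq)
qed

lemma card_matched_walks_le:
  assumes f: "f \<in> pairings k" and k: "k > 0" and N: "N \<ge> 1"
  shows "card (matched_walks k N f c) \<le> (3 * N) ^ (k + 1)"
proof -
  have "finite (matched_walks k N f c) \<and> card (matched_walks k N f c) \<le> (3 * N) ^ (1 + card (f ` edges 1 (2 * k) - {}))"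
  proof (rule card_determined_walks[where vt = solo and w = 1 and m = "2 * k" and h = "orient f" and c = "\<lambda>v. c v * (int N - 1)"])
    show "0 < 2 * k" "1 \<le> N" "f ` edges 1 (2 * k) \<subseteq> edges 1 (2 * k)" using k N pairings_in[OF f] by auto
    fix i u assume "i \<in> matched_walks k N f c" thus "solo i u \<in> closed_walks (2 * k) N"
      unfolding matched_walks_def solo_def by simp
  next
    fix i i' assume "\<And>u. u < 1 \<Longrightarrow> solo i u = solo i' u"
    from this[of 0] show "i = i'" by (simp add: solo_def)
  next
    fix i v assume "i \<in> matched_walks k N f c" "v \<in> edges 1 (2 * k)"
    thus "incr (2 * k) solo i v = orient f v * incr (2 * k) solo i (f v) + c v * (int N - 1)"
      unfolding matched_walks_def by blast
  next
    fix i i' r assume "r \<in> ({} :: (nat \<times> nat) set)"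
    thus "incr (2 * k) solo i r = incr (2 * k) solo i' r" by simp
  qed
  moreover have "1 + card (f ` edges 1 (2 * k) - {}) = k + 1" using pairings_card_image[OF f] by simp
  ultimately show ?thesis by (simp only:)
qed

lemma finite_pairings: "finite (pairings k)"
  unfolding pairings_def
  by (rule finite_subset[of _ "edges 1 (2 * k) \<rightarrow>\<^sub>E edges 1 (2 * k)"]) (auto intro: finite_PiE)

text \<open>A pairing is determined by its set of representatives, one of at most
  \<open>2 ^ (2 * k)\<close> subsets, and the map from the \<open>k\<close> remaining edges to the
  \<open>k\<close> representatives.\<close>

lemma card_pairings_le: "card (pairings k) \<le> 4 ^ k * k ^ k"
proof -
  let ?V = "edges 1 (2 * k)"
  define \<R> where "\<R> = {R. R \<subseteq> ?V \<and> card R = k}"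
  have finR: "finite R" if "R \<in> \<R>" for R using that finite_subset[of R ?V] by (auto simp: \<R>_def)
  have fin\<R>: "finite \<R>" unfolding \<R>_def by (rule finite_subset[of _ "Pow ?V"]) auto
  define \<Phi> where "\<Phi> f = (f ` ?V, restrict f (?V - f ` ?V))" for f :: "nat \<times> nat \<Rightarrow> nat \<times> nat"
  have "card (pairings k) \<le> card (SIGMA R:\<R>. (?V - R) \<rightarrow>\<^sub>E R)"
  proof (rule card_inj_on_le[of \<Phi>])
    show "inj_on \<Phi> (pairings k)"
    proof (rule inj_onI)
      fix f g assume f: "f \<in> pairings k" and g: "g \<in> pairings k" and eq: "\<Phi> f = \<Phi> g"
      have R: "f ` ?V = g ` ?V" and r: "restrict f (?V - f ` ?V) = restrict g (?V - f ` ?V)"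
        using eq unfolding \<Phi>_def by auto
      show "f = g"
      proof (rule PiE_ext[of f ?V "\<lambda>_. ?V" g])
        show "f \<in> ?V \<rightarrow>\<^sub>E ?V" "g \<in> ?V \<rightarrow>\<^sub>E ?V" using f g by (simp_all add: pairings_def)
        fix v assume v: "v \<in> ?V"
        show "f v = g v"
        proof (cases "v \<in> f ` ?V")
          case True
          then obtain v1 v2 where "v1 \<in> ?V" "v = f v1" "v2 \<in> ?V" "v = g v2" using R by blast
          thus ?thesis using pairings_idem[OF f, of v1] pairings_idem[OF g, of v2] by simp
        next
          case False
          thus ?thesis using fun_cong[OF r, of v] v by simp
        qed
      qed
    qed
    show "\<Phi> ` pairings k \<subseteq> (SIGMA R:\<R>. (?V - R) \<rightarrow>\<^sub>E R)"
    proof (rule image_subsetI)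
      fix f assume f: "f \<in> pairings k"
      have "f ` ?V \<in> \<R>" unfolding \<R>_def using pairings_in[OF f] pairings_card_image[OF f] by auto
      moreover have "restrict f (?V - f ` ?V) \<in> (?V - f ` ?V) \<rightarrow>\<^sub>E f ` ?V"
        unfolding restrict_PiE_iff by blast
      ultimately show "\<Phi> f \<in> (SIGMA R:\<R>. (?V - R) \<rightarrow>\<^sub>E R)" unfolding \<Phi>_def by blast
    qed
    show "finite (SIGMA R:\<R>. (?V - R) \<rightarrow>\<^sub>E R)"
      by (intro finite_SigmaI fin\<R> finite_PiE) (auto intro: finR)
  qed
  also have "\<dots> = (\<Sum>R\<in>\<R>. card ((?V - R) \<rightarrow>\<^sub>E R))"
    by (intro card_SigmaI fin\<R> ballI finite_PiE) (auto intro: finR)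
  also have "\<dots> = (\<Sum>R\<in>\<R>. k ^ k)"
  proof (rule sum.cong[OF refl])
    fix R assume R: "R \<in> \<R>"
    hence "card (?V - R) = k" "card R = k" using finR[OF R] by (simp_all add: \<R>_def card_Diff_subset card_edges)
    thus "card ((?V - R) \<rightarrow>\<^sub>E R) = k ^ k" by (simp add: card_PiE)
  qed
  also have "\<dots> = card \<R> * k ^ k" by simp
  also have "card \<R> \<le> card (Pow ?V)" unfolding \<R>_def by (intro card_mono) auto
  hence "card \<R> * k ^ k \<le> 4 ^ k * k ^ k" by (simp add: card_Pow card_edges power_mult)
  finally show ?thesis .
qed

section \<open>Pair configurations and exceptional walks\<close>

context link
begin

definition pair_configs :: "nat \<Rightarrow> ((nat \<times> nat \<Rightarrow> nat \<times> nat) \<times> (nat \<times> nat \<Rightarrow> int)) set" where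
  "pair_configs k = {(f, c). f \<in> pairings k \<and> c \<in> edges 1 (2 * k) \<rightarrow>\<^sub>E Cs \<and> (\<forall>v\<in>edges 1 (2 * k). f v = v \<longrightarrow> c v = 0)}"

lemma pair_configs_subset: "pair_configs k \<subseteq> pairings k \<times> (edges 1 (2 * k) \<rightarrow>\<^sub>E {-1, 0, 1})"
proof
  fix \<gamma> assume "\<gamma> \<in> pair_configs k"
  then obtain f c where "\<gamma> = (f, c)" "f \<in> pairings k" "c \<in> edges 1 (2 * k) \<rightarrow>\<^sub>E Cs" unfolding pair_configs_def by blast
  moreover from this(3) have "c \<in> edges 1 (2 * k) \<rightarrow>\<^sub>E {-1, 0, 1}" using Cs PiE_mono[of "edges 1 (2 * k)" "\<lambda>_. Cs" "\<lambda>_. {-1, 0, 1}"] by blast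
  ultimately show "\<gamma> \<in> pairings k \<times> (edges 1 (2 * k) \<rightarrow>\<^sub>E {-1, 0, 1})" by blast
qed

lemma finite_pair_configs: "finite (pair_configs k)"
  by (rule finite_subset[OF pair_configs_subset]) (intro finite_cartesian_product finite_pairings finite_PiE, auto)

text \<open>36 is 4 * 9: the bound for the pairings times three possible constants on each of the
  \<open>2 * k\<close> edges.\<close>

lemma card_pair_configs_le: "card (pair_configs k) \<le> 36 ^ k * k ^ k"
proof -
  have "card (pair_configs k) \<le> card (pairings k \<times> (edges 1 (2 * k) \<rightarrow>\<^sub>E {-1, 0, 1 :: int}))"
    by (rule card_mono[OF _ pair_configs_subset]) (intro finite_cartesian_product finite_pairings finite_PiE, auto)
  also have "\<dots> = card (pairings k) * 9 ^ k"
  proof -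
    have "card {-1, 0, 1 :: int} = 3" by simp
    hence "card (edges 1 (2 * k) \<rightarrow>\<^sub>E {-1, 0, 1 :: int}) = 3 ^ (2 * k)"
      by (simp only: card_PiE finite_edges prod_constant card_edges mult_1)
    also have "\<dots> = (9 :: nat) ^ k" by (simp add: power_mult)
    finally show ?thesis by (simp only: card_cartesian_product)
  qed
  also have "\<dots> \<le> (4 ^ k * k ^ k) * 9 ^ k" using card_pairings_le by (rule mult_right_mono) simp
  also have "\<dots> = (4 * 9) ^ k * k ^ k" by (simp only: power_mult_distrib mult_ac)
  finally show ?thesis by simp
qed

definition paired :: "nat \<Rightarrow> nat \<Rightarrow> (nat \<Rightarrow> nat) \<Rightarrow> bool" where
  "paired k N i \<longleftrightarrow> (\<forall>v\<in>edges 1 (2 * k). card {v' \<in> edges 1 (2 * k). lab N (2 * k) solo i v' = lab N (2 * k) solo i v} = 2)"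

definition antipaired :: "nat \<Rightarrow> nat \<Rightarrow> (nat \<Rightarrow> nat) \<Rightarrow> bool" where
  "antipaired k N i \<longleftrightarrow> (\<forall>v\<in>edges 1 (2 * k). canon (edges 1 (2 * k)) (lab N (2 * k) solo i) v \<noteq> v \<longrightarrow>
     (\<exists>c\<in>Cs. incr (2 * k) solo i v = - incr (2 * k) solo i (canon (edges 1 (2 * k)) (lab N (2 * k) solo i) v) + c * (int N - 1)))"

lemma paired_canon_pairing:
  assumes "paired k N i"
  shows "canon (edges 1 (2 * k)) (lab N (2 * k) solo i) \<in> pairings k"
proof -
  let ?V = "edges 1 (2 * k)" and ?l = "lab N (2 * k) solo i"
  have "card {v' \<in> ?V. canon ?V ?l v' = canon ?V ?l v} = 2" if v: "v \<in> ?V" for v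
  proof -
    have "{v' \<in> ?V. canon ?V ?l v' = canon ?V ?l v} = {v' \<in> ?V. ?l v' = ?l v}"
      using canon_eq_iff[OF _ v, of _ ?l] by blast
    thus ?thesis using assms v unfolding paired_def by simp
  qed
  thus ?thesis unfolding pairings_def using canon_PiE[of ?V ?l] canon_canon[of ?V ?l] by blast
qed

text \<open>
  Two paired edges with the same orientation make the closing condition a nontrivial relation
  between the increments, which saves a factor \<open>N\<close>.
\<close>

lemma card_misoriented_walks:
  assumes k: "k > 0" and N: "N \<ge> 1"
  shows "card {i \<in> closed_walks (2 * k) N. paired k N i \<and> \<not> antipaired k N i} \<le> card (configs (edges 1 (2 * k))) * (3 * N) ^ k"
proof -
  let ?V = "edges 1 (2 * k)" and ?X = "closed_walks (2 * k) N"
  let ?S = "{i \<in> ?X. paired k N i \<and> \<not> antipaired k N i}"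
  have m: "0 < 2 * k" using k by simp
  have "finite ?S \<and> card ?S \<le> card (configs ?V) * (3 * N) ^ (1 + (k - 1))"
  proof (rule card_obeying_le[where vt = solo and X = ?X and w = 1, OF m N])
    show "solo i u \<in> ?X" if "i \<in> ?X" for i u using that by (simp add: solo_def)
    show "i = i'" if "\<And>u. u < 1 \<Longrightarrow> solo i u = solo i' u" for i i'
      using that[of 0] by (simp add: solo_def)
    show "?S \<subseteq> ?X" by blast
    fix f h c assume cfg: "(f, h, c) \<in> configs ?V" and "\<exists>x\<in>?S. obeying 1 N (2 * k) solo (f, h, c) x"
    then obtain i where i: "paired k N i" "\<not> antipaired k N i" "obeying 1 N (2 * k) solo (f, h, c) i" by blast
    have f: "canon ?V (lab N (2 * k) solo i) = f" using i(3) unfolding obeying_def by simp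
    have fp: "f \<in> pairings k" using paired_canon_pairing[OF i(1)] unfolding f .
    obtain v0 where v0: "v0 \<in> ?V" "f v0 \<noteq> v0"
      "\<And>c. c \<in> Cs \<Longrightarrow> incr (2 * k) solo i v0 \<noteq> - incr (2 * k) solo i (f v0) + c * (int N - 1)"
      using i(2) unfolding antipaired_def f by blast
    have iv0: "incr (2 * k) solo i v0 = h v0 * incr (2 * k) solo i (f v0) + c v0 * (int N - 1)" "c v0 \<in> Cs"
      using i(3) v0(1) unfolding obeying_def by simp_all
    have "h v0 \<in> {-1, 1}" using cfg v0(1) unfolding configs_def by (auto dest: PiE_mem)
    moreover have "h v0 \<noteq> -1" using v0(3)[OF iv0(2)] iv0(1) by auto
    ultimately have h: "h v0 = 1" by blast
    let ?P = "f v0"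
    have PR: "?P \<in> f ` ?V" "?P \<in> ?V" using v0(1) pairings_in[OF fp] by blast+
    have "card (f ` ?V - {?P}) \<le> k - 1"
      using PR pairings_card_image[OF fp] by (simp add: card_Diff_singleton)
    moreover have "incr (2 * k) solo x ?P = incr (2 * k) solo x' ?P"
      if x: "obeying 1 N (2 * k) solo (f, h, c) x" "obeying 1 N (2 * k) solo (f, h, c) x'"
        and eq: "\<forall>r\<in>f ` ?V - {?P}. incr (2 * k) solo x r = incr (2 * k) solo x' r" for x x'
    proof -
      define \<delta> where "\<delta> v = incr (2 * k) solo x v - incr (2 * k) solo x' v" for v
      have \<delta>: "\<delta> v = h v * \<delta> (f v)" if "v \<in> ?V" for v
        using x that unfolding obeying_def \<delta>_def by (simp add: right_diff_distrib)
      have fib: "{v \<in> ?V. f v = ?P} = {v0, ?P}" by (rule pairings_fiber[OF fp v0(1,2)])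
      have "(\<Sum>v\<in>?V. \<delta> v) = 0"
        unfolding sum_edges_1 \<delta>_def using sum_incr_eq_0[OF m, of solo] by (simp add: sum_subtractf)
      moreover have "(\<Sum>v\<in>?V. \<delta> v) = (\<Sum>v\<in>{v0, ?P}. \<delta> v)"
      proof (rule sum.mono_neutral_right)
        show "finite ?V" "{v0, ?P} \<subseteq> ?V" using v0(1) PR by auto
        show "\<forall>v\<in>?V - {v0, ?P}. \<delta> v = 0"
        proof
          fix v assume v: "v \<in> ?V - {v0, ?P}"
          hence "f v \<in> f ` ?V - {?P}" using fib by blast
          hence "\<delta> (f v) = 0" using eq unfolding \<delta>_def by simp
          thus "\<delta> v = 0" using \<delta>[of v] v by simp
        qed
      qed
      moreover have "\<delta> v0 = \<delta> ?P" using \<delta>[OF v0(1)] h by simp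
      ultimately have "\<delta> ?P = 0" using v0(2) by simp
      thus ?thesis by (simp add: \<delta>_def)
    qed
    ultimately show "\<exists>Z. card (f ` ?V - Z) \<le> k - 1 \<and>
         (\<forall>x\<in>?S. \<forall>x'\<in>?S. obeying 1 N (2 * k) solo (f, h, c) x \<longrightarrow> obeying 1 N (2 * k) solo (f, h, c) x' \<longrightarrow>
           (\<forall>r\<in>f ` ?V - Z. incr (2 * k) solo x r = incr (2 * k) solo x' r) \<longrightarrow> (\<forall>r\<in>Z. incr (2 * k) solo x r = incr (2 * k) solo x' r))"
      by (intro exI[of _ "{?P}"]) blast
  qed
  thus ?thesis using k by simp
qed

text \<open>The exceptional walks, only \<open>O(N ^ k)\<close> many against a normalisation by
  \<open>N ^ (k + 1)\<close>: too few labels, a pair traversed in the same direction, or accidental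
  coincidences of vertices.\<close>

definition bad_walks :: "nat \<Rightarrow> nat \<Rightarrow> (nat \<Rightarrow> nat) set" where
  "bad_walks k N = {i \<in> closed_walks (2 * k) N. card (lab N (2 * k) solo i ` edges 1 (2 * k)) \<le> k - 1}
     \<union> {i \<in> closed_walks (2 * k) N. paired k N i \<and> \<not> antipaired k N i}
     \<union> (\<Union>\<gamma>\<in>pair_configs k. degenerate_walks k N (fst \<gamma>) (snd \<gamma>))"

lemma card_few_labels_solo:
  assumes m: "m > 0" and N: "N \<ge> 1"
  shows "card {i \<in> closed_walks m N. card (lab N m solo i ` edges 1 m) \<le> r} \<le> card (configs (edges 1 m)) * (3 * N) ^ (1 + r)"
proof -
  have "finite {i \<in> closed_walks m N. card (lab N m solo i ` edges 1 m) \<le> r} \<and>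
     card {i \<in> closed_walks m N. card (lab N m solo i ` edges 1 m) \<le> r} \<le> card (configs (edges 1 m)) * (3 * N) ^ (1 + r)"
  proof (rule card_few_labels[where vt = solo and w = 1, OF m N])
    show "solo i u \<in> closed_walks m N" if "i \<in> closed_walks m N" for i u using that by (simp add: solo_def)
    show "i = i'" if "\<And>u. u < 1 \<Longrightarrow> solo i u = solo i' u" for i i'
      using that[of 0] by (simp add: solo_def)
  qed
  thus ?thesis by blast
qed

lemma card_bad_walks:
  assumes k: "k > 0"
  shows "\<exists>C. \<forall>N\<ge>2. card (bad_walks k N) \<le> C * N ^ k"
proof -
  define A where "A = card (configs (edges 1 (2 * k)))"
  define G where "G = card (pair_configs k)"
  have "card (bad_walks k N) \<le> ((A + A + G * (2 * k * (2 * k))) * 3 ^ k) * N ^ k" if N: "N \<ge> 2" for N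
  proof -
    have N1: "N \<ge> 1" using N by simp
    let ?X = "closed_walks (2 * k) N"
    let ?A = "{i \<in> ?X. card (lab N (2 * k) solo i ` edges 1 (2 * k)) \<le> k - 1}"
    let ?B = "{i \<in> ?X. paired k N i \<and> \<not> antipaired k N i}"
    let ?D = "\<Union>\<gamma>\<in>pair_configs k. degenerate_walks k N (fst \<gamma>) (snd \<gamma>)"
    have "card (bad_walks k N) \<le> card (?A \<union> ?B) + card ?D" unfolding bad_walks_def by (rule card_Un_le)
    also have "card (?A \<union> ?B) \<le> card ?A + card ?B" by (rule card_Un_le)
    also have "card ?A \<le> A * (3 * N) ^ k"
      using card_few_labels_solo[of "2 * k" N "k - 1"] k N1 unfolding A_def by simp
    also have "card ?B \<le> A * (3 * N) ^ k" unfolding A_def by (rule card_misoriented_walks[OF k N1])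
    also have "card ?D \<le> (\<Sum>\<gamma>\<in>pair_configs k. card (degenerate_walks k N (fst \<gamma>) (snd \<gamma>)))"
      by (rule card_UN_le[OF finite_pair_configs])
    also have "\<dots> \<le> (\<Sum>\<gamma>\<in>pair_configs k. (2 * k * (2 * k)) * (3 * N) ^ k)"
    proof (rule sum_mono)
      fix \<gamma> assume "\<gamma> \<in> pair_configs k"
      hence "fst \<gamma> \<in> pairings k" unfolding pair_configs_def by auto
      thus "card (degenerate_walks k N (fst \<gamma>) (snd \<gamma>)) \<le> (2 * k * (2 * k)) * (3 * N) ^ k"
        by (rule card_degenerate_walks[OF _ k N])
    qed
    also have "\<dots> = G * ((2 * k * (2 * k)) * (3 * N) ^ k)" by (simp add: G_def)
    finally show ?thesis by (simp add: algebra_simps power_mult_distrib)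
  qed
  thus ?thesis by blast
qed

text \<open>A walk that is not bad lies in exactly one configuration if its labels are paired and in
  none otherwise. This turns the expectation along a walk into a sum over configurations.\<close>

lemma pair_config_sum:
  assumes k: "k > 0" and N: "N \<ge> 2" and i: "i \<in> closed_walks (2 * k) N" "i \<notin> bad_walks k N"
  shows "(\<Sum>\<gamma>\<in>pair_configs k. if i \<in> matched_walks k N (fst \<gamma>) (snd \<gamma>) then pairing_weight q k (fst \<gamma>) (snd \<gamma>) else 0)
       = (if paired k N i then class_prod (sign_moment q) (walk_edge (2 * k) solo i) (edges 1 (2 * k)) else 0)"
proof -
  let ?V = "edges 1 (2 * k)"
  define l where "l = lab N (2 * k) solo i"
  define f0 where "f0 = canon ?V l"
  have m: "0 < 2 * k" using k by simp
  have solo: "\<And>u. u < 1 \<Longrightarrow> solo i u \<in> closed_walks (2 * k) N" using i(1) by (simp add: solo_def)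
  have many: "k \<le> card (l ` ?V)" using i unfolding bad_walks_def l_def by auto
  have wt: "pairing_weight q k f c = class_prod (sign_moment q) (walk_edge (2 * k) solo i) ?V"
    if "(f, c) \<in> pair_configs k" "i \<in> matched_walks k N f c" for f c
  proof (rule pairing_weight_eq[OF k that(2), symmetric])
    show "i \<notin> degenerate_walks k N f c" using i(2) that(1) unfolding bad_walks_def by force
  qed
  \<comment> \<open>The pairing \<open>f\<close> joins only edges of equal label. As there are at
    least \<open>k\<close> labels for its \<open>k\<close> pairs, no label is shared between pairs,
    so the labels induce exactly \<open>f\<close>.\<close>
  have fis: "f = f0 \<and> paired k N i" if g: "(f, c) \<in> pair_configs k" "i \<in> matched_walks k N f c" for f c
  proof -
    have f: "f \<in> pairings k" and c: "c \<in> ?V \<rightarrow>\<^sub>E Cs" using g(1) unfolding pair_configs_def by auto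
    have lf: "l v = l (f v)" if v: "v \<in> ?V" for v
    proof -
      have "incr (2 * k) solo i v = orient f v * incr (2 * k) solo i (f v) + c v * (int N - 1)"
        using g(2) v unfolding matched_walks_def by blast
      moreover have "orient f v \<in> {-1, 1}" by (simp add: orient_def)
      moreover have "c v \<in> Cs" using c v by (rule PiE_mem)
      ultimately have "\<exists>h\<in>{-1, 1}. \<exists>c\<in>Cs. incr (2 * k) solo i v = h * incr (2 * k) solo i (f v) + c * (int N - 1)" by blast
      thus ?thesis unfolding l_def
        using lab_eq_iff[where w = 1 and vt = solo and x = i and m = "2 * k" and N = N, OF m solo v pairings_in[OF f v]] by blast
    qed
    have "l ` ?V = l ` f ` ?V" unfolding image_image by (rule image_cong[OF refl]) (rule lf)
    hence "card (l ` f ` ?V) \<ge> card (f ` ?V)" using many pairings_card_image[OF f] by simp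
    hence "card (l ` f ` ?V) = card (f ` ?V)" using card_image_le[of "f ` ?V" l] by simp
    hence inj: "inj_on l (f ` ?V)" by (intro eq_card_imp_inj_on) auto
    have part: "l v = l v' \<longleftrightarrow> f v = f v'" if "v \<in> ?V" "v' \<in> ?V" for v v'
    proof
      assume "l v = l v'"
      hence "l (f v) = l (f v')" using lf that by simp
      thus "f v = f v'" using inj that by (auto dest: inj_onD)
    next
      assume "f v = f v'"
      thus "l v = l v'" using lf[OF that(1)] lf[OF that(2)] by simp
    qed
    have "f0 = canon ?V f" unfolding f0_def by (rule canon_cong) (rule part)
    also have "\<dots> = f" using f unfolding pairings_def by blast
    finally have "f = f0" ..
    moreover have "paired k N i" unfolding paired_def l_def[symmetric]
    proof
      fix v assume v: "v \<in> ?V"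
      have "{v' \<in> ?V. l v' = l v} = {v' \<in> ?V. f v' = f v}" using part[OF _ v] by blast
      thus "card {v' \<in> ?V. l v' = l v} = 2" using f v unfolding pairings_def by simp
    qed
    ultimately show ?thesis ..
  qed
  show ?thesis
  proof (cases "paired k N i")
    case False
    have "(\<Sum>\<gamma>\<in>pair_configs k. if i \<in> matched_walks k N (fst \<gamma>) (snd \<gamma>) then pairing_weight q k (fst \<gamma>) (snd \<gamma>) else 0) = 0"
    proof (rule sum.neutral, rule ballI)
      fix \<gamma> assume "\<gamma> \<in> pair_configs k"
      hence "i \<notin> matched_walks k N (fst \<gamma>) (snd \<gamma>)" using fis[of "fst \<gamma>" "snd \<gamma>"] False by auto
      thus "(if i \<in> matched_walks k N (fst \<gamma>) (snd \<gamma>) then pairing_weight q k (fst \<gamma>) (snd \<gamma>) else 0) = 0" by simp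
    qed
    thus ?thesis using False by simp
  next
    case True
    have f0: "f0 \<in> pairings k" using paired_canon_pairing[OF True] unfolding f0_def l_def .
    have anti: "antipaired k N i" using i True unfolding bad_walks_def by blast
    have "\<exists>c\<in>Cs. incr (2 * k) solo i v = orient f0 v * incr (2 * k) solo i (f0 v) + c * (int N - 1) \<and> (f0 v = v \<longrightarrow> c = 0)"
      if v: "v \<in> ?V" for v
    proof (cases "f0 v = v")
      case True
      thus ?thesis using zero_in_Cs by (intro bexI[of _ 0]) (auto simp: orient_def)
    next
      case False
      then obtain c where "c \<in> Cs" "incr (2 * k) solo i v = - incr (2 * k) solo i (f0 v) + c * (int N - 1)"
        using anti v unfolding antipaired_def f0_def l_def by blast
      thus ?thesis using False by (intro bexI[of _ c]) (auto simp: orient_def)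
    qed
    then obtain c' where c': "\<And>v. v \<in> ?V \<Longrightarrow> c' v \<in> Cs \<and>
        incr (2 * k) solo i v = orient f0 v * incr (2 * k) solo i (f0 v) + c' v * (int N - 1) \<and> (f0 v = v \<longrightarrow> c' v = 0)" by metis
    define c0 where "c0 = restrict c' ?V"
    have c0: "c0 v = c' v" if "v \<in> ?V" for v using that by (simp add: c0_def)
    have "c0 \<in> ?V \<rightarrow>\<^sub>E Cs" unfolding c0_def restrict_PiE_iff using c' by blast
    hence g0: "(f0, c0) \<in> pair_configs k" unfolding pair_configs_def using f0 c' c0 by auto
    have m0: "i \<in> matched_walks k N f0 c0" unfolding matched_walks_def using i(1) c' c0 by auto
    have uniq: "\<gamma> = (f0, c0)" if \<gamma>: "\<gamma> \<in> pair_configs k" "i \<in> matched_walks k N (fst \<gamma>) (snd \<gamma>)" for \<gamma>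
    proof -
      obtain f c where fc: "\<gamma> = (f, c)" by (cases \<gamma>)
      have ff: "f = f0" using fis[of f c] \<gamma> unfolding fc by simp
      have "c \<in> ?V \<rightarrow>\<^sub>E Cs" using \<gamma>(1) unfolding fc pair_configs_def by simp
      moreover have "c v = c0 v" if v: "v \<in> ?V" for v
      proof -
        have "incr (2 * k) solo i v = orient f0 v * incr (2 * k) solo i (f0 v) + c v * (int N - 1)"
          using \<gamma>(2) v unfolding fc ff matched_walks_def by simp
        moreover have "incr (2 * k) solo i v = orient f0 v * incr (2 * k) solo i (f0 v) + c0 v * (int N - 1)"
          using m0 v unfolding matched_walks_def by simp
        ultimately have "c v * (int N - 1) = c0 v * (int N - 1)" by linarith
        thus ?thesis using N by simp
      qed
      ultimately have "c = c0" using \<open>c0 \<in> ?V \<rightarrow>\<^sub>E Cs\<close> by (intro PiE_ext[of c ?V "\<lambda>_. Cs" c0])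
      thus ?thesis unfolding fc ff by simp
    qed
    have "(\<Sum>\<gamma>\<in>pair_configs k. if i \<in> matched_walks k N (fst \<gamma>) (snd \<gamma>) then pairing_weight q k (fst \<gamma>) (snd \<gamma>) else 0)
        = (\<Sum>\<gamma>\<in>pair_configs k. if \<gamma> = (f0, c0) then pairing_weight q k f0 c0 else 0)"
    proof (rule sum.cong[OF refl])
      fix \<gamma> assume \<gamma>: "\<gamma> \<in> pair_configs k"
      show "(if i \<in> matched_walks k N (fst \<gamma>) (snd \<gamma>) then pairing_weight q k (fst \<gamma>) (snd \<gamma>) else 0)
          = (if \<gamma> = (f0, c0) then pairing_weight q k f0 c0 else 0)"
      proof (cases "\<gamma> = (f0, c0)")
        case True
        thus ?thesis using m0 by simp
      next
        case False
        hence "i \<notin> matched_walks k N (fst \<gamma>) (snd \<gamma>)" using uniq[OF \<gamma>] by blast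
        thus ?thesis using False by simp
      qed
    qed
    also have "\<dots> = pairing_weight q k f0 c0" using g0 finite_pair_configs by simp
    also have "\<dots> = class_prod (sign_moment q) (walk_edge (2 * k) solo i) ?V" by (rule wt[OF g0 m0])
    finally show ?thesis using True by simp
  qed
qed

end

section \<open>Moments of the random matrices\<close>

lemma sum_PiE_insert:
  assumes "finite I" "x \<notin> I" "finite B"
  shows "(\<Sum>g\<in>insert x I \<rightarrow>\<^sub>E B. h g) = (\<Sum>c\<in>B. \<Sum>g\<in>I \<rightarrow>\<^sub>E B. h (g(x := c)))"
proof -
  have "(\<Sum>g\<in>insert x I \<rightarrow>\<^sub>E B. h g) = (\<Sum>(c, g)\<in>B \<times> (I \<rightarrow>\<^sub>E B). h (g(x := c)))"
    unfolding PiE_insert_eq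
    by (subst sum.reindex[OF inj_combinator[OF assms(2)]]) (simp add: o_def case_prod_unfold)
  thus ?thesis by (simp add: sum.cartesian_product)
qed

lemma pow_mat_eq_sum_paths:
  fixes a :: "nat \<Rightarrow> nat \<Rightarrow> 'a :: comm_ring_1" and N :: nat
  defines "A \<equiv> Matrix.mat N N (\<lambda>(i, j). a i j)"
  assumes "r < N" "t < N"
  shows "(A ^\<^sub>m Suc m) $$ (r, t) = (\<Sum>i\<in>{..<Suc m} \<rightarrow>\<^sub>E {..<N}.
     if i 0 = r then (\<Prod>s<m. a (i s) (i (Suc s))) * a (i m) t else 0)"
  using assms(3)
proof (induction m arbitrary: t)
  case 0
  have A: "A \<in> carrier_mat N N" by (simp add: A_def)
  define h where "h i = (if i 0 = r then a (i 0) t else 0)" for i :: "nat \<Rightarrow> nat"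
  have "(\<Sum>i\<in>{..<Suc 0} \<rightarrow>\<^sub>E {..<N}. h i) = (\<Sum>c<N. \<Sum>g\<in>{} \<rightarrow>\<^sub>E {..<N}. h (g(0 := c)))"
    unfolding lessThan_Suc lessThan_0 by (rule sum_PiE_insert) auto
  also have "\<dots> = (\<Sum>c<N. if c = r then a c t else 0)" by (simp add: h_def)
  also have "\<dots> = a r t" using assms(2) by simp
  also have "\<dots> = (A ^\<^sub>m Suc 0) $$ (r, t)" using A assms(2) 0 by (simp add: A_def)
  finally show ?case by (simp add: h_def cong: if_cong)
next
  case (Suc m)
  have A: "A \<in> carrier_mat N N" by (simp add: A_def)
  have Am: "A ^\<^sub>m Suc m \<in> carrier_mat N N" using A by (rule pow_carrier_mat)
  have "(A ^\<^sub>m Suc (Suc m)) $$ (r, t) = (\<Sum>c<N. (A ^\<^sub>m Suc m) $$ (r, c) * A $$ (c, t))"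
    using Am A assms(2) Suc.prems by (simp add: scalar_prod_def lessThan_atLeast0 del: pow_mat.simps(2) add: pow_mat.simps(2)[of A "Suc m"])
  also have "\<dots> = (\<Sum>c<N. \<Sum>i\<in>{..<Suc m} \<rightarrow>\<^sub>E {..<N}.
      if i 0 = r then (\<Prod>s<m. a (i s) (i (Suc s))) * a (i m) c * a c t else 0)"
  proof (rule sum.cong[OF refl])
    fix c assume "c \<in> {..<N}"
    hence c: "c < N" by simp
    show "(A ^\<^sub>m Suc m) $$ (r, c) * A $$ (c, t) = (\<Sum>i\<in>{..<Suc m} \<rightarrow>\<^sub>E {..<N}.
      if i 0 = r then (\<Prod>s<m. a (i s) (i (Suc s))) * a (i m) c * a c t else 0)"
      unfolding Suc.IH[OF c] sum_distrib_right using c Suc.prems by (intro sum.cong) (auto simp: A_def)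
  qed
  also have "\<dots> = (\<Sum>c<N. \<Sum>i\<in>{..<Suc m} \<rightarrow>\<^sub>E {..<N}. (\<lambda>i.
      if i 0 = r then (\<Prod>s<Suc m. a (i s) (i (Suc s))) * a (i (Suc m)) t else 0) (i(Suc m := c)))"
  proof (intro sum.cong refl)
    fix c i
    have "(\<Prod>s<Suc m. a ((i(Suc m := c)) s) ((i(Suc m := c)) (Suc s))) = (\<Prod>s<m. a (i s) (i (Suc s))) * a (i m) c"
      by (simp add: prod.lessThan_Suc)
    thus "(if i 0 = r then (\<Prod>s<m. a (i s) (i (Suc s))) * a (i m) c * a c t else 0) = (\<lambda>i.
      if i 0 = r then (\<Prod>s<Suc m. a (i s) (i (Suc s))) * a (i (Suc m)) t else 0) (i(Suc m := c))" by simp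
  qed
  also have "\<dots> = (\<Sum>i\<in>insert (Suc m) {..<Suc m} \<rightarrow>\<^sub>E {..<N}.
      if i 0 = r then (\<Prod>s<Suc m. a (i s) (i (Suc s))) * a (i (Suc m)) t else 0)"
    by (rule sum_PiE_insert[symmetric]) auto
  also have "insert (Suc m) {..<Suc m} = {..<Suc (Suc m)}" by auto
  finally show ?case .
qed

lemma mat_trace_power_eq_sum_walks:
  fixes a :: "nat \<Rightarrow> nat \<Rightarrow> 'a :: comm_ring_1"
  assumes "m > 0"
  shows "mat_trace (Matrix.mat N N (\<lambda>(i, j). a i j) ^\<^sub>m m) = (\<Sum>i\<in>closed_walks m N. \<Prod>s<m. a (i s) (i (Suc s mod m)))"
proof -
  obtain m' where m: "m = Suc m'" using assms gr0_implies_Suc by blast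
  let ?A = "Matrix.mat N N (\<lambda>(i, j). a i j)"
  have "?A \<in> carrier_mat N N" by simp
  hence "?A ^\<^sub>m m \<in> carrier_mat N N" by (rule pow_carrier_mat)
  hence "mat_trace (?A ^\<^sub>m m) = (\<Sum>r<N. (?A ^\<^sub>m Suc m') $$ (r, r))" unfolding mat_trace_def m by simp
  also have "\<dots> = (\<Sum>r<N. \<Sum>i\<in>closed_walks m N. if i 0 = r then (\<Prod>s<m'. a (i s) (i (Suc s))) * a (i m') r else 0)"
    unfolding closed_walks_def m by (intro sum.cong refl pow_mat_eq_sum_paths) auto
  also have "\<dots> = (\<Sum>i\<in>closed_walks m N. \<Sum>r<N. if i 0 = r then (\<Prod>s<m'. a (i s) (i (Suc s))) * a (i m') r else 0)"
    by (rule sum.swap)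
  also have "\<dots> = (\<Sum>i\<in>closed_walks m N. \<Prod>s<m. a (i s) (i (Suc s mod m)))"
  proof (rule sum.cong[OF refl])
    fix i assume "i \<in> closed_walks m N"
    hence "i 0 < N" using closed_walk_less assms by blast
    hence "(\<Sum>r<N. if i 0 = r then (\<Prod>s<m'. a (i s) (i (Suc s))) * a (i m') r else 0)
        = (\<Prod>s<m'. a (i s) (i (Suc s))) * a (i m') (i 0)" by simp
    also have "\<dots> = (\<Prod>s<m. a (i s) (i (Suc s mod m)))" unfolding m by simp
    finally show "(\<Sum>r<N. if i 0 = r then (\<Prod>s<m'. a (i s) (i (Suc s))) * a (i m') r else 0)
        = (\<Prod>s<m. a (i s) (i (Suc s mod m)))" .
  qed
  finally show ?thesis .
qed

lemma prod_const_classes: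
  fixes h :: "'l \<Rightarrow> 'a :: comm_monoid_mult"
  assumes "finite W"
  shows "(\<Prod>v\<in>W. h (g v)) = (\<Prod>l\<in>g ` W. h l ^ card {v \<in> W. g v = l})"
proof -
  have "(\<Prod>v\<in>W. h (g v)) = (\<Prod>l\<in>g ` W. \<Prod>v\<in>{v \<in> W. g v = l}. h (g v))"
    by (rule prod.image_gen[OF assms])
  also have "\<dots> = (\<Prod>l\<in>g ` W. \<Prod>v\<in>{v \<in> W. g v = l}. h l)" by (intro prod.cong) auto
  finally show ?thesis by simp
qed

section \<open>Limit moments\<close>

context link
begin

definition pairing_density :: "nat \<Rightarrow> (nat \<times> nat \<Rightarrow> nat \<times> nat) \<times> (nat \<times> nat \<Rightarrow> int) \<Rightarrow> real" where
  "pairing_density k \<gamma> = lim (\<lambda>N. real (card (matched_walks k N (fst \<gamma>) (snd \<gamma>))) / real N ^ (k + 1))"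

text \<open>Only the weights depend on \<open>q\<close>. Both the configurations and their densities
  are those of the unsigned ensemble, so moments for different \<open>q\<close> can be compared term
  by term.\<close>

definition limit_moment :: "real \<Rightarrow> nat \<Rightarrow> real" where
  "limit_moment q m = (if odd m then 0 else if m = 0 then 1 else
     \<Sum>\<gamma>\<in>pair_configs (m div 2). pairing_weight q (m div 2) (fst \<gamma>) (snd \<gamma>) * pairing_density (m div 2) \<gamma>)"

lemma pairing_density_LIMSEQ:
  assumes "\<gamma> \<in> pair_configs k" "k > 0"
  shows "(\<lambda>N. real (card (matched_walks k N (fst \<gamma>) (snd \<gamma>))) / real N ^ (k + 1)) \<longlonglongrightarrow> pairing_density k \<gamma>"
proof -
  have f: "fst \<gamma> \<in> pairings k" and c: "\<And>v. v \<in> edges 1 (2 * k) \<Longrightarrow> fst \<gamma> v = v \<Longrightarrow> snd \<gamma> v = 0"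
    using assms(1) unfolding pair_configs_def by auto
  show ?thesis unfolding pairing_density_def using matched_walks_density[OF f assms(2) c] by (simp add: convergent_LIMSEQ_iff)
qed

lemma pairing_density_bounds:
  assumes \<gamma>: "\<gamma> \<in> pair_configs k" and k: "k > 0"
  shows "0 \<le> pairing_density k \<gamma>" "pairing_density k \<gamma> \<le> 3 ^ (k + 1)"
proof -
  have f: "fst \<gamma> \<in> pairings k" using \<gamma> unfolding pair_configs_def by auto
  show "0 \<le> pairing_density k \<gamma>"
    by (rule LIMSEQ_le_const[OF pairing_density_LIMSEQ[OF \<gamma> k]]) auto
  show "pairing_density k \<gamma> \<le> 3 ^ (k + 1)"
  proof (rule LIMSEQ_le_const2[OF pairing_density_LIMSEQ[OF \<gamma> k]], intro exI allI impI)
    fix N :: nat assume N: "N \<ge> 1"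
    have "real (card (matched_walks k N (fst \<gamma>) (snd \<gamma>))) \<le> real ((3 * N) ^ (k + 1))"
      using card_matched_walks_le[OF f k N] by (simp only: of_nat_le_iff)
    also have "\<dots> = 3 ^ (k + 1) * real N ^ (k + 1)" by (simp only: of_nat_power of_nat_mult of_nat_numeral power_mult_distrib)
    finally show "real (card (matched_walks k N (fst \<gamma>) (snd \<gamma>))) / real N ^ (k + 1) \<le> 3 ^ (k + 1)"
      using N by (subst pos_divide_le_eq) auto
  qed
qed

lemma limit_moment_even:
  "k > 0 \<Longrightarrow> limit_moment q (2 * k) = (\<Sum>\<gamma>\<in>pair_configs k. pairing_weight q k (fst \<gamma>) (snd \<gamma>) * pairing_density k \<gamma>)"
  by (simp add: limit_moment_def)

lemma pairing_weight_bounds: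
  assumes "0 \<le> q" "q \<le> 1"
  shows "q ^ (2 * k) \<le> pairing_weight q k f c" "pairing_weight q k f c \<le> 1"
  using class_prod_sign_bounds[where g = "generic_edge k f c" and W = "edges 1 (2 * k)", OF assms finite_edges]
  by (simp_all add: pairing_weight_def card_edges)

lemma pairing_weight_1 [simp]: "pairing_weight 1 k f c = 1"
  using pairing_weight_bounds[of 1 k f c] by simp

lemma limit_moment_compare:
  assumes q: "0 \<le> q" "q \<le> 1"
  shows "q ^ (2 * k) * limit_moment 1 (2 * k) \<le> limit_moment q (2 * k)" "limit_moment q (2 * k) \<le> limit_moment 1 (2 * k)"
proof -
  have "q ^ (2 * k) * limit_moment 1 (2 * k) \<le> limit_moment q (2 * k) \<and> limit_moment q (2 * k) \<le> limit_moment 1 (2 * k)"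
  proof (cases "k = 0")
    case True
    thus ?thesis by (simp add: limit_moment_def)
  next
    case False
    hence k: "k > 0" by simp
    show ?thesis unfolding limit_moment_even[OF k] sum_distrib_left
      using pairing_weight_bounds[OF q, of k] pairing_density_bounds(1)[OF _ k]
      by (intro conjI sum_mono) (simp_all add: mult_right_mono mult_left_le_one_le order.trans[of 0 "q ^ (2 * k)"] q)
  qed
  thus "q ^ (2 * k) * limit_moment 1 (2 * k) \<le> limit_moment q (2 * k)" "limit_moment q (2 * k) \<le> limit_moment 1 (2 * k)" by blast+
qed

lemma limit_moment_growth:
  assumes q: "0 \<le> q" "q \<le> 1"
  shows "(\<lambda>k. t ^ (2 * k) * limit_moment q (2 * k) / fact (2 * k)) \<longlonglongrightarrow> 0"
proof (rule growth_if_bounded)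
  have nn1: "0 \<le> limit_moment 1 (2 * k)" for k
    using pairing_density_bounds(1)[of _ k] by (cases "k = 0") (auto simp: limit_moment_def intro!: sum_nonneg)
  show "0 \<le> limit_moment q (2 * k)" for k
    using limit_moment_compare(1)[OF q, of k] nn1[of k] q by (intro order.trans[OF mult_nonneg_nonneg limit_moment_compare(1)[OF q]]) auto
  fix k :: nat assume "k \<ge> 1"
  hence k: "k > 0" by simp
  have "limit_moment q (2 * k) \<le> limit_moment 1 (2 * k)" by (rule limit_moment_compare(2)[OF q])
  also have "\<dots> \<le> (\<Sum>\<gamma>\<in>pair_configs k. 3 ^ (k + 1))"
    unfolding limit_moment_even[OF k] using pairing_density_bounds(2)[OF _ k] by (intro sum_mono) simp
  also have "\<dots> = real (card (pair_configs k)) * 3 ^ (k + 1)" by simp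
  also have "\<dots> \<le> real (36 ^ k * k ^ k) * 3 ^ (k + 1)"
    using card_pair_configs_le[of k] by (intro mult_right_mono) (simp_all only: of_nat_le_iff, simp)
  \<comment> \<open>108 is 36 * 3, from the number of configurations and from the bound
    \<open>3 ^ (k + 1)\<close> for each density.\<close>
  also have "\<dots> = 3 * 108 ^ k * real k ^ k"
  proof -
    have "(108::real) ^ k = 36 ^ k * 3 ^ k" unfolding power_mult_distrib[symmetric] by simp
    thus ?thesis by (simp add: power_add)
  qed
  finally show "limit_moment q (2 * k) \<le> 3 * 108 ^ k * real k ^ k" .
qed

lemma lnk_commute: "a < N \<Longrightarrow> c < N \<Longrightarrow> lnk N a c = lnk N c a"
  using zero_in_Cs by (subst lnk_eq_iff) (auto intro!: bexI[of _ "-1"] bexI[of _ 0])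

text \<open>Sign classes refine label classes: walks that share no entry share no sign either, so a
  single condition on labels gives independence of both.\<close>

lemma lab_eq_of_walk_edge_eq:
  assumes v: "src vt x v < N" "tgt m vt x v < N" and eq: "walk_edge m vt x v = walk_edge m vt x v'"
  shows "lab N m vt x v = lab N m vt x v'"
proof -
  from eq consider "src vt x v = src vt x v'" "tgt m vt x v = tgt m vt x v'"
    | "src vt x v = tgt m vt x v'" "tgt m vt x v = src vt x v'"
    unfolding walk_edge_def edge_eq_iff by blast
  thus ?thesis
  proof cases
    case 2
    thus ?thesis unfolding lab_def using lnk_commute[OF v] by simp
  qed (simp add: lab_def)
qed

end

text \<open>The fourth moments are summable, so the series of fourth powers has finite expectation
  and converges almost everywhere; its terms then tend to 0.\<close>

lemma AE_tendsto_0_of_fourth_moments: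
  fixes Y :: "nat \<Rightarrow> 'w \<Rightarrow> real"
  assumes int: "\<And>n. integrable M (\<lambda>\<omega>. Y n \<omega> ^ 4)" and meas: "\<And>n. Y n \<in> borel_measurable M"
    and bd: "\<And>n. (\<integral>\<omega>. Y n \<omega> ^ 4 \<partial>M) \<le> C / real (Suc n) ^ 2"
  shows "AE \<omega> in M. (\<lambda>n. Y n \<omega>) \<longlonglongrightarrow> 0"
proof -
  note [measurable] = meas
  have sum: "summable (\<lambda>n. C / real (Suc n) ^ 2)"
    using summable_mult[OF inverse_power_summable[of 2, where 'a = real, THEN summable_Suc_iff[THEN iffD2]], of C]
    by (simp add: divide_inverse power_inverse)
  have nn: "(\<integral>\<^sup>+\<omega>. ennreal (Y n \<omega> ^ 4) \<partial>M) = ennreal (\<integral>\<omega>. Y n \<omega> ^ 4 \<partial>M)" for n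
    by (rule nn_integral_eq_integral[OF int]) auto
  have nnI: "0 \<le> (\<integral>\<omega>. Y n \<omega> ^ 4 \<partial>M)" for n by (rule integral_nonneg_AE) auto
  have "(\<integral>\<^sup>+\<omega>. (\<Sum>n. ennreal (Y n \<omega> ^ 4)) \<partial>M) = (\<Sum>n. ennreal (\<integral>\<omega>. Y n \<omega> ^ 4 \<partial>M))"
    by (subst nn_integral_suminf) (auto simp: nn)
  also have "\<dots> \<le> (\<Sum>n. ennreal (C / real (Suc n) ^ 2))"
    by (intro suminf_le ennreal_leI bd) auto
  also have "\<dots> = ennreal (\<Sum>n. C / real (Suc n) ^ 2)"
    using order.trans[OF nnI bd] sum by (intro suminf_ennreal2) auto
  finally have "(\<integral>\<^sup>+\<omega>. (\<Sum>n. ennreal (Y n \<omega> ^ 4)) \<partial>M) \<noteq> \<infinity>"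
    by (auto simp: top_unique)
  hence "AE \<omega> in M. (\<Sum>n. ennreal (Y n \<omega> ^ 4)) \<noteq> \<infinity>"
    by (rule nn_integral_PInf_AE[rotated]) measurable
  thus ?thesis
  proof eventually_elim
    case (elim \<omega>)
    have "summable (\<lambda>n. Y n \<omega> ^ 4)" by (rule summable_suminf_not_top) (use elim in auto)
    hence "(\<lambda>n. Y n \<omega> ^ 4) \<longlonglongrightarrow> 0" by (rule summable_LIMSEQ_zero)
    hence "(\<lambda>n. root 4 (\<bar>Y n \<omega>\<bar> ^ 4)) \<longlonglongrightarrow> root 4 0" by (intro tendsto_real_root) simp
    hence "(\<lambda>n. \<bar>Y n \<omega>\<bar>) \<longlonglongrightarrow> 0" by (simp add: real_root_power_cancel del: power_abs power_even_abs_numeral)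
    thus ?case by (rule tendsto_rabs_zero_cancel)
  qed
qed

locale ensemble = link lnk Cs + prob_space M
  for lnk Cs and M :: "'w measure" +
  fixes b :: "nat \<Rightarrow> 'w \<Rightarrow> real" and e :: "nat \<Rightarrow> nat \<Rightarrow> 'w \<Rightarrow> real" and mu :: "nat \<Rightarrow> real" and q :: real
  assumes indep: "indep_vars (\<lambda>_. borel) (case_sum b (\<lambda>(i, j). e i j)) (UNIV <+> {(i, j). i \<le> j})"
    and b_integrable: "\<And>s k. integrable M (\<lambda>\<omega>. b s \<omega> ^ k)"
    and b_moment: "\<And>s k. expectation (\<lambda>\<omega>. b s \<omega> ^ k) = mu k"
    and mu1: "mu 1 = 0" and mu2: "mu 2 = 1"
    and e_sign: "\<And>i j \<omega>. i \<le> j \<Longrightarrow> \<omega> \<in> space M \<Longrightarrow> e i j \<omega> \<in> {-1, 1}"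
    and e_mean: "\<And>i j. i \<le> j \<Longrightarrow> expectation (e i j) = q"
    and q: "0 \<le> q" "q \<le> 1"
begin

definition entry :: "nat \<Rightarrow> 'w \<Rightarrow> nat \<Rightarrow> nat \<Rightarrow> real" where
  "entry N \<omega> i j = b (lnk N i j) \<omega> * e (min i j) (max i j) \<omega>"

definition random_mat :: "nat \<Rightarrow> 'w \<Rightarrow> real mat" where
  "random_mat N \<omega> = Matrix.mat N N (\<lambda>(i, j). entry N \<omega> i j)"

definition walk_expectation :: "nat \<Rightarrow> nat \<Rightarrow> ('x \<Rightarrow> nat \<Rightarrow> nat \<Rightarrow> nat) \<Rightarrow> 'x \<Rightarrow> (nat \<times> nat) set \<Rightarrow> real" where
  "walk_expectation N m vt x W = class_prod mu (lab N m vt x) W * class_prod (sign_moment q) (walk_edge m vt x) W"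

lemma b_measurable [measurable]: "b s \<in> borel_measurable M"
  using indep unfolding indep_vars_def2 by (auto dest!: bspec[of _ _ "Inl s"])

lemma e_measurable: "i \<le> j \<Longrightarrow> e i j \<in> borel_measurable M"
  using indep unfolding indep_vars_def2 by (auto dest!: bspec[of _ _ "Inr (i, j)"])

lemma e_power:
  assumes ij: "i \<le> j"
  shows "integrable M (\<lambda>\<omega>. e i j \<omega> ^ k)" "expectation (\<lambda>\<omega>. e i j \<omega> ^ k) = sign_moment q k"
proof -
  have val: "e i j \<omega> ^ k = (if odd k then e i j \<omega> else 1)" if "\<omega> \<in> space M" for \<omega>
    using e_sign[OF ij that] by auto
  note [measurable] = e_measurable[OF ij]
  have int: "integrable M (e i j)"
    by (rule integrable_const_bound[of _ 1]) (use e_sign[OF ij] in \<open>force intro!: AE_I2\<close>, measurable)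
  have "integrable M (\<lambda>\<omega>. if odd k then e i j \<omega> else 1)" using int by (cases "odd k") auto
  thus "integrable M (\<lambda>\<omega>. e i j \<omega> ^ k)"
    using val by (subst Bochner_Integration.integrable_cong[OF refl]) auto
  have "expectation (\<lambda>\<omega>. e i j \<omega> ^ k) = expectation (\<lambda>\<omega>. if odd k then e i j \<omega> else 1)"
    using val by (intro Bochner_Integration.integral_cong) auto
  also have "\<dots> = sign_moment q k" using e_mean[OF ij] prob_space by (cases "odd k") (auto simp: sign_moment_def)
  finally show "expectation (\<lambda>\<omega>. e i j \<omega> ^ k) = sign_moment q k" .
qed

text \<open>Equal entries and equal signs are collected into powers. The resulting factors are
  independent, so the expectation is the product of the moments of the entries over label classes
  and of the signs over edge classes.\<close>

lemma entry_prod: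
  assumes W: "finite W"
  shows "integrable M (\<lambda>\<omega>. \<Prod>v\<in>W. entry N \<omega> (src vt x v) (tgt m vt x v))"
    and "expectation (\<lambda>\<omega>. \<Prod>v\<in>W. entry N \<omega> (src vt x v) (tgt m vt x v)) = walk_expectation N m vt x W"
proof -
  define lb ed where "lb = lab N m vt x" and "ed = walk_edge m vt x"
  define Z where "Z = case_sum b (\<lambda>(i, j). e i j)"
  define mult where "mult y = (case y of Inl l \<Rightarrow> card {v \<in> W. lb v = l} | Inr p \<Rightarrow> card {v \<in> W. ed v = p})" for y
  define T where "T = Inl ` lb ` W \<union> Inr ` ed ` W"
  have ed_le: "fst (ed v) \<le> snd (ed v)" for v by (simp add: ed_def walk_edge_def edge_def)
  have T: "finite T" "T \<subseteq> UNIV <+> {(i, j). i \<le> j}"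
  proof -
    show "finite T" using W by (simp add: T_def)
    show "T \<subseteq> UNIV <+> {(i, j). i \<le> j}"
      unfolding T_def using ed_le by (auto simp: Plus_def case_prod_unfold)
  qed
  have split: "(\<Prod>y\<in>T. h y) = (\<Prod>l\<in>lb ` W. h (Inl l)) * (\<Prod>p\<in>ed ` W. h (Inr p))" for h :: "nat + nat \<times> nat \<Rightarrow> real"
  proof -
    have "(\<Prod>y\<in>T. h y) = (\<Prod>y\<in>Inl ` lb ` W. h y) * (\<Prod>y\<in>Inr ` ed ` W. h y)"
      unfolding T_def using W by (intro prod.union_disjoint) auto
    thus ?thesis by (simp add: prod.reindex inj_on_def)
  qed
  have prod_eq: "(\<Prod>v\<in>W. entry N \<omega> (src vt x v) (tgt m vt x v)) = (\<Prod>y\<in>T. Z y \<omega> ^ mult y)" for \<omega>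
  proof -
    have "(\<Prod>v\<in>W. entry N \<omega> (src vt x v) (tgt m vt x v))
        = (\<Prod>v\<in>W. b (lb v) \<omega>) * (\<Prod>v\<in>W. (\<lambda>p. e (fst p) (snd p) \<omega>) (ed v))"
      unfolding prod.distrib[symmetric]
      by (simp add: entry_def lb_def lab_def ed_def walk_edge_def edge_def)
    also have "\<dots> = (\<Prod>l\<in>lb ` W. b l \<omega> ^ card {v \<in> W. lb v = l}) * (\<Prod>p\<in>ed ` W. e (fst p) (snd p) \<omega> ^ card {v \<in> W. ed v = p})"
      using prod_const_classes[OF W, of "\<lambda>l. b l \<omega>" lb] prod_const_classes[OF W, of "\<lambda>p. e (fst p) (snd p) \<omega>" ed] by simp
    also have "\<dots> = (\<Prod>y\<in>T. Z y \<omega> ^ mult y)"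
      unfolding split by (simp add: Z_def mult_def case_prod_unfold)
    finally show ?thesis .
  qed
  have ind: "indep_vars (\<lambda>_. borel) (\<lambda>y \<omega>. Z y \<omega> ^ mult y) T"
    by (rule indep_vars_compose2[OF indep_vars_subset[OF indep[folded Z_def] T(2)]]) measurable
  have mom: "integrable M (\<lambda>\<omega>. Z y \<omega> ^ mult y) \<and> expectation (\<lambda>\<omega>. Z y \<omega> ^ mult y)
      = (case y of Inl l \<Rightarrow> mu (mult y) | Inr p \<Rightarrow> sign_moment q (mult y))" if "y \<in> T" for y
  proof (cases y)
    case (Inl l)
    thus ?thesis using b_integrable b_moment by (simp add: Z_def)
  next
    case (Inr p)
    hence "fst p \<le> snd p" using that ed_le by (auto simp: T_def)
    thus ?thesis using e_power[of "fst p" "snd p"] Inr by (simp add: Z_def case_prod_unfold)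
  qed
  show "integrable M (\<lambda>\<omega>. \<Prod>v\<in>W. entry N \<omega> (src vt x v) (tgt m vt x v))"
    unfolding prod_eq using mom by (intro indep_vars_integrable[OF T(1) ind]) blast
  have "expectation (\<lambda>\<omega>. \<Prod>y\<in>T. Z y \<omega> ^ mult y) = (\<Prod>y\<in>T. expectation (\<lambda>\<omega>. Z y \<omega> ^ mult y))"
    using mom by (intro indep_vars_lebesgue_integral[OF T(1) ind]) blast
  also have "\<dots> = (\<Prod>y\<in>T. case y of Inl l \<Rightarrow> mu (mult y) | Inr p \<Rightarrow> sign_moment q (mult y))"
    using mom by (intro prod.cong) auto
  also have "\<dots> = walk_expectation N m vt x W"
    unfolding split walk_expectation_def class_prod_def lb_def[symmetric] ed_def[symmetric] by (simp add: mult_def)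
  finally show "expectation (\<lambda>\<omega>. \<Prod>v\<in>W. entry N \<omega> (src vt x v) (tgt m vt x v)) = walk_expectation N m vt x W"
    unfolding prod_eq .
qed

definition mu_bound :: "nat \<Rightarrow> real" where
  "mu_bound n = (1 + (\<Sum>k\<le>n. \<bar>mu k\<bar>)) ^ n"

lemma mu_bound_ge_1: "1 \<le> mu_bound n"
  unfolding mu_bound_def by (intro one_le_power) (simp add: sum_nonneg)

lemma walk_expectation_bound:
  assumes W: "finite W" "card W \<le> n"
  shows "\<bar>walk_expectation N m vt x W\<bar> \<le> mu_bound n"
proof -
  let ?g = "lab N m vt x" and ?C = "1 + (\<Sum>k\<le>n. \<bar>mu k\<bar>)"
  have C1: "1 \<le> ?C" by (simp add: sum_nonneg)
  have "\<bar>class_prod mu ?g W\<bar> = (\<Prod>l\<in>?g ` W. \<bar>mu (card {v \<in> W. ?g v = l})\<bar>)"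
    unfolding class_prod_def by (rule abs_prod)
  also have "\<dots> \<le> (\<Prod>l\<in>?g ` W. ?C)"
  proof (rule prod_mono, intro conjI)
    fix l
    have "card {v \<in> W. ?g v = l} \<le> n" using card_mono[OF W(1), of "{v \<in> W. ?g v = l}"] W(2) by auto
    hence "\<bar>mu (card {v \<in> W. ?g v = l})\<bar> \<le> (\<Sum>k\<le>n. \<bar>mu k\<bar>)" by (intro member_le_sum) auto
    thus "\<bar>mu (card {v \<in> W. ?g v = l})\<bar> \<le> ?C" by simp
  qed simp
  also have "\<dots> = ?C ^ card (?g ` W)" by simp
  also have "\<dots> \<le> ?C ^ n" using card_image_le[OF W(1), of ?g] W(2) C1 by (intro power_increasing) auto
  finally have 1: "\<bar>class_prod mu ?g W\<bar> \<le> mu_bound n" by (simp add: mu_bound_def)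
  have sp: "0 \<le> class_prod (sign_moment q) (walk_edge m vt x) W"
    using q unfolding class_prod_def sign_moment_def by (intro prod_nonneg) auto
  have "\<bar>walk_expectation N m vt x W\<bar> \<le> mu_bound n * 1"
    unfolding walk_expectation_def abs_mult
    using 1 class_prod_sign_bounds(2)[OF q W(1), of "walk_edge m vt x"] sp mu_bound_ge_1[of n] by (intro mult_mono) auto
  thus ?thesis by simp
qed

text \<open>A label occurring once contributes the factor \<open>mu 1\<close>, the mean of an
  entry.\<close>

lemma walk_expectation_0:
  assumes W: "finite W" and v: "v \<in> W" and one: "card {v' \<in> W. lab N m vt x v' = lab N m vt x v} = 1"
  shows "walk_expectation N m vt x W = 0"
proof -
  have "class_prod mu (lab N m vt x) W = 0"
    unfolding class_prod_def
    by (rule prod_zero) (use W v one mu1 in \<open>auto intro!: bexI[of _ v]\<close>)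
  thus ?thesis by (simp add: walk_expectation_def)
qed

definition walk_prod :: "nat \<Rightarrow> nat \<Rightarrow> (nat \<Rightarrow> nat) \<Rightarrow> 'w \<Rightarrow> real" where
  "walk_prod N m i \<omega> = (\<Prod>s<m. entry N \<omega> (i s) (i (Suc s mod m)))"

lemma walk_prod_edges: "(\<Prod>v\<in>U \<times> {..<m}. entry N \<omega> (src vt x v) (tgt m vt x v)) = (\<Prod>u\<in>U. walk_prod N m (vt x u) \<omega>)"
  unfolding walk_prod_def by (simp add: prod.cartesian_product src_def tgt_def case_prod_unfold)

lemma walk_prod_moment:
  "integrable M (walk_prod N m i)" "expectation (walk_prod N m i) = walk_expectation N m solo i (edges 1 m)"
proof -
  have eq: "(\<lambda>\<omega>. \<Prod>v\<in>edges 1 m. entry N \<omega> (src solo i v) (tgt m solo i v)) = walk_prod N m i"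
    unfolding edges_def walk_prod_edges by (auto simp: lessThan_Suc One_nat_def solo_def)
  show "integrable M (walk_prod N m i)" using entry_prod(1)[OF finite_edges[of 1 m], where N = N and m = m and vt = solo and x = i] unfolding eq .
  show "expectation (walk_prod N m i) = walk_expectation N m solo i (edges 1 m)"
    using entry_prod(2)[OF finite_edges[of 1 m], where N = N and m = m and vt = solo and x = i] unfolding eq .
qed

lemma random_mat_carrier: "random_mat N \<omega> \<in> carrier_mat N N"
  by (simp add: random_mat_def)

lemma random_mat_symmetric: "i < N \<Longrightarrow> j < N \<Longrightarrow> random_mat N \<omega> $$ (i, j) = random_mat N \<omega> $$ (j, i)"
  using lnk_commute[of i N j] by (simp add: random_mat_def entry_def min.commute max.commute)

definition spectral_moment :: "nat \<Rightarrow> nat \<Rightarrow> 'w \<Rightarrow> real" where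
  "spectral_moment m N \<omega> = moment (rescaled_spectral_measure (random_mat N \<omega>)) m"

lemma spectral_moment_eq:
  assumes "m > 0" "N > 0"
  shows "spectral_moment m N \<omega> = (\<Sum>i\<in>closed_walks m N. walk_prod N m i \<omega>) / (real N * sqrt (real N) ^ m)"
proof -
  have "spectral_moment m N \<omega> = mat_trace (random_mat N \<omega> ^\<^sub>m m) / (real N * sqrt (real N) ^ m)"
    unfolding spectral_moment_def
    by (rule moment_rescaled_spectral_measure(2)[OF random_mat_carrier assms(2)]) (rule random_mat_symmetric)
  also have "mat_trace (random_mat N \<omega> ^\<^sub>m m) = (\<Sum>i\<in>closed_walks m N. walk_prod N m i \<omega>)"
    unfolding random_mat_def walk_prod_def by (rule mat_trace_power_eq_sum_walks[OF assms(1)])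
  finally show ?thesis .
qed

lemma spectral_moment_integrable:
  assumes "m > 0" "N > 0"
  shows "integrable M (spectral_moment m N)"
proof -
  have "spectral_moment m N = (\<lambda>\<omega>. (\<Sum>i\<in>closed_walks m N. walk_prod N m i \<omega>) / (real N * sqrt (real N) ^ m))"
    using spectral_moment_eq[OF assms] by (rule ext)
  thus ?thesis by (auto intro!: walk_prod_moment)
qed

lemma expectation_spectral_moment:
  assumes "m > 0" "N > 0"
  shows "expectation (spectral_moment m N) = (\<Sum>i\<in>closed_walks m N. walk_expectation N m solo i (edges 1 m)) / (real N * sqrt (real N) ^ m)"
proof -
  have eq: "spectral_moment m N = (\<lambda>\<omega>. (\<Sum>i\<in>closed_walks m N. walk_prod N m i \<omega>) / (real N * sqrt (real N) ^ m))"
    by (rule ext) (rule spectral_moment_eq[OF assms])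
  have "expectation (spectral_moment m N) = expectation (\<lambda>\<omega>. (\<Sum>i\<in>closed_walks m N. walk_prod N m i \<omega>) / (real N * sqrt (real N) ^ m))"
    unfolding eq ..
  also have "\<dots> = (\<Sum>i\<in>closed_walks m N. expectation (walk_prod N m i)) / (real N * sqrt (real N) ^ m)"
    by (simp add: walk_prod_moment(1))
  finally show ?thesis by (simp only: walk_prod_moment(2))
qed

lemma few_labels_of_nonzero:
  assumes nz: "walk_expectation N m solo i (edges 1 m) \<noteq> 0"
  shows "v \<in> edges 1 m \<Longrightarrow> 2 \<le> card {v' \<in> edges 1 m. lab N m solo i v' = lab N m solo i v}"
    and "2 * card (lab N m solo i ` edges 1 m) \<le> m"
proof -
  let ?V = "edges 1 m" and ?l = "lab N m solo i"
  show two: "2 \<le> card {v' \<in> ?V. ?l v' = ?l v}" if v: "v \<in> ?V" for v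
  proof -
    have "card {v' \<in> ?V. ?l v' = ?l v} \<noteq> 1"
    proof
      assume "card {v' \<in> ?V. ?l v' = ?l v} = 1"
      from walk_expectation_0[OF finite_edges v this] nz show False by blast
    qed
    moreover have "card {v' \<in> ?V. ?l v' = ?l v} > 0" unfolding card_gt_0_iff
    proof
      show "{v' \<in> ?V. ?l v' = ?l v} \<noteq> {}" using v by blast
    qed simp
    ultimately show ?thesis by linarith
  qed
  have "m = (\<Sum>r\<in>?l ` ?V. card {v \<in> ?V. ?l v = r})"
    using sum.image_gen[of ?V "\<lambda>_. 1::nat" ?l] by (simp add: card_edges)
  moreover have "(\<Sum>r\<in>?l ` ?V. 2) \<le> (\<Sum>r\<in>?l ` ?V. card {v \<in> ?V. ?l v = r})"
    using two by (intro sum_mono) auto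
  ultimately show "2 * card (?l ` ?V) \<le> m" by simp
qed

text \<open>Every label must occur at least twice, so \<open>2 * k + 1\<close> steps leave at most
  \<open>k\<close> labels and \<open>O(N ^ (k + 1))\<close> walks. The normalisation is larger by a
  factor sqrt N.\<close>

lemma odd_moment_limit:
  assumes "odd m"
  shows "(\<lambda>N. expectation (spectral_moment m N)) \<longlonglongrightarrow> 0"
proof -
  obtain k where m: "m = 2 * k + 1" using assms oddE by blast
  have m0: "m > 0" using m by simp
  define C where "C = mu_bound m * (real (card (configs (edges 1 m))) * 3 ^ (1 + k))"
  have bd: "\<bar>expectation (spectral_moment m N)\<bar> \<le> C / sqrt (real N)" if N: "N \<ge> 1" for N
  proof -
    let ?S = "{i \<in> closed_walks m N. card (lab N m solo i ` edges 1 m) \<le> k}"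
    have N0: "N > 0" and sN: "sqrt (real N) > 0" using N by simp_all
    have den: "real N * sqrt (real N) ^ m = real N ^ (1 + k) * sqrt (real N)"
      using N by (simp add: m power_add power_mult)
    have "\<bar>\<Sum>i\<in>closed_walks m N. walk_expectation N m solo i (edges 1 m)\<bar> = \<bar>\<Sum>i\<in>?S. walk_expectation N m solo i (edges 1 m)\<bar>"
    proof -
      have "(\<Sum>i\<in>?S. walk_expectation N m solo i (edges 1 m)) = (\<Sum>i\<in>closed_walks m N. walk_expectation N m solo i (edges 1 m))"
      proof (rule sum.mono_neutral_left)
        show "\<forall>i\<in>closed_walks m N - ?S. walk_expectation N m solo i (edges 1 m) = 0"
        proof
          fix i assume "i \<in> closed_walks m N - ?S"
          hence "\<not> 2 * card (lab N m solo i ` edges 1 m) \<le> m" using m by auto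
          thus "walk_expectation N m solo i (edges 1 m) = 0" using few_labels_of_nonzero(2) by blast
        qed
      qed auto
      thus ?thesis by simp
    qed
    also have "\<dots> \<le> (\<Sum>i\<in>?S. \<bar>walk_expectation N m solo i (edges 1 m)\<bar>)" by (rule sum_abs)
    also have "\<dots> \<le> (\<Sum>i\<in>?S. mu_bound m)"
      by (intro sum_mono walk_expectation_bound) (simp_all add: card_edges)
    also have "\<dots> = real (card ?S) * mu_bound m" by simp
    also have "\<dots> \<le> real (card (configs (edges 1 m)) * (3 * N) ^ (1 + k)) * mu_bound m"
    proof (rule mult_right_mono)
      show "real (card ?S) \<le> real (card (configs (edges 1 m)) * (3 * N) ^ (1 + k))"
        using card_few_labels_solo[OF m0 N, of k] by (simp only: of_nat_le_iff)
    qed (use mu_bound_ge_1[of m] in linarith)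
    also have "\<dots> = C * real N ^ (1 + k)" by (simp add: C_def power_mult_distrib)
    finally have "\<bar>\<Sum>i\<in>closed_walks m N. walk_expectation N m solo i (edges 1 m)\<bar> \<le> C * real N ^ (1 + k)" .
    note sum_le = this
    have ab: "\<bar>real N ^ (1 + k) * sqrt (real N)\<bar> = real N ^ (1 + k) * sqrt (real N)" by (rule abs_of_nonneg) simp
    have "\<bar>expectation (spectral_moment m N)\<bar> \<le> C * real N ^ (1 + k) / (real N ^ (1 + k) * sqrt (real N))"
      unfolding expectation_spectral_moment[OF m0 N0] den abs_divide ab
      by (rule divide_right_mono[OF sum_le]) simp
    also have "\<dots> = C / sqrt (real N)" using N by simp
    finally show ?thesis .
  qed
  have "(\<lambda>N. C / sqrt (real N)) \<longlonglongrightarrow> 0"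
    by (intro tendsto_divide_0[OF tendsto_const] filterlim_at_top_imp_at_infinity
        filterlim_compose[OF sqrt_at_top filterlim_real_sequentially])
  thus ?thesis
    by (rule Lim_null_comparison[rotated]) (use bd in \<open>auto intro!: eventually_sequentiallyI[of 1]\<close>)
qed

text \<open>Off the bad walks the expectation equals the weighted number of configurations
  containing the walk. Summation gives the weighted densities, and the bad walks change the result
  by \<open>O(1 / N)\<close>.\<close>

lemma even_moment_limit:
  assumes k: "k > 0"
  shows "(\<lambda>N. expectation (spectral_moment (2 * k) N)) \<longlonglongrightarrow> limit_moment q (2 * k)"
proof -
  let ?V = "edges 1 (2 * k)" let ?m = "2 * k"
  define ex where "ex N i = walk_expectation N ?m solo i ?V" for N i
  define h where "h N i = (\<Sum>\<gamma>\<in>pair_configs k. if i \<in> matched_walks k N (fst \<gamma>) (snd \<gamma>) then pairing_weight q k (fst \<gamma>) (snd \<gamma>) else 0)" for N i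
  define D where "D = mu_bound ?m + real (card (pair_configs k))"
  obtain C where C: "\<And>N. N \<ge> 2 \<Longrightarrow> card (bad_walks k N) \<le> C * N ^ k" using card_bad_walks[OF k] by blast
  have bad_sub: "bad_walks k N \<subseteq> closed_walks ?m N" for N
    unfolding bad_walks_def degenerate_walks_def matched_walks_def by blast
  have good: "ex N i = h N i" if N: "N \<ge> 2" and i: "i \<in> closed_walks ?m N" "i \<notin> bad_walks k N" for N i
  proof (cases "paired k N i")
    case True
    have "class_prod mu (lab N ?m solo i) ?V = 1"
      unfolding class_prod_def using True mu2 unfolding paired_def by (intro prod.neutral) auto
    thus ?thesis unfolding ex_def walk_expectation_def h_def pair_config_sum[OF k N i] using True by simp
  next
    case False
    have "ex N i = 0"
    proof (rule ccontr)
      assume "ex N i \<noteq> 0"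
      note two = few_labels_of_nonzero(1)[OF this[unfolded ex_def]]
      let ?l = "lab N ?m solo i"
      have many: "k \<le> card (?l ` ?V)" using i unfolding bad_walks_def by auto
      \<comment> \<open>At least \<open>k\<close> labels, each occurring at least twice among
        \<open>2 * k\<close> edges, must all occur exactly twice.\<close>
      have "card {v' \<in> ?V. ?l v' = ?l v} = 2" if v: "v \<in> ?V" for v
      proof -
        let ?F = "\<lambda>r. card {v' \<in> ?V. ?l v' = r}"
        have "2 * k = (\<Sum>r\<in>?l ` ?V. ?F r)"
          using sum.image_gen[of ?V "\<lambda>_. 1::nat" ?l] by (simp add: card_edges)
        also have "\<dots> = ?F (?l v) + (\<Sum>r\<in>?l ` ?V - {?l v}. ?F r)" using v by (intro sum.remove) auto
        finally have eq: "2 * k = ?F (?l v) + (\<Sum>r\<in>?l ` ?V - {?l v}. ?F r)" .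
        have "(\<Sum>r\<in>?l ` ?V - {?l v}. 2) \<le> (\<Sum>r\<in>?l ` ?V - {?l v}. ?F r)"
          using two by (intro sum_mono) auto
        moreover have "card (?l ` ?V - {?l v}) = card (?l ` ?V) - 1" using v by (simp add: card_Diff_singleton)
        ultimately have "2 * (k - 1) \<le> (\<Sum>r\<in>?l ` ?V - {?l v}. ?F r)" using many by simp
        thus ?thesis using eq two[OF v] k by linarith
      qed
      thus False using False unfolding paired_def by blast
    qed
    thus ?thesis unfolding h_def pair_config_sum[OF k N i] using False by simp
  qed
  have hb: "\<bar>h N i\<bar> \<le> real (card (pair_configs k))" for N i
  proof -
    have "\<bar>h N i\<bar> \<le> (\<Sum>\<gamma>\<in>pair_configs k. \<bar>if i \<in> matched_walks k N (fst \<gamma>) (snd \<gamma>) then pairing_weight q k (fst \<gamma>) (snd \<gamma>) else 0\<bar>)"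
      unfolding h_def by (rule sum_abs)
    also have "\<dots> \<le> (\<Sum>\<gamma>\<in>pair_configs k. 1)"
    proof (rule sum_mono)
      fix \<gamma>
      have "0 \<le> pairing_weight q k (fst \<gamma>) (snd \<gamma>)" "pairing_weight q k (fst \<gamma>) (snd \<gamma>) \<le> 1"
        using pairing_weight_bounds[OF q, of k "fst \<gamma>" "snd \<gamma>"] zero_le_power[OF q(1), of "2 * k"] by linarith+
      thus "\<bar>if i \<in> matched_walks k N (fst \<gamma>) (snd \<gamma>) then pairing_weight q k (fst \<gamma>) (snd \<gamma>) else 0\<bar> \<le> 1" by simp
    qed
    finally show ?thesis by simp
  qed
  have eb: "\<bar>ex N i\<bar> \<le> mu_bound ?m" for N i
    unfolding ex_def by (rule walk_expectation_bound) (simp_all add: card_edges)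
  define w where "w N = (\<Sum>\<gamma>\<in>pair_configs k. pairing_weight q k (fst \<gamma>) (snd \<gamma>) * (real (card (matched_walks k N (fst \<gamma>) (snd \<gamma>))) / real N ^ (k + 1)))" for N
  have sum_h: "(\<Sum>i\<in>closed_walks ?m N. h N i) / real N ^ (k + 1) = w N" for N
  proof -
    have "(\<Sum>i\<in>closed_walks ?m N. h N i) = (\<Sum>\<gamma>\<in>pair_configs k. \<Sum>i\<in>closed_walks ?m N. if i \<in> matched_walks k N (fst \<gamma>) (snd \<gamma>) then pairing_weight q k (fst \<gamma>) (snd \<gamma>) else 0)"
      unfolding h_def by (rule sum.swap)
    also have "\<dots> = (\<Sum>\<gamma>\<in>pair_configs k. pairing_weight q k (fst \<gamma>) (snd \<gamma>) * real (card (matched_walks k N (fst \<gamma>) (snd \<gamma>))))"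
    proof (rule sum.cong[OF refl])
      fix \<gamma>
      have "{i \<in> closed_walks ?m N. i \<in> matched_walks k N (fst \<gamma>) (snd \<gamma>)} = matched_walks k N (fst \<gamma>) (snd \<gamma>)"
        unfolding matched_walks_def by blast
      thus "(\<Sum>i\<in>closed_walks ?m N. if i \<in> matched_walks k N (fst \<gamma>) (snd \<gamma>) then pairing_weight q k (fst \<gamma>) (snd \<gamma>) else 0)
          = pairing_weight q k (fst \<gamma>) (snd \<gamma>) * real (card (matched_walks k N (fst \<gamma>) (snd \<gamma>)))"
        by (simp add: sum.inter_filter[symmetric])
    qed
    finally show ?thesis by (simp add: w_def sum_divide_distrib)
  qed
  have close: "\<bar>expectation (spectral_moment ?m N) - w N\<bar> \<le> D * real C / real N" if N: "N \<ge> 2" for N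
  proof -
    have N0: "N > 0" and rN: "real N > 0" using N by simp_all
    have den: "real N * sqrt (real N) ^ ?m = real N ^ (k + 1)" by (simp add: power_mult power_add)
    have "(\<Sum>i\<in>closed_walks ?m N. ex N i) - (\<Sum>i\<in>closed_walks ?m N. h N i) = (\<Sum>i\<in>bad_walks k N. ex N i - h N i)"
      unfolding sum_subtractf[symmetric]
      by (rule sum.mono_neutral_right) (use bad_sub good[OF N] in auto)
    also have "\<bar>\<dots>\<bar> \<le> (\<Sum>i\<in>bad_walks k N. \<bar>ex N i - h N i\<bar>)" by (rule sum_abs)
    also have "\<dots> \<le> (\<Sum>i\<in>bad_walks k N. D)"
    proof (rule sum_mono)
      fix i show "\<bar>ex N i - h N i\<bar> \<le> D" unfolding D_def using eb[of N i] hb[of N i] by linarith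
    qed
    also have "\<dots> = D * real (card (bad_walks k N))" by simp
    also have "\<dots> \<le> D * real (C * N ^ k)"
    proof (rule mult_left_mono)
      show "real (card (bad_walks k N)) \<le> real (C * N ^ k)" using C[OF N] by (simp only: of_nat_le_iff)
      show "0 \<le> D" unfolding D_def using mu_bound_ge_1[of ?m] by simp
    qed
    finally have *: "\<bar>(\<Sum>i\<in>closed_walks ?m N. ex N i) - (\<Sum>i\<in>closed_walks ?m N. h N i)\<bar> \<le> D * real (C * N ^ k)" .
    have "expectation (spectral_moment ?m N) - w N = ((\<Sum>i\<in>closed_walks ?m N. ex N i) - (\<Sum>i\<in>closed_walks ?m N. h N i)) / real N ^ (k + 1)"
      unfolding sum_h[symmetric] ex_def using expectation_spectral_moment[of ?m N] k N0 unfolding den by (simp add: diff_divide_distrib)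
    hence "\<bar>expectation (spectral_moment ?m N) - w N\<bar> = \<bar>(\<Sum>i\<in>closed_walks ?m N. ex N i) - (\<Sum>i\<in>closed_walks ?m N. h N i)\<bar> / real N ^ (k + 1)"
      by (simp only: abs_divide power_abs abs_of_nat)
    also have "\<dots> \<le> D * real (C * N ^ k) / real N ^ (k + 1)" using * by (rule divide_right_mono) simp
    also have "\<dots> = D * real C / real N" using rN by (simp add: power_add)
    finally show ?thesis .
  qed
  have wl: "w \<longlonglongrightarrow> limit_moment q ?m"
    unfolding w_def limit_moment_even[OF k] using pairing_density_LIMSEQ[OF _ k] by (intro tendsto_sum tendsto_mult tendsto_const)
  have "(\<lambda>N. expectation (spectral_moment ?m N) - w N) \<longlonglongrightarrow> 0"
    by (rule Lim_null_comparison[OF _ lim_const_over_n[of "D * real C"]])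
       (use close in \<open>auto intro!: eventually_sequentiallyI[of 2]\<close>)
  from tendsto_add[OF this wl] show ?thesis by simp
qed

lemma moment_limit: "m \<ge> 1 \<Longrightarrow> (\<lambda>N. expectation (spectral_moment m N)) \<longlonglongrightarrow> limit_moment q m"
proof (cases "odd m")
  case True
  thus ?thesis using odd_moment_limit by (simp add: limit_moment_def)
next
  case False
  assume "m \<ge> 1"
  with False obtain k where "m = 2 * k" "k > 0" by (metis evenE mult_0_right neq0_conv not_one_le_zero)
  thus ?thesis using even_moment_limit by simp
qed

end

section \<open>Fourth central moments and almost sure convergence\<close>

context ensemble
begin

definition linked_quadruples :: "nat \<Rightarrow> nat \<Rightarrow> (nat \<Rightarrow> nat \<Rightarrow> nat) set" where
  "linked_quadruples m N = {g \<in> {..<4} \<rightarrow>\<^sub>E closed_walks m N.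
     (\<forall>v\<in>edges 4 m. 2 \<le> card {v' \<in> edges 4 m. lab N m (\<lambda>g. g) g v' = lab N m (\<lambda>g. g) g v}) \<and>
     (\<forall>u<4. \<exists>s<m. \<exists>v'\<in>edges 4 m. fst v' \<noteq> u \<and> lab N m (\<lambda>g. g) g v' = lab N m (\<lambda>g. g) g (u, s))}"

lemma walk_prods_moment:
  assumes U: "finite U"
  shows "integrable M (\<lambda>\<omega>. \<Prod>u\<in>U. walk_prod N m (g u) \<omega>)"
    "expectation (\<lambda>\<omega>. \<Prod>u\<in>U. walk_prod N m (g u) \<omega>) = walk_expectation N m (\<lambda>g. g) g (U \<times> {..<m})"
proof -
  have fin: "finite (U \<times> {..<m})" using U by simp
  show "integrable M (\<lambda>\<omega>. \<Prod>u\<in>U. walk_prod N m (g u) \<omega>)"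
    "expectation (\<lambda>\<omega>. \<Prod>u\<in>U. walk_prod N m (g u) \<omega>) = walk_expectation N m (\<lambda>g. g) g (U \<times> {..<m})"
    using entry_prod[OF fin, where N = N and m = m and vt = "\<lambda>g. g" and x = g] unfolding walk_prod_edges by blast+
qed

lemma walk_expectation_single:
  "walk_expectation N m (\<lambda>g. g) g ({u} \<times> {..<m}) = expectation (walk_prod N m (g u))"
  using walk_prods_moment(2)[of "{u}" N m g] by simp

lemma centered_product:
  shows "integrable M (\<lambda>\<omega>. \<Prod>u<4. walk_prod N m (g u) \<omega> - expectation (walk_prod N m (g u)))"
    and "expectation (\<lambda>\<omega>. \<Prod>u<(4::nat). walk_prod N m (g u) \<omega> - expectation (walk_prod N m (g u)))
       = (\<Sum>U\<in>Pow {..<4}. walk_expectation N m (\<lambda>g. g) g (U \<times> {..<m}) * (\<Prod>u\<in>{..<4} - U. - expectation (walk_prod N m (g u))))"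
proof -
  have expand: "(\<lambda>\<omega>. \<Prod>u<(4::nat). walk_prod N m (g u) \<omega> - expectation (walk_prod N m (g u)))
      = (\<lambda>\<omega>. \<Sum>U\<in>Pow {..<4}. (\<Prod>u\<in>U. walk_prod N m (g u) \<omega>) * (\<Prod>u\<in>{..<4} - U. - expectation (walk_prod N m (g u))))"
    unfolding diff_conv_add_uminus by (subst prod_add) simp_all
  have int: "integrable M (\<lambda>\<omega>. \<Prod>u\<in>U. walk_prod N m (g u) \<omega>)" if "U \<in> Pow {..<4::nat}" for U
    using that finite_subset[of U "{..<4}"] by (intro walk_prods_moment) auto
  show "integrable M (\<lambda>\<omega>. \<Prod>u<(4::nat). walk_prod N m (g u) \<omega> - expectation (walk_prod N m (g u)))"
    unfolding expand by (intro Bochner_Integration.integrable_sum integrable_mult_left) (rule int)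
  have "expectation (\<lambda>\<omega>. \<Sum>U\<in>Pow {..<4::nat}. (\<Prod>u\<in>U. walk_prod N m (g u) \<omega>) * (\<Prod>u\<in>{..<4} - U. - expectation (walk_prod N m (g u))))
      = (\<Sum>U\<in>Pow {..<4::nat}. expectation (\<lambda>\<omega>. (\<Prod>u\<in>U. walk_prod N m (g u) \<omega>) * (\<Prod>u\<in>{..<4} - U. - expectation (walk_prod N m (g u)))))"
    by (intro Bochner_Integration.integral_sum integrable_mult_left) (rule int)
  also have "\<dots> = (\<Sum>U\<in>Pow {..<4}. walk_expectation N m (\<lambda>g. g) g (U \<times> {..<m}) * (\<Prod>u\<in>{..<4} - U. - expectation (walk_prod N m (g u))))"
  proof (rule sum.cong[OF refl])
    fix U assume "U \<in> Pow {..<4::nat}"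
    hence "finite U" using finite_subset[of U "{..<4}"] by auto
    thus "expectation (\<lambda>\<omega>. (\<Prod>u\<in>U. walk_prod N m (g u) \<omega>) * (\<Prod>u\<in>{..<4} - U. - expectation (walk_prod N m (g u))))
        = walk_expectation N m (\<lambda>g. g) g (U \<times> {..<m}) * (\<Prod>u\<in>{..<4} - U. - expectation (walk_prod N m (g u)))"
      by (simp only: integral_mult_left_zero walk_prods_moment(2))
  qed
  finally show "expectation (\<lambda>\<omega>. \<Prod>u<(4::nat). walk_prod N m (g u) \<omega> - expectation (walk_prod N m (g u)))
       = (\<Sum>U\<in>Pow {..<4}. walk_expectation N m (\<lambda>g. g) g (U \<times> {..<m}) * (\<Prod>u\<in>{..<4} - U. - expectation (walk_prod N m (g u))))"
    unfolding expand .
qed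

lemma centered_product_bound:
  "\<bar>expectation (\<lambda>\<omega>. \<Prod>u<(4::nat). walk_prod N m (g u) \<omega> - expectation (walk_prod N m (g u)))\<bar> \<le> 16 * mu_bound (4 * m) ^ 5"
proof -
  define B where "B = mu_bound (4 * m)"
  have B1: "1 \<le> B" unfolding B_def by (rule mu_bound_ge_1)
  have ex: "\<bar>walk_expectation N m (\<lambda>g. g) g (U \<times> {..<m})\<bar> \<le> B" if "U \<subseteq> {..<4}" for U
    unfolding B_def
  proof (rule walk_expectation_bound)
    show "finite (U \<times> {..<m})" using that finite_subset by blast
    have "card U \<le> 4" using card_mono[OF _ that] by simp
    thus "card (U \<times> {..<m}) \<le> 4 * m" by (simp add: card_cartesian_product)
  qed
  have e1: "\<bar>expectation (walk_prod N m (g u))\<bar> \<le> B" if "u < 4" for u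
    using ex[of "{u}"] that unfolding walk_expectation_single by simp
  have "\<bar>expectation (\<lambda>\<omega>. \<Prod>u<(4::nat). walk_prod N m (g u) \<omega> - expectation (walk_prod N m (g u)))\<bar>
      \<le> (\<Sum>U\<in>Pow {..<4::nat}. \<bar>walk_expectation N m (\<lambda>g. g) g (U \<times> {..<m}) * (\<Prod>u\<in>{..<4} - U. - expectation (walk_prod N m (g u)))\<bar>)"
    unfolding centered_product(2) by (rule sum_abs)
  \<comment> \<open>One factor comes from the joint expectation of the walks in \<open>U\<close>, at
    most four from the single expectations; there are 16 subsets.\<close>
  also have "\<dots> \<le> (\<Sum>U\<in>Pow {..<4::nat}. B * B ^ 4)"
  proof (rule sum_mono)
    fix U assume U: "U \<in> Pow {..<4::nat}"
    have "\<bar>\<Prod>u\<in>{..<4} - U. - expectation (walk_prod N m (g u))\<bar> = (\<Prod>u\<in>{..<4} - U. \<bar>expectation (walk_prod N m (g u))\<bar>)"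
      by (simp add: abs_prod)
    also have "\<dots> \<le> (\<Prod>u\<in>{..<4} - U. B)" using e1 by (intro prod_mono) auto
    also have "\<dots> = B ^ card ({..<4} - U)" by simp
    also have "\<dots> \<le> B ^ 4" using B1 card_mono[of "{..<4::nat}" "{..<4} - U"] by (intro power_increasing) auto
    finally have p: "\<bar>\<Prod>u\<in>{..<4} - U. - expectation (walk_prod N m (g u))\<bar> \<le> B ^ 4" .
    show "\<bar>walk_expectation N m (\<lambda>g. g) g (U \<times> {..<m}) * (\<Prod>u\<in>{..<4} - U. - expectation (walk_prod N m (g u)))\<bar> \<le> B * B ^ 4"
      unfolding abs_mult by (rule mult_mono) (use ex[of U] U p B1 in auto)
  qed
  also have "\<dots> = 16 * B ^ 5" by (simp add: card_Pow power_Suc[symmetric] del: power_Suc)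
  finally show ?thesis unfolding B_def .
qed

text \<open>If some label occurs only once, every term of the expansion has a factor with mean 0. If
  some walk shares no label with the other three, its centred factor is independent of theirs and
  has mean 0.\<close>

lemma centered_product_unlinked:
  assumes m: "m > 0" and g: "g \<in> {..<4} \<rightarrow>\<^sub>E closed_walks m N" "g \<notin> linked_quadruples m N"
  shows "expectation (\<lambda>\<omega>. \<Prod>u<(4::nat). walk_prod N m (g u) \<omega> - expectation (walk_prod N m (g u))) = 0"
proof -
  let ?l = "lab N m (\<lambda>g. g) g" and ?V = "edges 4 m"
  define ex where "ex U = walk_expectation N m (\<lambda>g. g) g (U \<times> {..<m})" for U
  define rest where "rest A U = (\<Prod>u\<in>A - U. - expectation (walk_prod N m (g u)))" for A U :: "nat set"
  have gw: "g u \<in> closed_walks m N" if "u < 4" for u using g(1) that by (auto dest: PiE_mem)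
  have ex1: "ex {u} = expectation (walk_prod N m (g u))" for u unfolding ex_def by (rule walk_expectation_single)
  have main: "expectation (\<lambda>\<omega>. \<Prod>u<(4::nat). walk_prod N m (g u) \<omega> - expectation (walk_prod N m (g u)))
      = (\<Sum>U\<in>Pow {..<4}. ex U * rest {..<4} U)"
    unfolding centered_product(2) ex_def rest_def ..
  consider v where "v \<in> ?V" "card {v' \<in> ?V. ?l v' = ?l v} < 2"
    | u where "u < 4" "\<And>s v'. s < m \<Longrightarrow> v' \<in> ?V \<Longrightarrow> fst v' \<noteq> u \<Longrightarrow> ?l v' \<noteq> ?l (u, s)"
  proof -
    have "\<not> (\<forall>v\<in>?V. 2 \<le> card {v' \<in> ?V. ?l v' = ?l v}) \<or>
        \<not> (\<forall>u<4. \<exists>s<m. \<exists>v'\<in>?V. fst v' \<noteq> u \<and> ?l v' = ?l (u, s))"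
      using g unfolding linked_quadruples_def by blast
    thus thesis
    proof
      assume "\<not> (\<forall>v\<in>?V. 2 \<le> card {v' \<in> ?V. ?l v' = ?l v})"
      thus thesis using that(1) by (meson not_le)
    next
      assume "\<not> (\<forall>u<4. \<exists>s<m. \<exists>v'\<in>?V. fst v' \<noteq> u \<and> ?l v' = ?l (u, s))"
      then obtain u where u: "u < 4" "\<not> (\<exists>s<m. \<exists>v'\<in>?V. fst v' \<noteq> u \<and> ?l v' = ?l (u, s))" by blast
      show thesis by (rule that(2)[OF u(1)]) (use u(2) in blast)
    qed
  qed
  thus ?thesis
  proof cases
    case 1
    have zero: "ex U = 0" if U: "U \<subseteq> {..<4}" "fst v \<in> U" for U
      unfolding ex_def
    proof (rule walk_expectation_0)
      have vW: "v \<in> U \<times> {..<m}" using 1(1) U by (auto simp: edges_def)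
      show "finite (U \<times> {..<m})" using U finite_subset by blast
      show "v \<in> U \<times> {..<m}" by (rule vW)
      have "U \<times> {..<m} \<subseteq> ?V" using U(1) unfolding edges_def by blast
      hence sub: "{v' \<in> U \<times> {..<m}. ?l v' = ?l v} \<subseteq> {v' \<in> ?V. ?l v' = ?l v}" by blast
      have "finite {v' \<in> ?V. ?l v' = ?l v}" by simp
      from card_mono[OF this sub] have "card {v' \<in> U \<times> {..<m}. ?l v' = ?l v} < 2" using 1(2) by linarith
      moreover have "card {v' \<in> U \<times> {..<m}. ?l v' = ?l v} > 0" unfolding card_gt_0_iff
      proof
        show "{v' \<in> U \<times> {..<m}. ?l v' = ?l v} \<noteq> {}" using vW by blast
        show "finite {v' \<in> U \<times> {..<m}. ?l v' = ?l v}" using \<open>finite (U \<times> {..<m})\<close> by simp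
      qed
      ultimately show "card {v' \<in> U \<times> {..<m}. ?l v' = ?l v} = 1" by linarith
    qed
    have fv: "fst v < 4" using 1(1) by (auto simp: edges_def)
    show ?thesis unfolding main
    proof (rule sum.neutral, rule ballI)
      fix U assume U: "U \<in> Pow {..<4::nat}"
      show "ex U * rest {..<4} U = 0"
      proof (cases "fst v \<in> U")
        case True
        thus ?thesis using zero[of U] U by simp
      next
        case False
        \<comment> \<open>If the walk through \<open>v\<close> is not in \<open>U\<close>, its
          single expectation is a factor of the remaining product, and it vanishes because the label
          of \<open>v\<close> occurs once there too.\<close>
        have "expectation (walk_prod N m (g (fst v))) = 0" using zero[of "{fst v}"] fv unfolding ex1 by simp
        hence "rest {..<4} U = 0" unfolding rest_def using False fv by (intro prod_zero) auto
        thus ?thesis by simp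
      qed
    qed
  next
    case 2
    let ?R = "{..<4} - {u}"
    have ins: "insert u ?R = {..<4}" using 2(1) by auto
    have Pow: "Pow {..<4} = Pow ?R \<union> insert u ` Pow ?R" using Pow_insert[of u ?R] unfolding ins .
    \<comment> \<open>The joint expectation factors for the isolated walk, so the terms of
      \<open>U\<close> and \<open>insert u U\<close> cancel, their remaining products differing by
      the factor \<open>- ex {u}\<close>.\<close>
    have split: "ex (insert u U) = ex {u} * ex U" if U: "U \<subseteq> ?R" for U
    proof -
      have W: "insert u U \<times> {..<m} = ({u} \<times> {..<m}) \<union> (U \<times> {..<m})" by auto
      have fin: "finite ({u} \<times> {..<m})" "finite (U \<times> {..<m})" using U finite_subset[of U "{..<4}"] by auto
      have d: "({u} \<times> {..<m}) \<inter> (U \<times> {..<m}) = {}" using U by auto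
      have lne: "?l v \<noteq> ?l v'" if "v \<in> {u} \<times> {..<m}" "v' \<in> U \<times> {..<m}" for v v'
      proof -
        obtain s where s: "v = (u, s)" "s < m" using \<open>v \<in> {u} \<times> {..<m}\<close> by auto
        have "v' \<in> ?V" "fst v' \<noteq> u" using \<open>v' \<in> U \<times> {..<m}\<close> U by (auto simp: edges_def)
        from 2(2)[OF s(2) this] show ?thesis unfolding s(1) by metis
      qed
      have l: "?l ` ({u} \<times> {..<m}) \<inter> ?l ` (U \<times> {..<m}) = {}" using lne by blast
      have e: "walk_edge m (\<lambda>g. g) g ` ({u} \<times> {..<m}) \<inter> walk_edge m (\<lambda>g. g) g ` (U \<times> {..<m}) = {}"
      proof (rule ccontr)
        assume "\<not> ?thesis"
        then obtain v v' where v: "v \<in> {u} \<times> {..<m}" "v' \<in> U \<times> {..<m}" "walk_edge m (\<lambda>g. g) g v = walk_edge m (\<lambda>g. g) g v'" by blast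
        have "v \<in> ?V" using v(1) 2(1) by (auto simp: edges_def)
        hence "src (\<lambda>g. g) g v < N" "tgt m (\<lambda>g. g) g v < N"
          using edge_vertices_less[where w = 4 and vt = "\<lambda>g. g" and x = g and N = N, OF m gw] by blast+
        from lab_eq_of_walk_edge_eq[OF this v(3)] lne[OF v(1,2)] show False by blast
      qed
      show ?thesis unfolding ex_def walk_expectation_def W class_prod_Un[OF fin d l] class_prod_Un[OF fin d e] by simp
    qed
    have "(\<Sum>U\<in>Pow {..<4}. ex U * rest {..<4} U) = (\<Sum>U\<in>Pow ?R \<union> insert u ` Pow ?R. ex U * rest {..<4} U)"
      unfolding Pow ..
    also have "\<dots> = (\<Sum>U\<in>Pow ?R. ex U * rest {..<4} U) + (\<Sum>U\<in>insert u ` Pow ?R. ex U * rest {..<4} U)"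
      by (rule sum.union_disjoint) auto
    also have "(\<Sum>U\<in>insert u ` Pow ?R. ex U * rest {..<4} U) = (\<Sum>U\<in>Pow ?R. ex (insert u U) * rest {..<4} (insert u U))"
      by (subst sum.reindex) (auto simp: inj_on_def o_def)
    also have "(\<Sum>U\<in>Pow ?R. ex U * rest {..<4} U) + (\<Sum>U\<in>Pow ?R. ex (insert u U) * rest {..<4} (insert u U))
        = (\<Sum>U\<in>Pow ?R. 0)"
      unfolding sum.distrib[symmetric]
    proof (rule sum.cong[OF refl])
      fix U assume "U \<in> Pow ?R"
      hence U: "U \<subseteq> ?R" by simp
      have eq: "{..<4} - U = insert u ({..<4} - insert u U)" using U 2(1) by auto
      have "rest {..<4} U = - ex {u} * rest {..<4} (insert u U)"
        unfolding rest_def ex1 eq by (subst prod.insert) auto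
      thus "ex U * rest {..<4} U + ex (insert u U) * rest {..<4} (insert u U) = 0" unfolding split[OF U] by simp
    qed
    finally show ?thesis unfolding main by simp
  qed
qed

text \<open>Expanding the fourth power gives a sum over quadruples of walks, of which only the
  linked ones contribute, each boundedly. Their number \<open>O(N ^ (2 * m + 2))\<close> is divided
  by \<open>N ^ (2 * m + 4)\<close>.\<close>

lemma fourth_central_moment:
  assumes m: "m > 0"
  shows "\<exists>C. \<forall>N\<ge>1. integrable M (\<lambda>\<omega>. (spectral_moment m N \<omega> - expectation (spectral_moment m N)) ^ 4) \<and>
    expectation (\<lambda>\<omega>. (spectral_moment m N \<omega> - expectation (spectral_moment m N)) ^ 4) \<le> C / real N ^ 2"
proof -
  define B where "B = 16 * mu_bound (4 * m) ^ 5"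
  define K where "K = card (configs (edges 4 m))"
  have B0: "0 \<le> B" unfolding B_def using mu_bound_ge_1[of "4 * m"] by simp
  have "integrable M (\<lambda>\<omega>. (spectral_moment m N \<omega> - expectation (spectral_moment m N)) ^ 4) \<and>
    expectation (\<lambda>\<omega>. (spectral_moment m N \<omega> - expectation (spectral_moment m N)) ^ 4) \<le> (B * real K * 3 ^ (2 * m + 2)) / real N ^ 2"
    if N: "N \<ge> 1" for N
  proof -
    have N0: "N > 0" using N by simp
    define d where "d = real N * sqrt (real N) ^ m"
    have d4: "d ^ 4 = real N ^ (2 * m + 2) * real N ^ 2"
    proof -
      have "sqrt (real N) ^ 4 = real N ^ 2" using real_sqrt_pow2[of "real N"] by (simp add: power4_eq_xxxx power2_eq_square)
      hence "(sqrt (real N) ^ m) ^ 4 = real N ^ (2 * m)" by (metis power_mult mult.commute)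
      hence "d ^ 4 = real N ^ 4 * real N ^ (2 * m)" by (simp only: d_def power_mult_distrib)
      also have "\<dots> = real N ^ (2 * m + 2) * real N ^ 2"
        unfolding power_add[symmetric] by (rule arg_cong[of _ _ "(^) (real N)"]) simp
      finally show ?thesis .
    qed
    have dpos: "d ^ 4 > 0" unfolding d4 using N by simp
    define P where "P g \<omega> = (\<Prod>u<(4::nat). walk_prod N m (g u) \<omega> - expectation (walk_prod N m (g u)))" for g \<omega>
    let ?G = "{..<4::nat} \<rightarrow>\<^sub>E closed_walks m N"
    have finG: "finite ?G" by (intro finite_PiE) auto
    have Y: "(spectral_moment m N \<omega> - expectation (spectral_moment m N)) ^ 4 = (\<Sum>g\<in>?G. P g \<omega>) / d ^ 4" for \<omega>
    proof -
      have "spectral_moment m N \<omega> - expectation (spectral_moment m N)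
          = (\<Sum>i\<in>closed_walks m N. walk_prod N m i \<omega> - expectation (walk_prod N m i)) / d"
        unfolding spectral_moment_eq[OF m N0] expectation_spectral_moment[OF m N0] d_def walk_prod_moment(2)
        by (simp only: sum_subtractf diff_divide_distrib)
      hence "(spectral_moment m N \<omega> - expectation (spectral_moment m N)) ^ 4
          = (\<Prod>u<(4::nat). \<Sum>i\<in>closed_walks m N. walk_prod N m i \<omega> - expectation (walk_prod N m i)) / d ^ 4"
        by (simp add: power_divide)
      also have "(\<Prod>u<(4::nat). \<Sum>i\<in>closed_walks m N. walk_prod N m i \<omega> - expectation (walk_prod N m i)) = (\<Sum>g\<in>?G. P g \<omega>)"
        unfolding P_def by (rule prod_sum_PiE) auto
      finally show ?thesis .
    qed
    have Pint: "integrable M (P g)" for g unfolding P_def[abs_def] by (rule centered_product(1))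
    have "integrable M (\<lambda>\<omega>. (\<Sum>g\<in>?G. P g \<omega>) / d ^ 4)"
      using Pint by (intro integrable_divide Bochner_Integration.integrable_sum)
    moreover have "expectation (\<lambda>\<omega>. (\<Sum>g\<in>?G. P g \<omega>) / d ^ 4) \<le> (B * real K * 3 ^ (2 * m + 2)) / real N ^ 2"
    proof -
      have "(\<Sum>g\<in>?G. expectation (P g)) = (\<Sum>g\<in>linked_quadruples m N. expectation (P g))"
      proof (rule sum.mono_neutral_right[OF finG])
        show "linked_quadruples m N \<subseteq> ?G" unfolding linked_quadruples_def by blast
        show "\<forall>g\<in>?G - linked_quadruples m N. expectation (P g) = 0"
          unfolding P_def[abs_def] using centered_product_unlinked[OF m] by blast
      qed
      also have "\<dots> \<le> (\<Sum>g\<in>linked_quadruples m N. B)"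
      proof (rule sum_mono)
        fix g show "expectation (P g) \<le> B"
          using centered_product_bound[of N m g] unfolding P_def[abs_def] B_def by (rule abs_le_D1)
      qed
      also have "\<dots> = real (card (linked_quadruples m N)) * B" by simp
      also have "\<dots> \<le> real (K * (3 * N) ^ (2 * m + 2)) * B"
      proof (rule mult_right_mono[OF _ B0])
        show "real (card (linked_quadruples m N)) \<le> real (K * (3 * N) ^ (2 * m + 2))"
          using card_linked_quadruples[OF m N] unfolding linked_quadruples_def K_def of_nat_le_iff .
      qed
      also have "\<dots> = (B * real K * 3 ^ (2 * m + 2)) * real N ^ (2 * m + 2)"
        by (simp only: of_nat_mult of_nat_power of_nat_numeral power_mult_distrib mult_ac)
      finally have le: "(\<Sum>g\<in>?G. expectation (P g)) \<le> (B * real K * 3 ^ (2 * m + 2)) * real N ^ (2 * m + 2)" .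
      have "expectation (\<lambda>\<omega>. (\<Sum>g\<in>?G. P g \<omega>) / d ^ 4) = (\<Sum>g\<in>?G. expectation (P g)) / d ^ 4"
        by (simp only: integral_divide_zero Bochner_Integration.integral_sum[OF Pint])
      also have "\<dots> \<le> (B * real K * 3 ^ (2 * m + 2)) * real N ^ (2 * m + 2) / d ^ 4"
        by (rule divide_right_mono[OF le less_imp_le[OF dpos]])
      also have "\<dots> = (B * real K * 3 ^ (2 * m + 2)) / real N ^ 2"
      proof -
        have cancel: "a * X / (X * Z) = a / Z" if "X \<noteq> 0" for a X Z :: real using that by simp
        show ?thesis unfolding d4 by (rule cancel) (use N in simp)
      qed
      finally show ?thesis .
    qed
    ultimately show ?thesis unfolding Y by blast
  qed
  thus ?thesis by blast
qed

lemma spectral_moment_AE: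
  assumes m: "m \<ge> 1"
  shows "AE \<omega> in M. (\<lambda>N. spectral_moment m N \<omega>) \<longlonglongrightarrow> limit_moment q m"
proof -
  have m0: "m > 0" using m by simp
  obtain C where C: "\<And>N. N \<ge> 1 \<Longrightarrow> integrable M (\<lambda>\<omega>. (spectral_moment m N \<omega> - expectation (spectral_moment m N)) ^ 4) \<and>
    expectation (\<lambda>\<omega>. (spectral_moment m N \<omega> - expectation (spectral_moment m N)) ^ 4) \<le> C / real N ^ 2"
    using fourth_central_moment[OF m0] by blast
  have "AE \<omega> in M. (\<lambda>n. spectral_moment m (Suc n) \<omega> - expectation (spectral_moment m (Suc n))) \<longlonglongrightarrow> 0"
  proof (rule AE_tendsto_0_of_fourth_moments)
    show "integrable M (\<lambda>\<omega>. (spectral_moment m (Suc n) \<omega> - expectation (spectral_moment m (Suc n))) ^ 4)" for n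
      using C[of "Suc n"] by simp
    show "expectation (\<lambda>\<omega>. (spectral_moment m (Suc n) \<omega> - expectation (spectral_moment m (Suc n))) ^ 4) \<le> C / real (Suc n) ^ 2" for n
      using C[of "Suc n"] by simp
    show "(\<lambda>\<omega>. spectral_moment m (Suc n) \<omega> - expectation (spectral_moment m (Suc n))) \<in> borel_measurable M" for n
      using spectral_moment_integrable[OF m0, of "Suc n"] by (intro borel_measurable_diff) auto
  qed
  thus ?thesis
  proof eventually_elim
    case (elim \<omega>)
    have "(\<lambda>n. spectral_moment m (Suc n) \<omega>) \<longlonglongrightarrow> limit_moment q m"
      using tendsto_add[OF elim LIMSEQ_Suc[OF moment_limit[OF m]]] by simp
    thus ?case by (rule LIMSEQ_imp_Suc)
  qed
qed

text \<open>Almost every outcome has convergent spectral moments, and at one of them the method of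
  moments produces a measure. Determinacy shows that it does not depend on the outcome, so the same
  measure is the weak limit almost surely.\<close>

theorem limiting_measure:
  "\<exists>\<nu>. real_distribution \<nu> \<and> (\<forall>k. integrable \<nu> (\<lambda>x. x ^ k) \<and> moment \<nu> k = limit_moment q k) \<and>
     limiting_rescaled_spectral_measure M random_mat \<nu> \<and> spectral_measures_converge_ae M random_mat \<nu>"
proof -
  have all: "AE \<omega> in M. \<forall>m\<ge>1. (\<lambda>N. spectral_moment m N \<omega>) \<longlonglongrightarrow> limit_moment q m"
    unfolding AE_all_countable
  proof
    fix m :: nat
    show "AE \<omega> in M. m \<ge> 1 \<longrightarrow> (\<lambda>N. spectral_moment m N \<omega>) \<longlonglongrightarrow> limit_moment q m"
    proof (cases "m \<ge> 1")
      case True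
      show ?thesis using spectral_moment_AE[OF True] by eventually_elim blast
    qed simp
  qed
  note growth = limit_moment_growth[OF q]
  \<comment> \<open>The sequence is shifted by one because the formula for the moments needs a
    nonempty matrix.\<close>
  have conv: "\<exists>\<nu>. real_distribution \<nu> \<and> (\<forall>k. integrable \<nu> (\<lambda>x. x ^ k) \<and> moment \<nu> k = limit_moment q k) \<and>
      weak_conv_m (\<lambda>N. rescaled_spectral_measure (random_mat (Suc N) \<omega>)) \<nu>"
    if \<omega>: "\<forall>m\<ge>1. (\<lambda>N. spectral_moment m N \<omega>) \<longlonglongrightarrow> limit_moment q m" for \<omega>
  proof (rule method_of_moments[OF real_distribution_rescaled_spectral_measure _ _ growth])
    show "integrable (rescaled_spectral_measure (random_mat (Suc N) \<omega>)) (\<lambda>x. x ^ k)" for N k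
      by (rule moment_rescaled_spectral_measure(1)[OF random_mat_carrier]) (simp, rule random_mat_symmetric)
    show "(\<lambda>N. moment (rescaled_spectral_measure (random_mat (Suc N) \<omega>)) k) \<longlonglongrightarrow> limit_moment q k" for k
    proof (cases "k = 0")
      case True
      have "prob_space (rescaled_spectral_measure (random_mat (Suc N) \<omega>))" for N
        using real_distribution_rescaled_spectral_measure by (simp add: real_distribution_def)
      hence "moment (rescaled_spectral_measure (random_mat (Suc N) \<omega>)) 0 = 1" for N
        by (simp add: moment_def prob_space.prob_space)
      thus ?thesis using True by (simp add: limit_moment_def)
    next
      case False
      thus ?thesis using \<omega> LIMSEQ_Suc[of "\<lambda>N. spectral_moment k N \<omega>"] unfolding spectral_moment_def by simp
    qed
  qed
  have "\<exists>\<omega>. \<forall>m\<ge>1. (\<lambda>N. spectral_moment m N \<omega>) \<longlonglongrightarrow> limit_moment q m"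
  proof (rule ccontr)
    assume *: "\<not> ?thesis"
    have "AE \<omega> in M. False" using all by (rule AE_mp) (use * in \<open>intro AE_I2; blast\<close>)
    thus False by simp
  qed
  then obtain \<omega>0 where "\<forall>m\<ge>1. (\<lambda>N. spectral_moment m N \<omega>0) \<longlonglongrightarrow> limit_moment q m" ..
  from conv[OF this] obtain \<nu> where \<nu>: "real_distribution \<nu>" "\<And>k. integrable \<nu> (\<lambda>x. x ^ k)" "\<And>k. moment \<nu> k = limit_moment q k"
    by blast
  have uniq: "\<nu>' = \<nu>" if "real_distribution \<nu>'" "\<And>k. integrable \<nu>' (\<lambda>x. x ^ k)" "\<And>k. moment \<nu>' k = limit_moment q k" for \<nu>'
    by (rule moments_determine) (use that \<nu> growth in auto)
  have det: "moment_determined \<nu>"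
    unfolding moment_determined_def
  proof (intro conjI allI impI)
    fix \<nu>' assume *: "real_distribution \<nu>' \<and> (\<forall>k\<ge>1. integrable \<nu>' (\<lambda>x. x ^ k) \<and> moment \<nu>' k = moment \<nu> k)"
    have p: "prob_space \<nu>'" "prob_space \<nu>" using * \<nu>(1) by (auto simp: real_distribution_def)
    interpret \<nu>': prob_space \<nu>' by (rule p(1))
    have z: "integrable \<nu>' (\<lambda>x. x ^ 0)" "moment \<nu>' 0 = moment \<nu> 0"
      by (simp_all add: moment_def prob_space.prob_space[OF p(1)] prob_space.prob_space[OF p(2)])
    have "integrable \<nu>' (\<lambda>x. x ^ k) \<and> moment \<nu>' k = limit_moment q k" for k
    proof (cases "k = 0")
      case True
      show ?thesis unfolding True using z \<nu>(3)[of 0] by metis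
    next
      case False
      hence "k \<ge> 1" by simp
      thus ?thesis using * \<nu>(3)[of k] by metis
    qed
    thus "\<nu>' = \<nu>" using * by (intro uniq) blast+
  qed (use \<nu> in auto)
  have lim: "limiting_rescaled_spectral_measure M random_mat \<nu>"
    unfolding limiting_rescaled_spectral_measure_def
    using det moment_limit \<nu>(3) unfolding spectral_moment_def[abs_def] by simp
  have "spectral_measures_converge_ae M random_mat \<nu>"
    unfolding spectral_measures_converge_ae_def
    using all
  proof eventually_elim
    case (elim \<omega>)
    obtain \<nu>' where \<nu>': "real_distribution \<nu>'" "\<And>k. integrable \<nu>' (\<lambda>x. x ^ k)" "\<And>k. moment \<nu>' k = limit_moment q k"
      "weak_conv_m (\<lambda>N. rescaled_spectral_measure (random_mat (Suc N) \<omega>)) \<nu>'"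
      using conv[OF elim] by blast
    have "\<nu>' = \<nu>" by (rule uniq[OF \<nu>'(1-3)])
    hence w: "weak_conv_m (\<lambda>N. rescaled_spectral_measure (random_mat (Suc N) \<omega>)) \<nu>" using \<nu>'(4) by simp
    have "weak_conv_m (\<lambda>N. rescaled_spectral_measure (random_mat N \<omega>)) \<nu>"
      unfolding weak_conv_m_def weak_conv_def
    proof (intro allI impI)
      fix x assume "isCont (cdf \<nu>) x"
      hence "(\<lambda>N. cdf (rescaled_spectral_measure (random_mat (Suc N) \<omega>)) x) \<longlonglongrightarrow> cdf \<nu> x"
        using w unfolding weak_conv_m_def weak_conv_def by blast
      thus "(\<lambda>N. cdf (rescaled_spectral_measure (random_mat N \<omega>)) x) \<longlonglongrightarrow> cdf \<nu> x" by (rule LIMSEQ_imp_Suc)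
    qed
    thus ?case using elim \<nu>(3) unfolding spectral_moment_def by simp
  qed
  thus ?thesis using \<nu> lim by blast
qed

end

section \<open>Vanishing sign expectation\<close>

text \<open>A walk is determined by its pattern of coinciding positions, of which there are finitely
  many, and its vertices at the at most \<open>r\<close> representative positions.\<close>

lemma card_few_vertices:
  assumes N: "N \<ge> 1"
  shows "card {i \<in> closed_walks m N. card (i ` {..<m}) \<le> r} \<le> card ({..<m} \<rightarrow>\<^sub>E {..<m}) * (3 * N) ^ r"
proof -
  let ?T = "\<lambda>f. {i \<in> closed_walks m N. canon {..<m} i = f \<and> card (i ` {..<m}) \<le> r}"
  have "finite {i \<in> closed_walks m N. card (i ` {..<m}) \<le> r} \<and>
    card {i \<in> closed_walks m N. card (i ` {..<m}) \<le> r} \<le> card ({..<m} \<rightarrow>\<^sub>E {..<m}) * (3 * N) ^ r"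
  proof (rule card_covered_le[where T = ?T])
    show "finite ({..<m} \<rightarrow>\<^sub>E {..<m})" by (intro finite_PiE) auto
    show "{i \<in> closed_walks m N. card (i ` {..<m}) \<le> r} \<subseteq> (\<Union>f\<in>{..<m} \<rightarrow>\<^sub>E {..<m}. ?T f)"
    proof
      fix i assume "i \<in> {i \<in> closed_walks m N. card (i ` {..<m}) \<le> r}"
      thus "i \<in> (\<Union>f\<in>{..<m} \<rightarrow>\<^sub>E {..<m}. ?T f)"
        by (intro UN_I[OF canon_PiE[of "{..<m}" i]]) simp_all
    qed
    fix f assume "f \<in> {..<m} \<rightarrow>\<^sub>E {..<m}"
    show "finite (?T f) \<and> card (?T f) \<le> (3 * N) ^ r"
    proof (cases "?T f = {}")
      case True
      show ?thesis unfolding True by simp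
    next
      case False
      obtain i0 where "i0 \<in> ?T f" using False unfolding ex_in_conv[symmetric] by blast
      hence i0: "canon {..<m} i0 = f" "card (i0 ` {..<m}) \<le> r" by simp_all
      have K: "card (f ` {..<m}) \<le> r" using card_canon_image[of "{..<m}" i0] i0 by simp
      have "finite (?T f) \<and> card (?T f) \<le> (3 * N) ^ card (f ` {..<m})"
      proof (rule card_le_of_inj_int_box[where F = "\<lambda>i p. int (i p)", OF _ N])
        show "finite (f ` {..<m})" by simp
        fix i i' assume i: "i \<in> ?T f" "i' \<in> ?T f" and eq: "\<And>k. k \<in> f ` {..<m} \<Longrightarrow> int (i k) = int (i' k)"
        show "i = i'"
        proof (rule PiE_ext[of i "{..<m}" "\<lambda>_. {..<N}" i'])
          show "i \<in> {..<m} \<rightarrow>\<^sub>E {..<N}" "i' \<in> {..<m} \<rightarrow>\<^sub>E {..<N}" using i unfolding closed_walks_def by blast+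
          fix p assume p: "p \<in> {..<m}"
          have "i (f p) = i p" "i' (f p) = i' p"
            using canon_in[OF p, of i] canon_in[OF p, of i'] i by auto
          thus "i p = i' p" using eq[of "f p"] p by simp
        qed
      next
        fix i k assume i: "i \<in> ?T f" and "k \<in> f ` {..<m}"
        then obtain p where p: "p \<in> {..<m}" "k = f p" by blast
        have "i k = i p" using canon_in[OF p(1), of i] i p(2) by auto
        moreover have "i p < N" using closed_walk_less[of i m N p] i p(1) by simp
        ultimately show "\<bar>int (i k)\<bar> \<le> int N" by simp
      qed
      moreover have "(3 * N) ^ card (f ` {..<m}) \<le> (3 * N) ^ r" using K N by (intro power_increasing) auto
      ultimately show ?thesis by linarith
    qed
  qed
  thus ?thesis by blast
qed

section \<open>Closed walks that traverse trees\<close>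

definition steps :: "nat \<Rightarrow> (nat \<Rightarrow> nat) \<Rightarrow> nat list" where
  "steps m i = map (\<lambda>s. i (Suc s mod m)) [0..<m]"

lemma length_steps [simp]: "length (steps m i) = m"
  by (simp add: steps_def)

lemma steps_nth: "s < m \<Longrightarrow> steps m i ! s = i (Suc s mod m)"
  by (simp add: steps_def)

lemma edge_list_steps:
  assumes "s < m"
  shows "edge_list (i 0) (steps m i) ! s = walk_edge m solo i (0, s)"
proof -
  have "(i 0 # steps m i) ! s = i s"
    using assms by (cases s) (simp_all add: steps_nth)
  thus ?thesis using assms by (simp add: edge_list_nth steps_nth walk_edge_def)
qed

lemma count_edge_list_steps:
  "count_list (edge_list (i 0) (steps m i)) p = card {v \<in> edges 1 m. walk_edge m solo i v = p}"
proof -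
  have "count_list (edge_list (i 0) (steps m i)) p = length (filter ((=) p) (edge_list (i 0) (steps m i)))"
    by (rule count_list_eq_length_filter)
  also have "\<dots> = card {s. s < m \<and> p = edge_list (i 0) (steps m i) ! s}"
    by (simp add: length_filter_conv_card)
  also have "\<dots> = card (Pair 0 ` {s. s < m \<and> p = edge_list (i 0) (steps m i) ! s})"
    by (simp add: card_image inj_on_def)
  also have "Pair 0 ` {s. s < m \<and> p = edge_list (i 0) (steps m i) ! s} = {v \<in> edges 1 m. walk_edge m solo i v = p}"
    unfolding edges_1 using edge_list_steps[of _ m i] by auto
  finally show ?thesis .
qed

definition tree_like :: "nat \<Rightarrow> (nat \<Rightarrow> nat) \<Rightarrow> bool" where
  "tree_like m i \<longleftrightarrow> tree_walk [i 0] {i 0} (steps m i)"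

lemma tree_like_even:
  assumes "tree_like m i"
  shows "even (card {v \<in> edges 1 m. walk_edge m solo i v = p})"
  using tree_walk_even[OF assms[unfolded tree_like_def], of p] by (simp add: count_edge_list_steps)

lemma card_image_eq_sum_classes:
  assumes "finite V"
  shows "card V = (\<Sum>l\<in>g ` V. card {v \<in> V. g v = l})"
  using sum.image_gen[OF assms, of "\<lambda>_. 1::nat" g] by simp

text \<open>
  If there are more than \<open>k\<close> vertices, the at least \<open>k\<close> steps to a new vertex use distinct edges. As
  there are at most \<open>k\<close> edges, each is used exactly twice, the first time to reach a new vertex.
\<close>

lemma tree_likeI:
  assumes k: "k > 0" and even: "\<And>v. v \<in> edges 1 (2 * k) \<Longrightarrow> even (card {v' \<in> edges 1 (2 * k). walk_edge (2 * k) solo i v' = walk_edge (2 * k) solo i v})"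
    and many: "k < card (i ` {..<2 * k})"
  shows "tree_like (2 * k) i"
proof -
  define m where "m = 2 * k"
  have m0: "m > 0" using k by (simp add: m_def)
  define E where "E j = edge (i j) (i (Suc j mod m))" for j
  \<comment> \<open>The steps that reach a vertex for the first time; every vertex except the
    starting one is reached by such a step.\<close>
  define New where "New = {j. j < m \<and> i (Suc j mod m) \<notin> i ` {..j}}"
  have finNew: "finite New" unfolding New_def by simp
  have New_Suc: "Suc j mod m = Suc j \<and> Suc j < m" if "j \<in> New" for j
  proof -
    have j: "j < m" "i (Suc j mod m) \<notin> i ` {..j}" using that by (auto simp: New_def)
    have "Suc j \<noteq> m"
    proof
      assume "Suc j = m"
      hence "i (Suc j mod m) = i 0" by simp
      thus False using j(2) by auto
    qed
    thus ?thesis using j(1) by simp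
  qed
  have "i ` {..<m} \<subseteq> insert (i 0) ((\<lambda>j. i (Suc j mod m)) ` New)"
  proof
    fix w assume "w \<in> i ` {..<m}"
    then obtain p0 where p0: "p0 < m" "i p0 = w" by auto
    define p where "p = (LEAST p. i p = w)"
    have p: "i p = w" "p \<le> p0" unfolding p_def using p0(2) by (auto intro: LeastI Least_le)
    have least: "i p' \<noteq> w" if "p' < p" for p' using not_less_Least that unfolding p_def by blast
    show "w \<in> insert (i 0) ((\<lambda>j. i (Suc j mod m)) ` New)"
    proof (cases p)
      case 0
      thus ?thesis using p(1) by simp
    next
      case (Suc j)
      have lt: "Suc j < m" using p(2) p0(1) Suc by linarith
      have "w \<notin> i ` {..j}"
      proof
        assume "w \<in> i ` {..j}"
        then obtain p' where "w = i p'" "p' \<le> j" by (metis atMost_iff imageE)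
        thus False using least[of p'] Suc by simp
      qed
      hence "j \<in> New" unfolding New_def using lt p(1) Suc by simp
      moreover have "w = i (Suc j mod m)" using lt p(1) Suc by simp
      ultimately show ?thesis by blast
    qed
  qed
  hence "card (i ` {..<m}) \<le> card (insert (i 0) ((\<lambda>j. i (Suc j mod m)) ` New))"
    using finNew by (intro card_mono) auto
  also have "\<dots> \<le> Suc (card ((\<lambda>j. i (Suc j mod m)) ` New))" by (rule card_insert_le_m1) simp_all
  also have "\<dots> \<le> Suc (card New)" using card_image_le[OF finNew] by simp
  finally have New_ge: "k \<le> card New" using many unfolding m_def by simp
  \<comment> \<open>The edge of the step \<open>j'\<close> contains a vertex not seen before, so no
    earlier step can use that edge.\<close>
  have contra: False if j: "j < j'" "j' \<in> New" "E j = E j'" for j j'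
  proof -
    have s: "Suc j' mod m = Suc j'" "Suc j' < m" using New_Suc[OF j(2)] by auto
    have "i (Suc j') \<notin> i ` {..j'}" using j(2) s by (simp add: New_def)
    moreover have "Suc j mod m = Suc j" using j(1) s by simp
    hence "i (Suc j') = i j \<or> i (Suc j') = i (Suc j)"
      using j(3) s unfolding E_def edge_eq_iff by auto
    ultimately show False using j(1) by auto
  qed
  have injE: "inj_on E New"
  proof (rule inj_onI)
    fix j j' assume "j \<in> New" "j' \<in> New" "E j = E j'"
    thus "j = j'" using contra[of j j'] contra[of j' j] by (metis linorder_neqE_nat)
  qed
  let ?ES = "E ` {..<m}"
  define c where "c p = card {j \<in> {..<m}. E j = p}" for p
  have c_eq: "c p = card {v \<in> edges 1 m. walk_edge m solo i v = p}" for p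
  proof -
    have "{v \<in> edges 1 m. walk_edge m solo i v = p} = Pair 0 ` {j \<in> {..<m}. E j = p}"
      unfolding edges_1 walk_edge_def E_def by auto
    thus ?thesis unfolding c_def by (simp add: card_image inj_on_def)
  qed
  have c2: "2 \<le> c p" if p: "p \<in> ?ES" for p
  proof -
    obtain j where pj: "p = E j" and "j \<in> {..<m}" using p by (rule imageE)
    hence j: "j < m" by simp
    have "(0, j) \<in> edges 1 m" using j by (simp add: edges_1)
    from even[folded m_def, OF this] have "even (c p)"
      unfolding c_eq pj by (simp add: walk_edge_def E_def)
    moreover have "c p > 0" unfolding c_def card_gt_0_iff
    proof
      show "{j \<in> {..<m}. E j = p} \<noteq> {}" using j pj by blast
    qed simp
    ultimately show ?thesis by presburger
  qed
  have sum_c: "m = (\<Sum>p\<in>?ES. c p)" unfolding c_def using card_image_eq_sum_classes[of "{..<m}" E] by simp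
  have "(\<Sum>p\<in>?ES. 2) \<le> (\<Sum>p\<in>?ES. c p)" by (rule sum_mono) (rule c2)
  hence ES_le: "card ?ES \<le> k" using sum_c unfolding m_def by simp
  have sub: "E ` New \<subseteq> ?ES" unfolding New_def by auto
  have cE: "card (E ` New) = card New" using injE by (rule card_image)
  have img: "E ` New = ?ES"
    by (rule card_seteq[OF _ sub]) (use cE New_ge ES_le in simp_all)
  have cardES: "card ?ES = k" using img cE New_ge ES_le by simp
  have c_eq2: "c p = 2" if p: "p \<in> ?ES" for p
  proof -
    have "(\<Sum>p\<in>?ES. c p) = c p + (\<Sum>p\<in>?ES - {p}. c p)" using p by (intro sum.remove) auto
    moreover have "(\<Sum>p\<in>?ES - {p}. 2) \<le> (\<Sum>p\<in>?ES - {p}. c p)" by (rule sum_mono) (use c2 in blast)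
    moreover have "(\<Sum>p\<in>?ES - {p}. 2) = 2 * (k - 1)" using cardES p by (simp add: card_Diff_singleton)
    ultimately have "c p + 2 * (k - 1) \<le> 2 * k" using sum_c unfolding m_def by linarith
    thus ?thesis using c2[OF p] k by linarith
  qed
  \<comment> \<open>All edges being used exactly twice and each being the edge of a step in
    \<open>New\<close>, a step outside \<open>New\<close> repeats an earlier one, which is what
    \<open>tree_walkI\<close> asks for.\<close>
  have elE: "edge_list (i 0) (steps m i) ! j = E j" if "j < m" for j
    using edge_list_steps[OF that, of i] by (simp add: walk_edge_def E_def)
  have takes: "i ` {..j} = {i 0} \<union> set (take j (steps m i))" if "j < m" for j
  proof -
    have "set (take j (steps m i)) = (\<lambda>s. steps m i ! s) ` {..<j}"
      using that by (simp add: nth_image[symmetric] lessThan_atLeast0)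
    also have "\<dots> = (\<lambda>s. i (Suc s)) ` {..<j}" using that by (intro image_cong) (auto simp: steps_nth)
    also have "{i 0} \<union> \<dots> = i ` {..j}"
    proof -
      have "{..j} = insert 0 (Suc ` {..<j})"
        unfolding lessThan_Suc_atMost[symmetric] by (rule lessThan_Suc_eq_insert_0)
      thus ?thesis by (simp add: image_image)
    qed
    finally show ?thesis by simp
  qed
  have "tree_walk [i 0] {i 0} (steps m i)"
  proof (rule tree_walkI)
    show "distinct [i 0]" "set [i 0] \<subseteq> {i 0}" by simp_all
    fix p
    have "count_list (edge_list (i 0) (steps m i)) p = c p" by (simp add: count_edge_list_steps c_eq)
    moreover have "c p = 0" if "p \<notin> ?ES" using that unfolding c_def by auto
    ultimately show "count_list (edge_list (i 0) (steps m i)) p + count_list (edge_list (i 0) []) p \<in> {0, 2}"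
      using c_eq2[of p] by (cases "p \<in> ?ES") auto
  next
    fix j assume "j < length (steps m i)"
    hence j: "j < m" by simp
    show "steps m i ! j \<notin> {i 0} \<union> set (take j (steps m i)) \<or>
      edge_list (i 0) (steps m i) ! j \<in> set (edge_list (i 0) []) \<union> set (take j (edge_list (i 0) (steps m i)))"
    proof (cases "j \<in> New")
      case True
      hence "steps m i ! j \<notin> i ` {..j}" by (simp add: New_def steps_nth)
      thus ?thesis unfolding takes[OF j] by blast
    next
      case False
      have "E j \<in> E ` New" using img j by auto
      then obtain j' where j': "E j = E j'" "j' \<in> New" by (rule imageE)
      have "j' \<noteq> j" using False j'(2) by metis
      moreover have "\<not> j < j'" using contra[OF _ j'(2,1)] by metis
      ultimately have lt: "j' < j" by simp
      have "take j (edge_list (i 0) (steps m i)) ! j' = E j'" using lt j elE[of j'] by simp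
      moreover have "j' < length (take j (edge_list (i 0) (steps m i)))" using lt j by simp
      ultimately have "E j' \<in> set (take j (edge_list (i 0) (steps m i)))" by (metis nth_mem)
      thus ?thesis using j'(1) elE[OF j] by simp
    qed
  qed
  thus ?thesis unfolding tree_like_def m_def .
qed

lemma tree_walk_last: "tree_walk st U xs \<Longrightarrow> st \<noteq> [] \<Longrightarrow> last (hd st # xs) = last st"
proof (induction xs arbitrary: st U)
  case Nil
  thus ?case by (cases st) auto
next
  case (Cons x xs)
  from Cons.prems consider "tree_walk (x # st) (insert x U) xs" | "tl st \<noteq> []" "x = hd (tl st)" "tree_walk (tl st) U xs"
    by auto
  thus ?case
  proof cases
    case 1
    from Cons.IH[OF this] show ?thesis using Cons.prems(2) by simp
  next
    case 2
    from Cons.IH[OF 2(3,1)] show ?thesis using 2 by (simp add: last_tl)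
  qed
qed

text \<open>The walk is recorded as its starting vertex and the list of vertices after it. A
  depth-first traversal ends at its root, so the last list entry closes the walk by itself.\<close>

lemma card_tree_like_walks:
  assumes m: "m > 0"
  shows "card {i \<in> closed_walks m N. tree_like m i} = N * (ballot m 0 * (\<Prod>t<m div 2. N - 1 - t))"
proof -
  let ?W = "{i \<in> closed_walks m N. tree_like m i}"
  let ?L = "SIGMA v:{..<N}. tree_walks N m [v] {v}"
  define \<Phi> where "\<Phi> i = (i 0, steps m i)" for i :: "nat \<Rightarrow> nat"
  define \<Psi> where "\<Psi> z = (\<lambda>s\<in>{..<m}. (fst z # snd z) ! s)" for z :: "nat \<times> nat list"
  have "bij_betw \<Phi> ?W ?L"
  proof (rule bij_betwI[where g = \<Psi>])
    show "\<Phi> \<in> ?W \<rightarrow> ?L"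
    proof
      fix i assume i: "i \<in> ?W"
      have iN: "i s < N" if "s < m" for s using closed_walk_less[of i m N s] i that by simp
      have "set (steps m i) \<subseteq> {..<N}" unfolding steps_def using iN m by auto
      thus "\<Phi> i \<in> ?L" using i iN[OF m] unfolding \<Phi>_def tree_walks_def tree_like_def by simp
    qed
    show "\<Psi> (\<Phi> i) = i" if i: "i \<in> ?W" for i
    proof (rule PiE_ext[of _ "{..<m}" "\<lambda>_. UNIV" i])
      have ext: "i \<in> extensional {..<m}" using i unfolding closed_walks_def by (simp add: PiE_iff)
      show "i \<in> {..<m} \<rightarrow>\<^sub>E UNIV" using ext by (simp add: PiE_iff)
      show "\<Psi> (\<Phi> i) \<in> {..<m} \<rightarrow>\<^sub>E UNIV" unfolding \<Psi>_def by (simp add: restrict_PiE_iff)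
      fix s assume "s \<in> {..<m}"
      thus "\<Psi> (\<Phi> i) s = i s" unfolding \<Psi>_def \<Phi>_def by (cases s) (simp_all add: steps_nth)
    qed
    have st: "\<Psi> z 0 = fst z \<and> steps m (\<Psi> z) = snd z" if z: "z \<in> ?L" for z
    proof
      have len: "length (snd z) = m" and tw: "tree_walk [fst z] {fst z} (snd z)"
        using z by (auto simp: tree_walks_def)
      show z0: "\<Psi> z 0 = fst z" using m by (simp add: \<Psi>_def)
      have ne: "snd z \<noteq> []" using len m by auto
      have lst: "last (snd z) = fst z" using tree_walk_last[OF tw] ne by simp
      show "steps m (\<Psi> z) = snd z"
      proof (rule nth_equalityI)
        show "length (steps m (\<Psi> z)) = length (snd z)" using len by simp
        fix s assume "s < length (steps m (\<Psi> z))"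
        hence s: "s < m" by simp
        show "steps m (\<Psi> z) ! s = snd z ! s"
        proof (cases "Suc s = m")
          case True
          have "s = length (snd z) - 1" using True len by linarith
          hence "snd z ! s = last (snd z)" using last_conv_nth[OF ne] by simp
          thus ?thesis using True s z0 lst by (simp add: steps_nth)
        next
          case False
          thus ?thesis using s by (simp add: steps_nth \<Psi>_def)
        qed
      qed
    qed
    show "\<Psi> \<in> ?L \<rightarrow> ?W"
    proof
      fix z assume z: "z \<in> ?L"
      have "(fst z # snd z) ! s \<in> {..<N}" if "s < m" for s
      proof -
        have "set (fst z # snd z) \<subseteq> {..<N}" "length (snd z) = m" using z by (auto simp: tree_walks_def)
        thus ?thesis using nth_mem[of s "fst z # snd z"] that by auto
      qed
      hence "\<Psi> z \<in> closed_walks m N" unfolding \<Psi>_def closed_walks_def restrict_PiE_iff by blast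
      moreover have "tree_like m (\<Psi> z)" unfolding tree_like_def using st[OF z] z by (auto simp: tree_walks_def)
      ultimately show "\<Psi> z \<in> ?W" by blast
    qed
    show "\<Phi> (\<Psi> z) = z" if "z \<in> ?L" for z using st[OF that] by (simp add: \<Phi>_def)
  qed
  hence "card ?W = card ?L" by (rule bij_betw_same_card)
  also have "\<dots> = (\<Sum>v<N. card (tree_walks N m [v] {v}))"
    by (intro card_SigmaI) (auto intro: finite_tree_walks)
  also have "\<dots> = (\<Sum>v<N. ballot m 0 * (\<Prod>t<m div 2. N - 1 - t))"
  proof (rule sum.cong[OF refl])
    fix v assume "v \<in> {..<N}"
    thus "card (tree_walks N m [v] {v}) = ballot m 0 * (\<Prod>t<m div 2. N - 1 - t)"
      by (subst card_tree_walks) (simp_all add: One_nat_def del: diff_diff_left)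
  qed
  finally show ?thesis by simp
qed

context ensemble
begin

text \<open>With more than \<open>k\<close> vertices and at least \<open>k\<close> labels, the
  expectation along a walk is 1 if it traverses a tree and 0 otherwise. The remaining walks are
  \<open>O(N ^ k)\<close>, so the limit is the normalised number of tree traversals.\<close>

lemma semicircle_moments:
  assumes q0: "q = 0"
  shows "limit_moment q m = real (ballot m 0)"
proof -
  consider "odd m" | "m = 0" | k where "m = 2 * k" "k > 0"
    by (metis evenE gr0I mult_0_right)
  thus ?thesis
  proof cases
    case 1
    thus ?thesis by (simp add: limit_moment_def ballot_odd)
  next
    case 2
    thus ?thesis by (simp add: limit_moment_def)
  next
    case (3 k)
    let ?m = "2 * k" let ?V = "edges 1 ?m"
    have k: "k > 0" by fact
    define ex where "ex N i = walk_expectation N ?m solo i ?V" for N i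
    define few where "few N = {i \<in> closed_walks ?m N. card (lab N ?m solo i ` ?V) \<le> k - 1} \<union> {i \<in> closed_walks ?m N. card (i ` {..<?m}) \<le> k}" for N
    define B where "B = mu_bound ?m + 1"
    define C where "C = (card (configs ?V) + card ({..<?m} \<rightarrow>\<^sub>E {..<?m})) * 3 ^ k"
    have few_sub: "few N \<subseteq> closed_walks ?m N" for N unfolding few_def by blast
    have card_few: "card (few N) \<le> C * N ^ k" if N: "N \<ge> 1" for N
    proof -
      have m0: "?m > 0" using k by simp
      have "card (few N) \<le> card {i \<in> closed_walks ?m N. card (lab N ?m solo i ` ?V) \<le> k - 1} + card {i \<in> closed_walks ?m N. card (i ` {..<?m}) \<le> k}"
        unfolding few_def by (rule card_Un_le)
      also have "\<dots> \<le> card (configs ?V) * (3 * N) ^ (1 + (k - 1)) + card ({..<?m} \<rightarrow>\<^sub>E {..<?m}) * (3 * N) ^ k"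
        by (intro add_mono card_few_labels_solo[OF m0 N] card_few_vertices[OF N])
      also have "1 + (k - 1) = k" using k by simp
      finally show ?thesis unfolding C_def by (simp add: algebra_simps power_mult_distrib)
    qed
    have good: "ex N i = (if tree_like ?m i then 1 else 0)" if i: "i \<in> closed_walks ?m N" "i \<notin> few N" for N i
    proof -
      let ?l = "lab N ?m solo i" and ?e = "walk_edge ?m solo i"
      have vN: "src solo i v < N" "tgt ?m solo i v < N" if "v \<in> ?V" for v
        using edge_vertices_less[where w = 1 and vt = solo and x = i and m = ?m and N = N and v = v] k i(1) that
        by (auto simp: solo_def)
      show ?thesis
      proof (cases "tree_like ?m i")
        case True
        have ev: "even (card {v \<in> ?V. ?e v = p})" for p by (rule tree_like_even[OF True])
        have sgn: "class_prod (sign_moment q) ?e ?V = 1"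
          unfolding class_prod_def sign_moment_def using ev by (intro prod.neutral) auto
        \<comment> \<open>In a tree traversal each edge recurs, hence so does each label. With at
          least \<open>k\<close> labels on \<open>2 * k\<close> edges all multiplicities are two,
          and the entries contribute powers of \<open>mu 2\<close>.\<close>
        have l2: "2 \<le> card {v' \<in> ?V. ?l v' = ?l v}" if v: "v \<in> ?V" for v
        proof -
          have sub: "{v' \<in> ?V. ?e v' = ?e v} \<subseteq> {v' \<in> ?V. ?l v' = ?l v}"
            using lab_eq_of_walk_edge_eq[of solo i _ N ?m v] vN by blast
          have fin: "finite {v' \<in> ?V. ?l v' = ?l v}" by simp
          have "card {v' \<in> ?V. ?e v' = ?e v} > 0" unfolding card_gt_0_iff
          proof
            show "{v' \<in> ?V. ?e v' = ?e v} \<noteq> {}" using v by blast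
          qed simp
          hence "2 \<le> card {v' \<in> ?V. ?e v' = ?e v}" using ev[of "?e v"] by (auto elim!: evenE)
          thus ?thesis using card_mono[OF fin sub] by linarith
        qed
        have many: "k \<le> card (?l ` ?V)" using i unfolding few_def by auto
        have "card {v' \<in> ?V. ?l v' = r} = 2" if r: "r \<in> ?l ` ?V" for r
        proof -
          let ?F = "\<lambda>r. card {v' \<in> ?V. ?l v' = r}"
          have "2 * k = (\<Sum>r\<in>?l ` ?V. ?F r)"
            using card_image_eq_sum_classes[of ?V ?l] by (simp add: card_edges)
          also have "\<dots> = ?F r + (\<Sum>r\<in>?l ` ?V - {r}. ?F r)" using r by (intro sum.remove) auto
          finally have eq: "2 * k = ?F r + (\<Sum>r\<in>?l ` ?V - {r}. ?F r)" .
          have "(\<Sum>r\<in>?l ` ?V - {r}. 2) \<le> (\<Sum>r\<in>?l ` ?V - {r}. ?F r)"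
            using l2 by (intro sum_mono) auto
          moreover have "card (?l ` ?V - {r}) = card (?l ` ?V) - 1" using r by (simp add: card_Diff_singleton)
          ultimately have "2 * (k - 1) \<le> (\<Sum>r\<in>?l ` ?V - {r}. ?F r)" using many by simp
          moreover have "2 \<le> ?F r" using l2 r by blast
          ultimately show ?thesis using eq k by linarith
        qed
        hence "class_prod mu ?l ?V = 1" unfolding class_prod_def using mu2 by (intro prod.neutral) auto
        thus ?thesis unfolding ex_def walk_expectation_def sgn using True by simp
      next
        case False
        \<comment> \<open>Otherwise the walk would traverse a tree; an edge of odd multiplicity
          contributes the factor \<open>q = 0\<close>.\<close>
        have "\<exists>v\<in>?V. odd (card {v' \<in> ?V. ?e v' = ?e v})"
        proof (rule ccontr)
          assume "\<not> ?thesis"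
          hence "tree_like ?m i" using i unfolding few_def by (intro tree_likeI[OF k]) auto
          thus False using False by blast
        qed
        then obtain v where v: "v \<in> ?V" "odd (card {v' \<in> ?V. ?e v' = ?e v})" by blast
        have "class_prod (sign_moment q) ?e ?V = 0"
          unfolding class_prod_def by (rule prod_zero) (use v q0 in \<open>auto simp: sign_moment_def intro!: bexI[of _ v]\<close>)
        thus ?thesis unfolding ex_def walk_expectation_def using False by simp
      qed
    qed
    have eb: "\<bar>ex N i\<bar> \<le> mu_bound ?m" for N i
      unfolding ex_def by (rule walk_expectation_bound) (simp_all add: card_edges)
    define w where "w N = real (card {i \<in> closed_walks ?m N. tree_like ?m i}) / real N ^ (k + 1)" for N
    have close: "\<bar>expectation (spectral_moment ?m N) - w N\<bar> \<le> B * real C / real N" if N: "N \<ge> 1" for N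
    proof -
      have N0: "N > 0" and rN: "real N > 0" and m0: "?m > 0" using N k by simp_all
      define h where "h i = (if tree_like ?m i then 1 else 0 :: real)" for i
      have den: "real N * sqrt (real N) ^ ?m = real N ^ (k + 1)" by (simp add: power_mult power_add)
      have card_eq: "real (card {i \<in> closed_walks ?m N. tree_like ?m i}) = (\<Sum>i\<in>closed_walks ?m N. h i)"
        unfolding h_def by (simp add: sum.inter_filter[symmetric])
      have "(\<Sum>i\<in>closed_walks ?m N. ex N i) - (\<Sum>i\<in>closed_walks ?m N. h i) = (\<Sum>i\<in>few N. ex N i - h i)"
        unfolding sum_subtractf[symmetric]
        by (rule sum.mono_neutral_right) (use few_sub good in \<open>auto simp: h_def\<close>)
      also have "\<bar>\<dots>\<bar> \<le> (\<Sum>i\<in>few N. \<bar>ex N i - h i\<bar>)" by (rule sum_abs)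
      also have "\<dots> \<le> (\<Sum>i\<in>few N. B)"
      proof (rule sum_mono)
        fix i
        have "\<bar>h i\<bar> \<le> 1" by (simp add: h_def)
        thus "\<bar>ex N i - h i\<bar> \<le> B" unfolding B_def using eb[of N i] by linarith
      qed
      also have "\<dots> = B * real (card (few N))" by simp
      also have "\<dots> \<le> B * real (C * N ^ k)"
      proof (rule mult_left_mono)
        show "real (card (few N)) \<le> real (C * N ^ k)" using card_few[OF N] by (simp only: of_nat_le_iff)
        show "0 \<le> B" unfolding B_def using mu_bound_ge_1[of ?m] by simp
      qed
      finally have *: "\<bar>(\<Sum>i\<in>closed_walks ?m N. ex N i) - (\<Sum>i\<in>closed_walks ?m N. h i)\<bar> \<le> B * real (C * N ^ k)" .
      have "expectation (spectral_moment ?m N) - w N = ((\<Sum>i\<in>closed_walks ?m N. ex N i) - (\<Sum>i\<in>closed_walks ?m N. h i)) / real N ^ (k + 1)"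
        unfolding w_def ex_def card_eq expectation_spectral_moment[OF m0 N0] den by (simp only: diff_divide_distrib)
      hence "\<bar>expectation (spectral_moment ?m N) - w N\<bar> = \<bar>(\<Sum>i\<in>closed_walks ?m N. ex N i) - (\<Sum>i\<in>closed_walks ?m N. h i)\<bar> / real N ^ (k + 1)"
        by (simp only: abs_divide power_abs abs_of_nat)
      also have "\<dots> \<le> B * real (C * N ^ k) / real N ^ (k + 1)" using * by (rule divide_right_mono) simp
      also have "\<dots> = B * real C / real N" using rN by (simp add: power_add)
      finally show ?thesis .
    qed
    have "(\<lambda>N. expectation (spectral_moment ?m N) - w N) \<longlonglongrightarrow> 0"
      by (rule Lim_null_comparison[OF _ lim_const_over_n[of "B * real C"]])
         (use close in \<open>auto intro!: eventually_sequentiallyI[of 1]\<close>)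
    from tendsto_diff[OF moment_limit[of ?m] this] k have w1: "w \<longlonglongrightarrow> limit_moment q ?m" by simp
    have "(\<lambda>N. real (ballot ?m 0) * (\<Prod>t<k. real (N - 1 - t) / real N)) \<longlonglongrightarrow> real (ballot ?m 0) * (\<Prod>t<k. 1)"
    proof (intro tendsto_intros)
      fix t
      have "(\<lambda>N. 1 - real (Suc t) / real N) \<longlonglongrightarrow> 1 - 0" by (intro tendsto_intros lim_const_over_n)
      moreover have "eventually (\<lambda>N. 1 - real (Suc t) / real N = real (N - 1 - t) / real N) sequentially"
        using eventually_ge_at_top[of "Suc t"]
      proof eventually_elim
        case (elim N)
        have "real (N - 1 - t) = real N - real (Suc t)" using elim by simp
        thus ?case using elim by (simp add: diff_divide_distrib)
      qed
      ultimately have "(\<lambda>N. real (N - 1 - t) / real N) \<longlonglongrightarrow> 1 - 0" by (rule Lim_transform_eventually)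
      thus "(\<lambda>N. real (N - 1 - t) / real N) \<longlonglongrightarrow> 1" by simp
    qed
    moreover have "eventually (\<lambda>N. real (ballot ?m 0) * (\<Prod>t<k. real (N - 1 - t) / real N) = w N) sequentially"
      using eventually_ge_at_top[of 1]
    proof eventually_elim
      case (elim N)
      have m0: "?m > 0" using k by simp
      have half: "?m div 2 = k" by simp
      have "w N = real N * (real (ballot ?m 0) * (\<Prod>t<k. real (N - 1 - t))) / real N ^ (k + 1)"
        unfolding w_def card_tree_like_walks[OF m0] half by (simp only: of_nat_mult of_nat_prod)
      also have "\<dots> = real (ballot ?m 0) * ((\<Prod>t<k. real (N - 1 - t)) / real N ^ k)"
        using elim by (simp add: power_add)
      also have "(\<Prod>t<k. real (N - 1 - t)) / real N ^ k = (\<Prod>t<k. real (N - 1 - t) / real N)"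
        by (simp add: prod_dividef)
      finally show ?case ..
    qed
    ultimately have "w \<longlonglongrightarrow> real (ballot ?m 0) * (\<Prod>t<k. 1)" by (rule Lim_transform_eventually)
    hence "w \<longlonglongrightarrow> real (ballot ?m 0)" by simp
    from LIMSEQ_unique[OF w1 this] show ?thesis using 3 by simp
  qed
qed

end

section \<open>The two ensembles\<close>

definition toeplitz_link :: "nat \<Rightarrow> nat \<Rightarrow> nat \<Rightarrow> nat" where
  "toeplitz_link N i j = nat \<bar>int i - int j\<bar>"

definition palindromic_link :: "nat \<Rightarrow> nat \<Rightarrow> nat \<Rightarrow> nat" where
  "palindromic_link N i j = min (nat \<bar>int i - int j\<bar>) (N - 1 - nat \<bar>int i - int j\<bar>)"

lemma link_toeplitz: "link toeplitz_link {0}"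
proof
  fix N i j i' j' :: nat
  show "toeplitz_link N i j = toeplitz_link N i' j' \<longleftrightarrow>
      (\<exists>h\<in>{-1, 1}. \<exists>c\<in>{0}. int j - int i = h * (int j' - int i') + c * (int N - 1))"
    unfolding toeplitz_link_def by auto
qed simp

text \<open>With n = N - 1, the folded distances agree iff the distances are equal or add up to n.
  As both increments are at most n in modulus, this says that one is plus or minus the other, up to
  a shift by -n, 0 or n.\<close>

lemma link_palindromic: "link palindromic_link {-1, 0, 1}"
proof
  fix N i j i' j' :: nat
  assume less: "i < N" "j < N" "i' < N" "j' < N"
  define n d d' where "n = int N - 1" and "d = int j - int i" and "d' = int j' - int i'"
  have bd: "\<bar>d\<bar> \<le> n" "\<bar>d'\<bar> \<le> n" using less by (auto simp: n_def d_def d'_def)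
  have pl: "int (palindromic_link N i j) = min \<bar>d\<bar> (n - \<bar>d\<bar>)" "int (palindromic_link N i' j') = min \<bar>d'\<bar> (n - \<bar>d'\<bar>)"
  proof -
    have pl: "int (palindromic_link N x y) = min \<bar>int y - int x\<bar> (n - \<bar>int y - int x\<bar>)" if "x < N" "y < N" for x y
    proof -
      define a where "a = nat \<bar>int x - int y\<bar>"
      have a: "int a = \<bar>int y - int x\<bar>" by (simp add: a_def abs_minus_commute)
      have "a \<le> N - 1" using a that by linarith
      hence "int (N - 1 - a) = n - int a" using that unfolding n_def by linarith
      thus ?thesis unfolding palindromic_link_def a_def[symmetric] a[symmetric] by (simp add: of_nat_min)
    qed
    show "int (palindromic_link N i j) = min \<bar>d\<bar> (n - \<bar>d\<bar>)" "int (palindromic_link N i' j') = min \<bar>d'\<bar> (n - \<bar>d'\<bar>)"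
      unfolding d_def d'_def using less by (auto intro: pl)
  qed
  have "palindromic_link N i j = palindromic_link N i' j' \<longleftrightarrow> min \<bar>d\<bar> (n - \<bar>d\<bar>) = min \<bar>d'\<bar> (n - \<bar>d'\<bar>)"
    unfolding pl[symmetric] by simp
  also have "\<dots> \<longleftrightarrow> \<bar>d\<bar> = \<bar>d'\<bar> \<or> \<bar>d\<bar> + \<bar>d'\<bar> = n" using bd by (auto simp: min_def)
  also have "\<dots> \<longleftrightarrow> (d = - d' - n \<or> d = - d' \<or> d = - d' + n \<or> d = d' - n \<or> d = d' \<or> d = d' + n)"
    using bd by linarith
  also have "\<dots> \<longleftrightarrow> (\<exists>h\<in>{-1, 1}. \<exists>c\<in>{-1, 0, 1}. d = h * d' + c * n)" by auto
  finally show "palindromic_link N i j = palindromic_link N i' j' \<longleftrightarrow>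
      (\<exists>h\<in>{-1, 1}. \<exists>c\<in>{-1, 0, 1}. int j - int i = h * (int j' - int i') + c * (int N - 1))"
    unfolding n_def d_def d'_def .
qed simp

lemma toeplitz_eq_link: "toeplitz b N = Matrix.mat N N (\<lambda>(i, j). b (toeplitz_link N i j))"
  by (simp add: toeplitz_def toeplitz_link_def)

lemma palindromic_toeplitz_eq_link: "palindromic_toeplitz b N = Matrix.mat N N (\<lambda>(i, j). b (palindromic_link N i j))"
  by (simp add: palindromic_toeplitz_def toeplitz_def palindromic_link_def)

text \<open>The same proof serves any link function: the locale is instantiated once with the given
  signs and once with signs 1, and the two families of limit moments are compared.\<close>

lemma signed_link_ensemble:
  fixes \<pp> :: "real \<Rightarrow> real" and p :: real and M :: "'w measure"
    and b :: "nat \<Rightarrow> 'w \<Rightarrow> real" and \<epsilon> :: "nat \<Rightarrow> nat \<Rightarrow> 'w \<Rightarrow> real"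
    and A S :: "nat \<Rightarrow> 'w \<Rightarrow> real mat" and \<mu> :: "real measure"
  assumes link: "link lnk Cs"
    and dens_nonneg: "\<And>x. 0 \<le> \<pp> x"
    and density_moments: "\<And>k. integrable lborel (\<lambda>x. x ^ k * \<pp> x)"
    and density_mean: "(\<integral>x. x * \<pp> x \<partial>lborel) = 0"
    and density_variance: "(\<integral>x. x\<^sup>2 * \<pp> x \<partial>lborel) = 1"
    and p: "p \<in> {1/2..1}"
    and M: "prob_space M"
    and entries: "\<And>s. distributed M lborel (b s) (\<lambda>x. ennreal (\<pp> x))"
    and signs: "\<And>i j \<omega>. i \<le> j \<Longrightarrow> \<omega> \<in> space M \<Longrightarrow> \<epsilon> i j \<omega> \<in> {-1, 1}"
    and signs_prob: "\<And>i j. i \<le> j \<Longrightarrow> measure M {\<omega> \<in> space M. \<epsilon> i j \<omega> = 1} = p"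
    and indep: "prob_space.indep_vars M (\<lambda>_. borel)
                  (case_sum b (\<lambda>(i, j). \<epsilon> i j)) (UNIV <+> {(i, j). i \<le> j})"
    and A_def: "A = (\<lambda>N \<omega>. Matrix.mat N N (\<lambda>(i, j). b (lnk N i j) \<omega>))"
    and S_def: "S = (\<lambda>N \<omega>. hadamard (A N \<omega>) (sign_matrix (\<lambda>i j. \<epsilon> i j \<omega>) N))"
    and unsigned_limit: "limiting_rescaled_spectral_measure M A \<mu>"
  shows "(p = 1/2 \<longrightarrow> limiting_rescaled_spectral_measure M S semicircle) \<and>
         (p \<noteq> 1/2 \<longrightarrow>
           (\<exists>\<nu>. limiting_rescaled_spectral_measure M S \<nu> \<and>
                (bounded (measure_support \<mu>) \<longleftrightarrow> bounded (measure_support \<nu>)) \<and>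
                spectral_measures_converge_ae M S \<nu>))"
proof -
  interpret link lnk Cs by fact
  interpret prob_space M by fact
  define mu where "mu k = (\<integral>x. x ^ k * \<pp> x \<partial>lborel)" for k
  define q where "q = 2 * p - 1"
  have q: "0 \<le> q" "q \<le> 1" using p by (auto simp: q_def)
  have b_int: "integrable M (\<lambda>\<omega>. b s \<omega> ^ k)" for s k
    using distributed_integrable[OF entries, of "\<lambda>x. x ^ k" s] density_moments[of k] dens_nonneg
    by (simp add: mult.commute)
  have b_mom: "expectation (\<lambda>\<omega>. b s \<omega> ^ k) = mu k" for s k
    using distributed_integral[OF entries, of "\<lambda>x. x ^ k" s] dens_nonneg
    by (simp add: mu_def mult.commute)
  have mu12: "mu 1 = 0" "mu 2 = 1" using density_mean density_variance by (simp_all add: mu_def)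
  have e_meas: "\<epsilon> i j \<in> borel_measurable M" if "i \<le> j" for i j
    using indep that unfolding indep_vars_def2 by (auto dest!: bspec[of _ _ "Inr (i, j)"])
  have e_mean: "expectation (\<epsilon> i j) = q" if ij: "i \<le> j" for i j
  proof -
    note [measurable] = e_meas[OF ij]
    define E where "E = {\<omega> \<in> space M. \<epsilon> i j \<omega> = 1}"
    have E: "E \<in> events" unfolding E_def by measurable
    have "expectation (\<epsilon> i j) = expectation (\<lambda>\<omega>. 2 * indicator E \<omega> - 1)"
      using signs[OF ij] by (intro Bochner_Integration.integral_cong) (auto simp: E_def indicator_def)
    also have "\<dots> = 2 * prob E - 1" using E prob_space by (simp add: emeasure_eq_measure)
    finally show ?thesis using signs_prob[OF ij] by (simp add: E_def q_def)
  qed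
  interpret sg: ensemble lnk Cs M b \<epsilon> mu q
    by unfold_locales (use indep b_int b_mom mu12 signs e_mean q in auto)
  \<comment> \<open>Applying a constant function to each sign preserves independence of the
    family.\<close>
  have indep1: "indep_vars (\<lambda>_. borel) (case_sum b (\<lambda>(i::nat, j::nat) \<omega>. 1::real)) (UNIV <+> {(i, j). i \<le> j})"
  proof -
    have "indep_vars (\<lambda>_. borel) (\<lambda>y \<omega>. (case y of Inl l \<Rightarrow> (\<lambda>z. z) | Inr r \<Rightarrow> (\<lambda>z. 1)) (case_sum b (\<lambda>(i, j). \<epsilon> i j) y \<omega>))
       (UNIV <+> {(i, j). i \<le> j})"
      by (rule indep_vars_compose2[OF indep]) (auto split: sum.split)
    also have "(\<lambda>y \<omega>. (case y of Inl l \<Rightarrow> (\<lambda>z. z) | Inr r \<Rightarrow> (\<lambda>z. 1)) (case_sum b (\<lambda>(i, j). \<epsilon> i j) y \<omega>))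
        = case_sum b (\<lambda>(i::nat, j::nat) \<omega>. 1::real)"
      by (auto simp: fun_eq_iff split: sum.split)
    finally show ?thesis .
  qed
  interpret un: ensemble lnk Cs M b "\<lambda>i j \<omega>. 1" mu 1
    by unfold_locales (use indep1 b_int b_mom mu12 prob_space in auto)
  have S: "S = sg.random_mat"
  proof (intro ext)
    fix N \<omega>
    show "S N \<omega> = sg.random_mat N \<omega>"
      unfolding S_def A_def hadamard_def sign_matrix_def sg.random_mat_def sg.entry_def
      by (rule eq_matI) auto
  qed
  have A: "A = un.random_mat"
    unfolding A_def un.random_mat_def[abs_def] un.entry_def by simp
  obtain \<nu> where \<nu>: "real_distribution \<nu>" "\<And>k. integrable \<nu> (\<lambda>x. x ^ k)" "\<And>k. moment \<nu> k = limit_moment q k"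
    and lim: "limiting_rescaled_spectral_measure M S \<nu>" and ae: "spectral_measures_converge_ae M S \<nu>"
    using sg.limiting_measure unfolding S by blast
  have \<mu>d: "real_distribution \<mu>" and \<mu>int: "integrable \<mu> (\<lambda>x. x ^ k)" for k
  proof -
    show d: "real_distribution \<mu>"
      using unsigned_limit unfolding limiting_rescaled_spectral_measure_def moment_determined_def by blast
    interpret \<mu>: real_distribution \<mu> by (rule d)
    show "integrable \<mu> (\<lambda>x. x ^ k)"
    proof (cases "k = 0")
      case False
      hence "k \<ge> 1" by simp
      thus ?thesis using unsigned_limit unfolding limiting_rescaled_spectral_measure_def moment_determined_def by blast
    qed simp
  qed
  \<comment> \<open>The unsigned limit is given abstractly; uniqueness of limits identifies its
    moments with the computed ones.\<close>
  have \<mu>m: "moment \<mu> k = limit_moment 1 k" if "k \<ge> 1" for k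
  proof (rule LIMSEQ_unique)
    show "(\<lambda>N. \<integral>\<omega>. moment (rescaled_spectral_measure (A N \<omega>)) k \<partial>M) \<longlonglongrightarrow> moment \<mu> k"
      using unsigned_limit that unfolding limiting_rescaled_spectral_measure_def by blast
    show "(\<lambda>N. \<integral>\<omega>. moment (rescaled_spectral_measure (A N \<omega>)) k \<partial>M) \<longlonglongrightarrow> limit_moment 1 k"
      using un.moment_limit[OF that] unfolding A un.spectral_moment_def[abs_def] .
  qed
  have \<mu>2: "moment \<mu> (2 * k) = limit_moment 1 (2 * k)" for k
  proof (cases "k = 0")
    case True
    interpret \<mu>: real_distribution \<mu> by (rule \<mu>d)
    show ?thesis using True \<mu>.prob_space by (simp add: moment_def limit_moment_def)
  qed (simp add: \<mu>m)
  show ?thesis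
  proof (intro conjI impI)
    assume "p = 1/2"
    hence q0: "q = 0" by (simp add: q_def)
    have "\<nu> = semicircle"
    proof (rule moments_determine[OF \<nu>(1,2) semicircle_distribution semicircle_integrable])
      show "moment \<nu> k = moment semicircle k" for k
        unfolding \<nu>(3) sg.semicircle_moments[OF q0] moment_semicircle ..
      show "(\<lambda>k. t ^ (2 * k) * moment \<nu> (2 * k) / fact (2 * k)) \<longlonglongrightarrow> 0" for t
        unfolding \<nu>(3) by (rule limit_moment_growth[OF q])
    qed
    thus "limiting_rescaled_spectral_measure M S semicircle" using lim by simp
  next
    assume "p \<noteq> 1/2"
    hence q0: "q > 0" using p by (simp add: q_def)
    have "bounded (measure_support \<mu>) \<longleftrightarrow> bounded (measure_support \<nu>)"
      unfolding bounded_support_iff_moments[OF \<mu>d \<mu>int] bounded_support_iff_moments[OF \<nu>(1,2)] \<mu>2 \<nu>(3)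
    proof
      assume "\<exists>R. \<forall>k. limit_moment 1 (2 * k) \<le> R ^ (2 * k)"
      thus "\<exists>R. \<forall>k. limit_moment q (2 * k) \<le> R ^ (2 * k)" using limit_moment_compare(2)[OF q] order.trans by blast
    next
      assume "\<exists>R. \<forall>k. limit_moment q (2 * k) \<le> R ^ (2 * k)"
      then obtain R where R: "\<And>k. limit_moment q (2 * k) \<le> R ^ (2 * k)" by blast
      \<comment> \<open>The loss of \<open>q ^ (2 * k)\<close> in the comparison is exponential, so
        it only enlarges the radius from \<open>R\<close> to \<open>R / q\<close>.\<close>
      have "limit_moment 1 (2 * k) \<le> (R / q) ^ (2 * k)" for k
      proof -
        have "q ^ (2 * k) * limit_moment 1 (2 * k) \<le> R ^ (2 * k)"
          using limit_moment_compare(1)[OF q, of k] R[of k] by linarith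
        thus ?thesis using q0 unfolding power_divide by (subst pos_le_divide_eq) (auto simp: mult.commute)
      qed
      thus "\<exists>R. \<forall>k. limit_moment 1 (2 * k) \<le> R ^ (2 * k)" by blast
    qed
    thus "\<exists>\<nu>. limiting_rescaled_spectral_measure M S \<nu> \<and>
                (bounded (measure_support \<mu>) \<longleftrightarrow> bounded (measure_support \<nu>)) \<and>
                spectral_measures_converge_ae M S \<nu>"
      using lim ae by blast
  qed
qed

theorem corollary1p4:
  fixes \<pp> :: "real \<Rightarrow> real"
    and p :: real
    and M :: "'w measure"
    and b :: "nat \<Rightarrow> 'w \<Rightarrow> real"
    and \<epsilon> :: "nat \<Rightarrow> nat \<Rightarrow> 'w \<Rightarrow> real"
    and T :: "(nat \<Rightarrow> real) \<Rightarrow> nat \<Rightarrow> real mat"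
    and A S :: "nat \<Rightarrow> 'w \<Rightarrow> real mat"
    and \<mu> :: "real measure"
  assumes ensemble: "T = toeplitz \<or> T = palindromic_toeplitz"
    and density_meas: "\<pp> \<in> borel_measurable borel"
    and density_nonneg: "\<And>x. 0 \<le> \<pp> x"
    and density_moments: "\<And>k. integrable lborel (\<lambda>x. x ^ k * \<pp> x)"
    and density_mass: "(\<integral>x. \<pp> x \<partial>lborel) = 1"
    and density_mean: "(\<integral>x. x * \<pp> x \<partial>lborel) = 0"
    and density_variance: "(\<integral>x. x\<^sup>2 * \<pp> x \<partial>lborel) = 1"
    and p: "p \<in> {1/2..1}"
    and M: "prob_space M"
    and entries: "\<And>s. distributed M lborel (b s) (\<lambda>x. ennreal (\<pp> x))"
    and signs: "\<And>i j \<omega>. i \<le> j \<Longrightarrow> \<omega> \<in> space M \<Longrightarrow> \<epsilon> i j \<omega> \<in> {-1, 1}"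
    and signs_prob: "\<And>i j. i \<le> j \<Longrightarrow> measure M {\<omega> \<in> space M. \<epsilon> i j \<omega> = 1} = p"
    and indep: "prob_space.indep_vars M (\<lambda>_. borel)
                  (case_sum b (\<lambda>(i, j). \<epsilon> i j)) (UNIV <+> {(i, j). i \<le> j})"
    and A_def: "A = (\<lambda>N \<omega>. T (\<lambda>s. b s \<omega>) N)"
    and S_def: "S = (\<lambda>N \<omega>. hadamard (A N \<omega>) (sign_matrix (\<lambda>i j. \<epsilon> i j \<omega>) N))"
    and unsigned_limit: "limiting_rescaled_spectral_measure M A \<mu>"
  shows "(p = 1/2 \<longrightarrow> limiting_rescaled_spectral_measure M S semicircle) \<and>
         (p \<noteq> 1/2 \<longrightarrow>
           (\<exists>\<nu>. limiting_rescaled_spectral_measure M S \<nu> \<and>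
                (bounded (measure_support \<mu>) \<longrightarrow> bounded (measure_support \<nu>)) \<and>
                (\<not> bounded (measure_support \<mu>) \<longrightarrow> \<not> bounded (measure_support \<nu>)) \<and>
                ((\<forall>x. \<pp> (- x) = \<pp> x) \<longrightarrow> spectral_measures_converge_ae M S \<nu>)))"
proof -
  \<comment> \<open>The two ensembles differ only in their link functions, after which no case
    distinction remains.\<close>
  have meets: "\<exists>lnk Cs. link lnk Cs \<and> (\<forall>b N. T b N = Matrix.mat N N (\<lambda>(i, j). b (lnk N i j)))"
    using ensemble link_toeplitz toeplitz_eq_link link_palindromic palindromic_toeplitz_eq_link by metis
  then obtain lnk Cs where link: "link lnk Cs" and T: "\<And>b N. T b N = Matrix.mat N N (\<lambda>(i, j). b (lnk N i j))"
    by blast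
  have "A = (\<lambda>N \<omega>. Matrix.mat N N (\<lambda>(i, j). b (lnk N i j) \<omega>))" unfolding A_def T ..
  from signed_link_ensemble[OF link density_nonneg density_moments density_mean density_variance p M entries signs
      signs_prob indep this S_def unsigned_limit]
  show ?thesis by blast
qed

end
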